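(* Let $H$ be a left or right Noetherian Hopf algebra over a field $\Bbbk$. Then the following conditions are equivalent: (a) $H$ is affine; (b) the Hopf coradical $H_{[0]}$ is affine; (c) the coradical $H_{(0)}$ is contained in an affine Hopf subalgebra of $H$. In this case (i.e. when these equivalent conditions hold), any Hopf subalgebra of $H$ containing $H_{(0)}$ is also affine.
   Context: A $\Bbbk$-algebra is called affine if it is finitely generated as a $\Bbbk$-algebra. The coradical $H_{(0)}$ of a Hopf algebra $H$ is the sum of all simple subcoalgebras of $H$. The Hopf coradical $H_{[0]}$ is the subalgebra of $H$ generated by $H_{(0)}$. The field $\Bbbk$ is arbitrary. (By a theorem of Skryabin, the antipode of a left or right Noetherian Hopf algebra is injective, and hence $H_{[0]}$ is a Hopf subalgebra of $H$.) *)

theory Defs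
  imports Complex_Main "HOL-Library.Poly_Mapping"
begin

section \<open>Free vector spaces and tensor products\<close>

text \<open>
  The finitely supported functions \<^typ>\<open>'x \<Rightarrow>\<^sub>0 'k\<close> form the free \<open>'k\<close>-vector space on \<open>'x\<close>,
  with basis vectors \<open>Poly_Mapping.single x 1\<close>.
\<close>

definition fscale :: "'k::field \<Rightarrow> ('x \<Rightarrow>\<^sub>0 'k) \<Rightarrow> ('x \<Rightarrow>\<^sub>0 'k)"
  where "fscale c p = Poly_Mapping.map ((*) c) p"

lemma lookup_fscale [simp]: "Poly_Mapping.lookup (fscale c p) x = c * Poly_Mapping.lookup p x"
  by (simp add: fscale_def Poly_Mapping.map.rep_eq when_def)

lemma vector_space_fscale: "vector_space fscale"
  by unfold_locales (auto intro!: poly_mapping_eqI simp: lookup_add algebra_simps)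

text \<open>The linear map on the free vector space that extends \<open>f\<close>.\<close>

definition lin_ext :: "('k::field \<Rightarrow> 'v::ab_group_add \<Rightarrow> 'v) \<Rightarrow> ('x \<Rightarrow> 'v) \<Rightarrow> ('x \<Rightarrow>\<^sub>0 'k) \<Rightarrow> 'v"
  where "lin_ext scale f p = (\<Sum>x\<in>Poly_Mapping.keys p. scale (Poly_Mapping.lookup p x) (f x))"

text \<open>
  For a vector space \<open>V\<close>, the tensor powers \<open>V \<otimes> V\<close> and \<open>V \<otimes> V \<otimes> V\<close> are the quotients of
  the free vector spaces on \<open>V \<times> V\<close> and \<open>V \<times> V \<times> V\<close> by the relations of multilinearity.
\<close>

definition tensor_null ::
    "('k::field \<Rightarrow> 'v::ab_group_add \<Rightarrow> 'v) \<Rightarrow> ('v \<times> 'v \<Rightarrow>\<^sub>0 'k) set"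
  where "tensor_null scale = module.span fscale
    ({Poly_Mapping.single (x + x', y) 1 - Poly_Mapping.single (x, y) 1
        - Poly_Mapping.single (x', y) 1 | x x' y. True}
     \<union> {Poly_Mapping.single (x, y + y') 1 - Poly_Mapping.single (x, y) 1
        - Poly_Mapping.single (x, y') 1 | x y y'. True}
     \<union> {Poly_Mapping.single (scale c x, y) 1 - Poly_Mapping.single (x, y) c | c x y. True}
     \<union> {Poly_Mapping.single (x, scale c y) 1 - Poly_Mapping.single (x, y) c | c x y. True})"

definition tensor3_null ::
    "('k::field \<Rightarrow> 'v::ab_group_add \<Rightarrow> 'v) \<Rightarrow> ('v \<times> 'v \<times> 'v \<Rightarrow>\<^sub>0 'k) set"
  where "tensor3_null scale = module.span fscale
    ({Poly_Mapping.single (x + x', y, z) 1 - Poly_Mapping.single (x, y, z) 1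
        - Poly_Mapping.single (x', y, z) 1 | x x' y z. True}
     \<union> {Poly_Mapping.single (x, y + y', z) 1 - Poly_Mapping.single (x, y, z) 1
        - Poly_Mapping.single (x, y', z) 1 | x y y' z. True}
     \<union> {Poly_Mapping.single (x, y, z + z') 1 - Poly_Mapping.single (x, y, z) 1
        - Poly_Mapping.single (x, y, z') 1 | x y z z'. True}
     \<union> {Poly_Mapping.single (scale c x, y, z) 1 - Poly_Mapping.single (x, y, z) c | c x y z. True}
     \<union> {Poly_Mapping.single (x, scale c y, z) 1 - Poly_Mapping.single (x, y, z) c | c x y z. True}
     \<union> {Poly_Mapping.single (x, y, scale c z) 1 - Poly_Mapping.single (x, y, z) c | c x y z. True})"

definition tensor_square ::
    "('k::field \<Rightarrow> 'v::ab_group_add \<Rightarrow> 'v) \<Rightarrow> ('v \<times> 'v \<Rightarrow>\<^sub>0 'k) set set"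
  where "tensor_square scale = UNIV // {(p, q). p - q \<in> tensor_null scale}"

text \<open>For a subspace \<open>C\<close> of \<open>V\<close>, the image of \<open>C \<otimes> C\<close> in \<open>V \<otimes> V\<close>.\<close>

definition tensor_square_image ::
    "('k::field \<Rightarrow> 'v::ab_group_add \<Rightarrow> 'v) \<Rightarrow> 'v set \<Rightarrow> ('v \<times> 'v \<Rightarrow>\<^sub>0 'k) set set"
  where "tensor_square_image scale C =
    {t \<in> tensor_square scale. \<exists>p\<in>t. Poly_Mapping.keys p \<subseteq> C \<times> C}"


section \<open>Hopf algebras\<close>

text \<open>The product of \<open>A \<otimes> A\<close> for an algebra \<open>A\<close>, on representatives:
  \<open>(a \<otimes> b) (c \<otimes> d) = a c \<otimes> b d\<close>.\<close>

definition tensor_mult ::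
    "('a::ring_1 \<times> 'a \<Rightarrow>\<^sub>0 'k::field) \<Rightarrow> ('a \<times> 'a \<Rightarrow>\<^sub>0 'k) \<Rightarrow> ('a \<times> 'a \<Rightarrow>\<^sub>0 'k)"
  where "tensor_mult p q =
    lin_ext fscale (\<lambda>(a, b). lin_ext fscale (\<lambda>(c, d). Poly_Mapping.single (a * c, b * d) 1) q) p"

text \<open>The maps \<open>\<Delta> \<otimes> id\<close> and \<open>id \<otimes> \<Delta>\<close> from \<open>V \<otimes> V\<close> to \<open>V \<otimes> V \<otimes> V\<close>, on representatives;
  here \<open>\<delta> a\<close> is a representative of \<open>\<Delta> a\<close>.\<close>

definition comult_tensor_id ::
    "('v \<Rightarrow> ('v \<times> 'v \<Rightarrow>\<^sub>0 'k::field)) \<Rightarrow> ('v \<times> 'v \<Rightarrow>\<^sub>0 'k) \<Rightarrow> ('v \<times> 'v \<times> 'v \<Rightarrow>\<^sub>0 'k)"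
  where "comult_tensor_id \<delta> p =
    lin_ext fscale (\<lambda>(a, b). lin_ext fscale (\<lambda>(a', a''). Poly_Mapping.single (a', a'', b) 1) (\<delta> a)) p"

definition id_tensor_comult ::
    "('v \<Rightarrow> ('v \<times> 'v \<Rightarrow>\<^sub>0 'k::field)) \<Rightarrow> ('v \<times> 'v \<Rightarrow>\<^sub>0 'k) \<Rightarrow> ('v \<times> 'v \<times> 'v \<Rightarrow>\<^sub>0 'k)"
  where "id_tensor_comult \<delta> p =
    lin_ext fscale (\<lambda>(a, b). lin_ext fscale (\<lambda>(b', b''). Poly_Mapping.single (a, b', b'') 1) (\<delta> b)) p"

text \<open>
  The underlying ring of the Hopf algebra is the whole type \<open>'h\<close>. The axiom
  \<open>counit 1 = 1\<close> forces \<open>0 \<noteq> 1\<close>, so the class \<^class>\<open>ring_1\<close> excludes nothing.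
  The comultiplication takes values in the quotient \<^term>\<open>tensor_square scale\<close>; its axioms
  are stated for all representatives \<open>p \<in> comult x\<close> of its values. The antipode is not assumed to be bijective.
\<close>

locale hopf_algebra = vector_space scale
  for scale :: "'k::field \<Rightarrow> 'h::ring_1 \<Rightarrow> 'h" +
  fixes comult :: "'h \<Rightarrow> ('h \<times> 'h \<Rightarrow>\<^sub>0 'k) set"
    and counit :: "'h \<Rightarrow> 'k"
    and antipode :: "'h \<Rightarrow> 'h"
  assumes scale_mult_left: "scale c x * y = scale c (x * y)"
    and scale_mult_right: "x * scale c y = scale c (x * y)"
    and comult_closed: "comult x \<in> tensor_square scale"
    and comult_add: "p \<in> comult x \<Longrightarrow> q \<in> comult y \<Longrightarrow> p + q \<in> comult (x + y)"
    and comult_scale: "p \<in> comult x \<Longrightarrow> fscale c p \<in> comult (scale c x)"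
    and counit_linear: "Vector_Spaces.linear scale (*) counit"
    and antipode_linear: "Vector_Spaces.linear scale scale antipode"
    and coassoc: "(\<And>a. \<delta> a \<in> comult a) \<Longrightarrow>
      comult_tensor_id \<delta> (\<delta> x) - id_tensor_comult \<delta> (\<delta> x) \<in> tensor3_null scale"
    and counit_left: "p \<in> comult x \<Longrightarrow> lin_ext scale (\<lambda>(a, b). scale (counit a) b) p = x"
    and counit_right: "p \<in> comult x \<Longrightarrow> lin_ext scale (\<lambda>(a, b). scale (counit b) a) p = x"
    and comult_mult: "p \<in> comult x \<Longrightarrow> q \<in> comult y \<Longrightarrow> tensor_mult p q \<in> comult (x * y)"
    and comult_one: "Poly_Mapping.single (1, 1) 1 \<in> comult 1"
    and counit_mult: "counit (x * y) = counit x * counit y"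
    and counit_one: "counit 1 = 1"
    and antipode_left: "p \<in> comult x \<Longrightarrow>
      lin_ext scale (\<lambda>(a, b). antipode a * b) p = scale (counit x) 1"
    and antipode_right: "p \<in> comult x \<Longrightarrow>
      lin_ext scale (\<lambda>(a, b). a * antipode b) p = scale (counit x) 1"


section \<open>Noetherian rings and affine algebras\<close>

definition left_ideal :: "'a::ring_1 set \<Rightarrow> bool"
  where "left_ideal I \<longleftrightarrow>
    0 \<in> I \<and> (\<forall>x\<in>I. \<forall>y\<in>I. x + y \<in> I) \<and> (\<forall>r. \<forall>x\<in>I. r * x \<in> I)"

definition right_ideal :: "'a::ring_1 set \<Rightarrow> bool"
  where "right_ideal I \<longleftrightarrow>
    0 \<in> I \<and> (\<forall>x\<in>I. \<forall>y\<in>I. x + y \<in> I) \<and> (\<forall>r. \<forall>x\<in>I. x * r \<in> I)"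

definition left_noetherian :: "'a::ring_1 itself \<Rightarrow> bool"
  where "left_noetherian _ \<longleftrightarrow>
    (\<forall>I :: 'a set. left_ideal I \<longrightarrow> (\<exists>F. finite F \<and> I = left_ideal hull F))"

definition right_noetherian :: "'a::ring_1 itself \<Rightarrow> bool"
  where "right_noetherian _ \<longleftrightarrow>
    (\<forall>I :: 'a set. right_ideal I \<longrightarrow> (\<exists>F. finite F \<and> I = right_ideal hull F))"

definition subalgebra :: "('k::field \<Rightarrow> 'a::ring_1 \<Rightarrow> 'a) \<Rightarrow> 'a set \<Rightarrow> bool"
  where "subalgebra scale A \<longleftrightarrow>
    module.subspace scale A \<and> 1 \<in> A \<and> (\<forall>x\<in>A. \<forall>y\<in>A. x * y \<in> A)"

definition affine_algebra :: "('k::field \<Rightarrow> 'a::ring_1 \<Rightarrow> 'a) \<Rightarrow> 'a set \<Rightarrow> bool"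
  where "affine_algebra scale A \<longleftrightarrow>
    subalgebra scale A \<and> (\<exists>F. finite F \<and> A = subalgebra scale hull F)"


section \<open>The coradical and the Hopf coradical\<close>

definition subcoalgebra ::
    "('k::field \<Rightarrow> 'h::ring_1 \<Rightarrow> 'h) \<Rightarrow> ('h \<Rightarrow> ('h \<times> 'h \<Rightarrow>\<^sub>0 'k) set) \<Rightarrow> 'h set \<Rightarrow> bool"
  where "subcoalgebra scale comult C \<longleftrightarrow>
    module.subspace scale C \<and> (\<forall>x\<in>C. comult x \<in> tensor_square_image scale C)"

definition simple_subcoalgebra ::
    "('k::field \<Rightarrow> 'h::ring_1 \<Rightarrow> 'h) \<Rightarrow> ('h \<Rightarrow> ('h \<times> 'h \<Rightarrow>\<^sub>0 'k) set) \<Rightarrow> 'h set \<Rightarrow> bool"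
  where "simple_subcoalgebra scale comult C \<longleftrightarrow>
    subcoalgebra scale comult C \<and> C \<noteq> {0}
    \<and> (\<forall>D. subcoalgebra scale comult D \<and> D \<subseteq> C \<longrightarrow> D = {0} \<or> D = C)"

definition coradical ::
    "('k::field \<Rightarrow> 'h::ring_1 \<Rightarrow> 'h) \<Rightarrow> ('h \<Rightarrow> ('h \<times> 'h \<Rightarrow>\<^sub>0 'k) set) \<Rightarrow> 'h set"
  where "coradical scale comult = module.span scale (\<Union>{C. simple_subcoalgebra scale comult C})"

definition hopf_coradical ::
    "('k::field \<Rightarrow> 'h::ring_1 \<Rightarrow> 'h) \<Rightarrow> ('h \<Rightarrow> ('h \<times> 'h \<Rightarrow>\<^sub>0 'k) set) \<Rightarrow> 'h set"
  where "hopf_coradical scale comult = subalgebra scale hull coradical scale comult"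

definition hopf_subalgebra ::
    "('k::field \<Rightarrow> 'h::ring_1 \<Rightarrow> 'h) \<Rightarrow> ('h \<Rightarrow> ('h \<times> 'h \<Rightarrow>\<^sub>0 'k) set) \<Rightarrow> ('h \<Rightarrow> 'h) \<Rightarrow> 'h set \<Rightarrow> bool"
  where "hopf_subalgebra scale comult antipode A \<longleftrightarrow>
    subalgebra scale A \<and> subcoalgebra scale comult A \<and> antipode ` A \<subseteq> A"

end

theory Submission
  imports Defs "HOL-Library.Function_Algebras"
begin

text \<open>
  Let \<open>K\<close> be a Hopf subalgebra containing the coradical, and \<open>B \<supseteq> K\<close> a subbialgebra. The wedge
  powers of \<open>K\<close> exhaust \<open>H\<close>; hence \<open>S(B) \<subseteq> B\<close> (Takeuchi), and, since the successive quotients are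
  Hopf modules over \<open>K\<close>, there is a right \<open>K\<close>-linear retraction \<open>p : H \<rightarrow> K\<close>. The map
  \<open>x \<mapsto> x\<^sub>1 S(p(x\<^sub>2))\<close> kills \<open>H K\<^sup>+\<close>. If \<open>H K\<^sup>+ = H B\<^sup>+\<close>, it follows that \<open>S p = S\<close> on \<open>B\<close>, and so
  \<open>B = K\<close> because \<open>S\<close> is injective (one-sided inverses of matrices over a Noetherian
  ring are two-sided). As \<open>H B\<^sup>+\<close> is finitely generated, \<open>B\<close> is generated by \<open>K\<close> and
  finitely many elements.

  Conversely, if \<open>H\<close> is generated by a finite-dimensional subcoalgebra \<open>C\<close>, the wedge powers of the
  algebra \<open>A\<close> generated by \<open>C \<inter> H\<^sub>(\<^sub>0\<^sub>)\<close> form an exhaustive algebra and coalgebra filtration, so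
  \<open>H\<^sub>(\<^sub>0\<^sub>) \<subseteq> A\<close>.
\<close>


section \<open>Linear maps and functionals\<close>

text \<open>The antipode is not assumed bijective, and faithful flatness over \<open>K\<close> is
  not invoked. The retraction takes over its work: it makes a Hopf subalgebra containing the
  coradical recoverable from the left ideal generated by its augmentation kernel. In that step the
  smaller algebra is not the given Hopf subalgebra but the one generated by it and a
  finite-dimensional subcoalgebra. A priori this is only a subbialgebra; stability under
  \<open>S\<close> is needed to form the Hopf module projections that build its retraction, hence
  Takeuchi's argument. Over an arbitrary field the exhaustion by wedge powers rests on the structure
  of finite-dimensional dual algebras, for which the needed piece of Artinian ring theory is
  developed by hand. Injectivity of \<open>S\<close> is used a second time: it makes
  \<open>S\<close> send simple subcoalgebras to simple ones, so that the Hopf coradical is a Hopf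
  subalgebra.\<close>

abbreviation lin :: "('k::field \<Rightarrow> 'a::ab_group_add \<Rightarrow> 'a) \<Rightarrow> ('k \<Rightarrow> 'b::ab_group_add \<Rightarrow> 'b) \<Rightarrow> ('a \<Rightarrow> 'b) \<Rightarrow> bool"
  where "lin \<equiv> Vector_Spaces.linear"

definition bilin :: "('k::field \<Rightarrow> 'a::ab_group_add \<Rightarrow> 'a) \<Rightarrow> ('k \<Rightarrow> 'b::ab_group_add \<Rightarrow> 'b) \<Rightarrow> ('a \<Rightarrow> 'a \<Rightarrow> 'b) \<Rightarrow> bool"
  where "bilin s s' \<phi> \<longleftrightarrow> (\<forall>b. lin s s' (\<lambda>a. \<phi> a b)) \<and> (\<forall>a. lin s s' (\<phi> a))"

lemma linI:
  assumes "vector_space s" "vector_space s'"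
    and "\<And>x y. f (x + y) = f x + f y" "\<And>c x. f (s c x) = s' c (f x)"
  shows "lin s s' f"
  using assms by (simp add: Vector_Spaces.linear_def module_hom_def module_hom_axioms_def
      module_iff_vector_space)

lemma linD:
  assumes "lin s s' f"
  shows "vector_space s" "vector_space s'" "f (x + y) = f x + f y" "f (s c x) = s' c (f x)"
    "f 0 = 0" "f (x - y) = f x - f y" "f (- x) = - f x" "f (sum g A) = (\<Sum>i\<in>A. f (g i))"
proof -
  interpret Vector_Spaces.linear s s' f by fact
  show "vector_space s" "vector_space s'" "f (x + y) = f x + f y" "f (s c x) = s' c (f x)"
    "f 0 = 0" "f (x - y) = f x - f y" "f (- x) = - f x" "f (sum g A) = (\<Sum>i\<in>A. f (g i))"
    by (simp_all add: vs1.vector_space_axioms vs2.vector_space_axioms add scale zero diff neg sum)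
qed

lemma bilinI:
  "(\<And>b. lin s s' (\<lambda>a. \<phi> a b)) \<Longrightarrow> (\<And>a. lin s s' (\<phi> a)) \<Longrightarrow> bilin s s' \<phi>"
  by (simp add: bilin_def)

lemma bilinD:
  assumes "bilin s s' \<phi>"
  shows "lin s s' (\<lambda>a. \<phi> a b)" "lin s s' (\<phi> a)"
  using assms by (auto simp: bilin_def)

lemma vector_space_times: "vector_space ((*) :: 'k::field \<Rightarrow> 'k \<Rightarrow> 'k)"
  by unfold_locales (auto simp: algebra_simps)

lemma lin_comp: "lin s' s'' f \<Longrightarrow> lin s s' g \<Longrightarrow> lin s s'' (\<lambda>x. f (g x))"
  by (rule linI) (auto simp: linD)

lemma lin_bilin1: "bilin s' s'' \<phi> \<Longrightarrow> lin s s' g \<Longrightarrow> lin s s'' (\<lambda>x. \<phi> (g x) c)"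
  using lin_comp[OF bilinD(1)] .

lemma lin_bilin2: "bilin s' s'' \<phi> \<Longrightarrow> lin s s' g \<Longrightarrow> lin s s'' (\<lambda>x. \<phi> c (g x))"
  using lin_comp[OF bilinD(2)] .

lemma lin_ident: "vector_space s \<Longrightarrow> lin s s (\<lambda>x. x)"
  by (rule linI) auto

lemma lin_zero: "vector_space s \<Longrightarrow> vector_space s' \<Longrightarrow> lin s s' (\<lambda>x. 0)"
  by (rule linI) (auto simp: vector_space.vector_space_assms module.scale_zero_right
      module_iff_vector_space[symmetric])

lemma lin_add: "lin s s' f \<Longrightarrow> lin s s' g \<Longrightarrow> lin s s' (\<lambda>x. f x + g x)"
  by (rule linI) (auto simp: linD algebra_simps dest: linD(2) intro: vector_space.vector_space_assms(1)[symmetric])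

lemma lin_diff: "lin s s' f \<Longrightarrow> lin s s' g \<Longrightarrow> lin s s' (\<lambda>x. f x - g x)"
  by (rule linI) (auto simp: linD algebra_simps module_iff_vector_space[symmetric]
      module.scale_right_diff_distrib dest: linD(1,2))

lemma lin_timesL: "lin s (*) f \<Longrightarrow> lin s (*) (\<lambda>x. f x * (c::'k::field))"
  by (rule linI) (auto simp: linD vector_space_times algebra_simps)

lemma lin_timesR: "lin s (*) f \<Longrightarrow> lin s (*) (\<lambda>x. (c::'k::field) * f x)"
  by (rule linI) (auto simp: linD vector_space_times algebra_simps)

lemma lin_scaleL: "vector_space s' \<Longrightarrow> lin s (*) f \<Longrightarrow> lin s s' (\<lambda>x. s' (f x) c)"
  by (rule linI) (auto simp: linD vector_space.vector_space_assms)

lemma lin_scaleR: "lin s s' f \<Longrightarrow> lin s s' (\<lambda>x. s' c (f x))"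
  by (rule linI) (auto simp: linD vector_space.vector_space_assms[OF linD(2)] mult.commute)

context vector_space
begin

lemma functional_separates_subspace:
  assumes "subspace U" "x \<notin> U"
  obtains f where "lin scale (*) f" "\<And>u. u \<in> U \<Longrightarrow> f u = 0" "f x = 1"
proof -
  interpret vs: vector_space_pair scale "(*) :: 'a \<Rightarrow> 'a \<Rightarrow> 'a"
    using vector_space_axioms vector_space_times by (simp add: vector_space_pair_def)
  obtain B where B: "B \<subseteq> U" "independent B" "span B = U"
    using basis_exists[of U] assms(1) by (metis span_eq_iff span_mono subset_antisym)
  have ind: "independent (insert x B)"
    using B assms by (simp add: independent_insert)
  obtain g where g: "lin scale (*) g" "\<forall>y\<in>insert x B. g y = (if y = x then 1 else (0::'a))"
    using vs.linear_independent_extend[OF ind, of "\<lambda>y. if y = x then 1 else 0"] by blast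
  interpret g: Vector_Spaces.linear scale "(*)" g by fact
  have "g u = 0" if "u \<in> U" for u
  proof -
    have "u \<in> span B" using that B by simp
    thus ?thesis
      by (rule g.eq_0_on_span[rotated]) (use g B assms in auto)
  qed
  with g that[of g] show ?thesis by simp
qed

text \<open>Reduces identities in any target space to scalar ones. The axioms of the locales below
  can therefore be stated for scalar multilinear forms, locale assumptions not being polymorphic in
  a target type.\<close>

lemma eq_if_functionals_eq:
  assumes "\<And>f. lin scale (*) f \<Longrightarrow> f u = f v"
  shows "u = v"
proof (rule ccontr)
  assume "u \<noteq> v"
  hence "u - v \<notin> {0}" by simp
  from functional_separates_subspace[OF subspace_single_0 this]
  obtain f where f: "lin scale (*) f" "f (u - v) = 1" by metis
  thus False using assms[OF f(1)] by (simp add: linD(6)[OF f(1)])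
qed

lemma projection_exists:
  assumes "subspace U"
  obtains t where "lin scale scale t" "\<And>x. t x \<in> U" "\<And>x. x \<in> U \<Longrightarrow> t x = x"
proof -
  interpret vs: vector_space_pair scale scale
    using vector_space_axioms by (simp add: vector_space_pair_def)
  obtain B where B: "B \<subseteq> U" "independent B" "span B = U"
    using basis_exists[of U] assms by (metis span_eq_iff span_mono subset_antisym)
  obtain g where g: "lin scale scale g" "\<forall>y\<in>B. g y = y" "range g = span (id ` B)"
    using vs.linear_independent_extend_subspace[OF B(2), of id] by auto
  have "g u = u" if "u \<in> U" for u
  proof (rule vs.linear_eq_on)
    show "lin scale scale g" by fact
    show "lin scale scale (\<lambda>x. x)" by (rule lin_ident[OF vector_space_axioms])
    show "u \<in> span B" using that B(3) by simp
  qed (simp add: g(2))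
  moreover have "g x \<in> U" for x
    using rangeI[of g x] unfolding g(3) image_id id_apply B(3) .
  ultimately show ?thesis using that[of g] g(1) by simp
qed

text \<open>The coefficients are coordinates in a basis of the whole space, so each is a functional
  defined everywhere; finiteness of \<open>X\<close> bounds how many are involved.\<close>

lemma finite_dual_basis:
  assumes "finite X"
  shows "\<exists>E c. finite E \<and> (\<forall>e. lin scale (*) (c e)) \<and> (\<forall>x\<in>X. x = (\<Sum>e\<in>E. c e x *s e))"
proof -
  obtain B where B: "independent B" "span B = UNIV"
    by (metis basis_exists subset_UNIV top.extremum_uniqueI)
  let ?c = "\<lambda>e x. representation B x e"
  define E where "E = (\<Union>x\<in>X. {b. ?c b x \<noteq> 0})"
  have "finite E" using assms finite_representation by (auto simp: E_def)
  moreover have "lin scale (*) (?c e)" for e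
    using B by (intro linI) (auto simp: vector_space_axioms vector_space_times
        representation_add representation_scale)
  moreover have "x = (\<Sum>e\<in>E. ?c e x *s e)" if "x \<in> X" for x
  proof -
    have "x = (\<Sum>b | ?c b x \<noteq> 0. ?c b x *s b)"
      using sum_nonzero_representation_eq[OF B(1), of x] B(2) by simp
    also have "\<dots> = (\<Sum>e\<in>E. ?c e x *s e)"
      using \<open>finite E\<close> that by (intro sum.mono_neutral_left) (auto simp: E_def)
    finally show ?thesis .
  qed
  ultimately show ?thesis by (intro exI[of _ E] exI[of _ ?c] conjI ballI allI)
qed

end


section \<open>Coalgebras and Sweedler sums\<close>

text \<open>Here \<open>d x\<close> lists the simple tensors of a representative of \<open>\<Delta> x\<close>. Identities between
  elements of tensor powers are expressed by evaluating all multilinear maps.\<close>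

definition sweedler :: "('h \<Rightarrow> ('h \<times> 'h) list) \<Rightarrow> ('h \<Rightarrow> 'h \<Rightarrow> 'v::comm_monoid_add) \<Rightarrow> 'h \<Rightarrow> 'v"
  where "sweedler d \<phi> x = (\<Sum>(a, b)\<leftarrow>d x. \<phi> a b)"

lemma sweedler_cong:
  "(\<And>a b. (a, b) \<in> set (d x) \<Longrightarrow> \<phi> a b = \<psi> a b) \<Longrightarrow> sweedler d \<phi> x = sweedler d \<psi> x"
  unfolding sweedler_def by (rule arg_cong[of _ _ sum_list]) auto

lemma sweedler_zero [simp]: "sweedler d (\<lambda>a b. 0) x = 0"
  by (simp add: sweedler_def case_prod_unfold)

lemma sweedler_add: "sweedler d (\<lambda>a b. \<phi> a b + \<psi> a b) x = sweedler d \<phi> x + sweedler d \<psi> x"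
  by (simp add: sweedler_def case_prod_unfold sum_list_addf)

lemma sweedler_diff:
  "sweedler d (\<lambda>a b. \<phi> a b - \<psi> a b) x = sweedler d \<phi> x - (sweedler d \<psi> x :: 'v::ab_group_add)"
  by (simp add: sweedler_def case_prod_unfold sum_list_subtractf)

lemma sweedler_hom:
  assumes "lin s s' f"
  shows "f (sweedler d \<phi> x) = sweedler d (\<lambda>a b. f (\<phi> a b)) x"
proof -
  have "f (\<Sum>(a, b)\<leftarrow>l. \<phi> a b) = (\<Sum>(a, b)\<leftarrow>l. f (\<phi> a b))" for l
    using assms by (induction l) (auto simp: linD)
  thus ?thesis by (simp add: sweedler_def)
qed

lemma sweedler_swap:
  "sweedler d (\<lambda>a b. sweedler d' (\<lambda>a' b'. \<phi> a b a' b') y) x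
    = sweedler d' (\<lambda>a' b'. sweedler d (\<lambda>a b. \<phi> a b a' b') x) y"
proof -
  have *: "(\<Sum>p\<leftarrow>l. \<Sum>q\<leftarrow>l'. f p q) = (\<Sum>q\<leftarrow>l'. \<Sum>p\<leftarrow>l. f p q)"
    for l :: "'x list" and l' :: "'y list" and f :: "'x \<Rightarrow> 'y \<Rightarrow> 'z::comm_monoid_add"
    by (induction l) (simp_all add: sum_list_addf)
  show ?thesis unfolding sweedler_def case_prod_unfold by (rule *)
qed

lemma sweedler_sum:
  "sweedler d (\<lambda>a b. \<Sum>i\<in>I. \<phi> i a b) x = (\<Sum>i\<in>I. sweedler d (\<phi> i) x)"
proof -
  have "(\<Sum>(a, b)\<leftarrow>l. \<Sum>i\<in>I. \<phi> i a b) = (\<Sum>i\<in>I. \<Sum>(a, b)\<leftarrow>l. \<phi> i a b)" for l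
    by (induction l) (simp_all add: sum.distrib case_prod_unfold)
  thus ?thesis by (simp add: sweedler_def)
qed

lemma lin_sweedler_inner:
  assumes "\<And>a b. lin s s' (\<lambda>x. \<phi> x a b)" "vector_space s" "vector_space s'"
  shows "lin s s' (\<lambda>x. sweedler d (\<phi> x) y)"
proof -
  have "lin s s' (\<lambda>x. \<Sum>(a, b)\<leftarrow>l. \<phi> x a b)" for l
    by (induction l) (use assms in \<open>auto intro!: lin_zero lin_add\<close>)
  thus ?thesis by (simp add: sweedler_def)
qed

text \<open>\<open>delta\<close> chooses representatives and need not be additive. Linearity and
  coassociativity are imposed only after evaluation on multilinear forms, that is, on classes in the
  tensor powers.\<close>

locale coalgebra = vector_space scale
  for scale :: "'k::field \<Rightarrow> 'h::ab_group_add \<Rightarrow> 'h" (infixr "*s" 75) +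
  fixes delta :: "'h \<Rightarrow> ('h \<times> 'h) list"
    and counit :: "'h \<Rightarrow> 'k"
  assumes sweedler_linear_ax: "bilin scale (*) \<phi> \<Longrightarrow> lin scale (*) (sweedler delta \<phi>)"
    and coassoc_ax: "\<lbrakk>\<And>b c. lin scale (*) (\<lambda>a. \<psi> a b c); \<And>a c. lin scale (*) (\<lambda>b. \<psi> a b c);
        \<And>a b. lin scale (*) (\<psi> a b)\<rbrakk> \<Longrightarrow>
      sweedler delta (\<lambda>a b. sweedler delta (\<lambda>a' a''. \<psi> a' a'' b) a) x
        = sweedler delta (\<lambda>a b. sweedler delta (\<psi> a) b) x"
    and lin_counit_ax: "lin scale (*) counit"
    and counit_l: "sweedler delta (\<lambda>a b. counit a *s b) x = x"
    and counit_r: "sweedler delta (\<lambda>a b. counit b *s a) x = x"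
begin

abbreviation cm :: "('h \<Rightarrow> 'h \<Rightarrow> 'v::comm_monoid_add) \<Rightarrow> 'h \<Rightarrow> 'v"
  where "cm \<equiv> sweedler delta"

abbreviation functional :: "('h \<Rightarrow> 'k) \<Rightarrow> bool"
  where "functional \<equiv> lin scale (*)"

abbreviation endo :: "('h \<Rightarrow> 'h) \<Rightarrow> bool"
  where "endo \<equiv> lin scale scale"

lemmas vs = vector_space_axioms vector_space_times

text \<open>The inner map \<open>g\<close> is built in so that the rule can be applied by
  \<open>intro\<close> under arbitrary nesting of Sweedler sums.\<close>

lemma lin_cm: 
  assumes \<phi>: "bilin scale s \<phi>" and g: "lin scale scale g"
  shows "lin scale s (\<lambda>x. cm \<phi> (g x))"
proof -
  have s: "vector_space s" using linD(2)[OF bilinD(1)[OF \<phi>]] .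
  interpret s: vector_space s by fact
  have *: "lin scale (*) (cm (\<lambda>a b. f (\<phi> a b)))" if "lin s (*) f" for f
    
    by (intro sweedler_linear_ax bilinI lin_comp[OF that] bilinD[OF \<phi>])
  have "lin scale s (cm \<phi>)"
  proof (rule linI[OF vector_space_axioms s])
    fix x y c
    show "cm \<phi> (x + y) = cm \<phi> x + cm \<phi> y"
      by (rule s.eq_if_functionals_eq) (simp add: sweedler_hom linD(3) linD(3)[OF *])
    show "cm \<phi> (c *s x) = s c (cm \<phi> x)"
      by (rule s.eq_if_functionals_eq) (simp add: sweedler_hom linD(4) linD(4)[OF *])
  qed
  thus ?thesis using g by (rule lin_comp)
qed

lemma coassoc:
  assumes 1: "\<And>b c. lin scale s (\<lambda>a. \<psi> a b c)" and 2: "\<And>a c. lin scale s (\<lambda>b. \<psi> a b c)"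
    and 3: "\<And>a b. lin scale s (\<psi> a b)"
  shows "cm (\<lambda>a b. cm (\<lambda>a' a''. \<psi> a' a'' b) a) x = cm (\<lambda>a b. cm (\<psi> a) b) x"
proof -
  interpret s: vector_space s using linD(2)[OF 1] .
  show ?thesis
  proof (rule s.eq_if_functionals_eq)
    fix f assume f: "lin s (*) f"
    have "cm (\<lambda>a b. cm (\<lambda>a' a''. f (\<psi> a' a'' b)) a) x = cm (\<lambda>a b. cm (\<lambda>a' b'. f (\<psi> a a' b')) b) x"
      by (rule coassoc_ax) (intro lin_comp[OF f] assms)+
    thus "f (cm (\<lambda>a b. cm (\<lambda>a' a''. \<psi> a' a'' b) a) x) = f (cm (\<lambda>a b. cm (\<psi> a) b) x)"
      by (simp add: sweedler_hom[OF f])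
  qed
qed

lemmas lin_counit = lin_comp[OF lin_counit_ax]
lemmas lin_inner = lin_sweedler_inner[OF _ vector_space_axioms vector_space_axioms]
  lin_sweedler_inner[OF _ vector_space_axioms vector_space_times]
lemmas lin_intros = bilinI lin_ident[OF vector_space_axioms] lin_add lin_diff lin_timesL lin_timesR
  lin_scaleL[OF vector_space_axioms] lin_scaleR lin_counit lin_inner lin_cm

text \<open>\<open>conv\<close> is the product of the dual algebra; \<open>R f x\<close> and
  \<open>L f x\<close> are its left action \<open>x\<^sub>1 f(x\<^sub>2)\<close> and right action
  \<open>f(x\<^sub>1) x\<^sub>2\<close>.\<close>

definition R :: "('h \<Rightarrow> 'k) \<Rightarrow> 'h \<Rightarrow> 'h" where "R f = cm (\<lambda>a b. f b *s a)"
definition L :: "('h \<Rightarrow> 'k) \<Rightarrow> 'h \<Rightarrow> 'h" where "L f = cm (\<lambda>a b. f a *s b)"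
definition conv :: "('h \<Rightarrow> 'k) \<Rightarrow> ('h \<Rightarrow> 'k) \<Rightarrow> 'h \<Rightarrow> 'k" where "conv f g = cm (\<lambda>a b. f a * g b)"

lemma lin_R:
  assumes f: "functional f" and g: "lin scale scale g"
  shows "lin scale scale (\<lambda>x. R f (g x))"
  unfolding R_def by (intro lin_intros lin_comp[OF f] g)

lemma lin_L:
  assumes f: "functional f" and g: "lin scale scale g"
  shows "lin scale scale (\<lambda>x. L f (g x))"
  unfolding L_def by (intro lin_intros lin_comp[OF f] g)

lemmas lin_R' = lin_R[OF _ lin_ident[OF vector_space_axioms]]
lemmas lin_L' = lin_L[OF _ lin_ident[OF vector_space_axioms]]

lemma lin_conv:
  assumes f: "functional f" and g: "functional g"
  shows "functional (conv f g)"
  unfolding conv_def by (intro lin_intros lin_comp[OF f] lin_comp[OF g])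

lemma R_counit [simp]: "R counit x = x" by (simp add: R_def counit_r)
lemma L_counit [simp]: "L counit x = x" by (simp add: L_def counit_l)

lemma counit_R:
  assumes f: "functional f"
  shows "counit (R f x) = f x"
proof -
  have "f x = f (cm (\<lambda>a b. counit a *s b) x)" by (simp add: counit_l)
  thus ?thesis
    by (simp add: R_def sweedler_hom[OF lin_counit_ax] sweedler_hom[OF f] linD(4)[OF lin_counit_ax]
        linD(4)[OF f] mult.commute)
qed

lemma counit_L:
  assumes f: "functional f"
  shows "counit (L f x) = f x"
proof -
  have "f x = f (cm (\<lambda>a b. counit b *s a) x)" by (simp add: counit_r)
  thus ?thesis
    by (simp add: L_def sweedler_hom[OF lin_counit_ax] sweedler_hom[OF f] linD(4)[OF lin_counit_ax]
        linD(4)[OF f] mult.commute)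
qed

lemma f_R: "functional f \<Longrightarrow> f (R g x) = conv f g x"
  by (simp add: R_def conv_def sweedler_hom[of _ _ f] linD(4)[of _ _ f] mult.commute)

lemma f_L: "functional g \<Longrightarrow> g (L f x) = conv f g x"
  by (simp add: L_def conv_def sweedler_hom[of _ _ g] linD(4)[of _ _ g] mult.commute)

lemma R_R: 
  assumes f: "functional f" and g: "functional g"
  shows "R f (R g x) = R (conv f g) x"
proof -
  have "R f (R g x) = cm (\<lambda>a b. g b *s R f a) x"
    unfolding R_def[of g]
    by (simp add: sweedler_hom[OF lin_R'[OF f]] linD(4)[OF lin_R'[OF f]])
  also have "\<dots> = cm (\<lambda>a b. cm (\<lambda>a' a''. g b *s f a'' *s a') a) x"
    unfolding R_def by (simp add: sweedler_hom[OF lin_scaleR[OF lin_ident[OF vector_space_axioms]]])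
  also have "\<dots> = cm (\<lambda>a b. cm (\<lambda>a' b'. g b' *s f a' *s a) b) x"
    by (rule coassoc[where s=scale]) (intro lin_intros lin_comp[OF f] lin_comp[OF g])+
  also have "\<dots> = R (conv f g) x"
    unfolding R_def conv_def 
    by (simp add: sweedler_hom[OF lin_scaleL[OF vector_space_axioms lin_ident[OF vector_space_times]]] mult.commute)
  finally show ?thesis .
qed

lemma L_L: 
  assumes f: "functional f" and g: "functional g"
  shows "L g (L f x) = L (conv f g) x"
proof -
  have "L g (L f x) = cm (\<lambda>a b. f a *s L g b) x"
    unfolding L_def[of f]
    by (simp add: sweedler_hom[OF lin_L'[OF g]] linD(4)[OF lin_L'[OF g]])
  also have "\<dots> = cm (\<lambda>a b. cm (\<lambda>a' b'. f a *s g a' *s b') b) x"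
    unfolding L_def by (simp add: sweedler_hom[OF lin_scaleR[OF lin_ident[OF vector_space_axioms]]])
  also have "\<dots> = cm (\<lambda>a b. cm (\<lambda>a' a''. f a' *s g a'' *s b) a) x"
    by (rule coassoc[where s=scale, symmetric]) (intro lin_intros lin_comp[OF f] lin_comp[OF g])+
  also have "\<dots> = L (conv f g) x"
    unfolding L_def conv_def
    by (rule sweedler_cong) (simp add: sweedler_hom[OF lin_scaleL[OF vector_space_axioms lin_ident[OF vector_space_times]]] mult.commute)
  finally show ?thesis .
qed

lemma L_R:
  assumes f: "functional f" and g: "functional g"
  shows "L f (R g x) = R g (L f x)"
proof -
  have "L f (R g x) = cm (\<lambda>a b. g b *s L f a) x"
    unfolding R_def[of g]
    by (simp add: sweedler_hom[OF lin_L'[OF f]] linD(4)[OF lin_L'[OF f]])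
  also have "\<dots> = cm (\<lambda>a b. cm (\<lambda>a' a''. g b *s f a' *s a'') a) x"
    unfolding L_def by (simp add: sweedler_hom[OF lin_scaleR[OF lin_ident[OF vector_space_axioms]]])
  also have "\<dots> = cm (\<lambda>a b. cm (\<lambda>a' b'. g b' *s f a *s a') b) x"
    by (rule coassoc[where s=scale]) (intro lin_intros lin_comp[OF f] lin_comp[OF g])+
  also have "\<dots> = cm (\<lambda>a b. f a *s R g b) x"
    unfolding R_def by (simp add: sweedler_hom[OF lin_scaleR[OF lin_ident[OF vector_space_axioms]]] mult.commute)
  also have "\<dots> = R g (L f x)"
    unfolding L_def[of f]
    by (simp add: sweedler_hom[OF lin_R'[OF g]] linD(4)[OF lin_R'[OF g]])
  finally show ?thesis .
qed

lemma conv_assoc: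
  assumes "functional f" "functional g" "functional h"
  shows "conv (conv f g) h = conv f (conv g h)"
  using assms by (intro ext) (simp add: f_R[symmetric] R_R lin_conv)

lemma conv_counit: "functional f \<Longrightarrow> conv counit f = f" "functional f \<Longrightarrow> conv f counit = f"
  using f_L[of f counit] f_R[of f counit] by auto

text \<open>Expanding the second tensor factor in a dual basis turns a statement about the tensor
  \<open>\<Delta> x\<close> into one about the vectors \<open>R f x\<close>.\<close>

lemma cm_eq_0:
  assumes \<psi>: "bilin scale s \<psi>" and K: "subspace K"
    and U: "\<And>f. functional f \<Longrightarrow> (\<And>k. k \<in> K \<Longrightarrow> f k = 0) \<Longrightarrow> R f x \<in> U"
    and 0: "\<And>a b. a \<in> U \<Longrightarrow> \<psi> a b = 0" "\<And>a b. b \<in> K \<Longrightarrow> \<psi> a b = 0"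
  shows "cm \<psi> x = 0"
proof -
  obtain t where t: "endo t" "\<And>x. t x \<in> K" "\<And>x. x \<in> K \<Longrightarrow> t x = x"
    by (rule projection_exists[OF K]) blast
  \<comment> \<open>Passing from \<open>b\<close> to \<open>b - t b\<close> does not change the sum,
    since \<open>\<psi> a\<close> vanishes on \<open>K\<close>; it makes the coordinate functionals
    vanish on \<open>K\<close>, as the hypothesis on \<open>U\<close> demands.\<close>
  have b: "bilin scale s (\<lambda>a b. \<psi> a (b - t b))"
    using t(1) by (intro bilinI lin_bilin1[OF \<psi>] lin_bilin2[OF \<psi>] lin_intros)
  have "cm \<psi> x = cm (\<lambda>a b. \<psi> a (b - t b)) x"
    by (rule sweedler_cong) (simp add: linD(6)[OF bilinD(2)[OF \<psi>]] 0(2) t)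
  also have "\<dots> = 0"
  proof -
    obtain E c where E: "finite E" and c: "\<forall>e. functional (c e)" 
      and exp: "\<And>b. b \<in> (\<lambda>(a, b). b - t b) ` set (delta x) \<Longrightarrow> b = (\<Sum>e\<in>E. c e b *s e)"
      using finite_dual_basis[of "(\<lambda>(a, b). b - t b) ` set (delta x)", OF finite_imageI[OF finite_set]]
      by blast
    let ?c = "\<lambda>e b. c e (b - t b)"
    have c': "functional (?c e)" for e using t by (intro lin_comp[OF spec[OF c]] lin_intros)
    have "cm (\<lambda>a b. \<psi> a (b - t b)) x = cm (\<lambda>a b. \<Sum>e\<in>E. \<psi> (?c e b *s a) e) x"
    proof (rule sweedler_cong)
      fix a b assume "(a, b) \<in> set (delta x)"
      hence "b - t b = (\<Sum>e\<in>E. ?c e b *s e)" by (intro exp) force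
      hence "\<psi> a (b - t b) = \<psi> a (\<Sum>e\<in>E. ?c e b *s e)" by simp
      also have "\<dots> = (\<Sum>e\<in>E. s (?c e b) (\<psi> a e))" by (simp add: linD[OF bilinD(2)[OF \<psi>]])
      finally show "\<psi> a (b - t b) = (\<Sum>e\<in>E. \<psi> (?c e b *s a) e)"
        by (simp add: linD(4)[OF bilinD(1)[OF \<psi>]])
    qed
    also have "\<dots> = (\<Sum>e\<in>E. \<psi> (R (?c e) x) e)"
      unfolding sweedler_sum R_def by (simp add: sweedler_hom[OF bilinD(1)[OF \<psi>]])
    also have "\<dots> = 0"
      by (intro sum.neutral ballI 0(1) U c') (simp add: t linD(5)[OF spec[OF c]])
    finally show ?thesis .
  qed
  finally show ?thesis .
qed

end


section \<open>Prime Artinian rings\<close>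

text \<open>The ring meant is \<open>A\<close> modulo the prime ideal \<open>Z\<close>, kept as a
  pair to avoid a quotient type. In the application it is the dual of a finite-dimensional
  subcoalgebra \<open>D\<close>: \<open>A\<close> consists of all functionals, \<open>Z\<close> of
  those vanishing on \<open>D\<close>. The chain condition enters as a strictly monotone measure
  \<open>m\<close> on left ideals.\<close>

locale prime_artinian =
  fixes mul :: "'a::ab_group_add \<Rightarrow> 'a \<Rightarrow> 'a" (infixl "\<star>" 70)
    and one :: 'a and A Z :: "'a set"
  assumes A: "\<And>x y. x \<in> A \<Longrightarrow> y \<in> A \<Longrightarrow> x + y \<in> A" "\<And>x y. x \<in> A \<Longrightarrow> y \<in> A \<Longrightarrow> x - y \<in> A"
      "\<And>x y. x \<in> A \<Longrightarrow> y \<in> A \<Longrightarrow> x \<star> y \<in> A" "one \<in> A"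
    and assoc: "\<And>x y z. x \<in> A \<Longrightarrow> y \<in> A \<Longrightarrow> z \<in> A \<Longrightarrow> x \<star> y \<star> z = x \<star> (y \<star> z)"
    and one: "\<And>x. x \<in> A \<Longrightarrow> x \<star> one = x"
    and distr: "\<And>x y z. x \<in> A \<Longrightarrow> y \<in> A \<Longrightarrow> z \<in> A \<Longrightarrow> (x + y) \<star> z = x \<star> z + y \<star> z"
      "\<And>x y z. x \<in> A \<Longrightarrow> y \<in> A \<Longrightarrow> z \<in> A \<Longrightarrow> z \<star> (x + y) = z \<star> x + z \<star> y"
      "\<And>x y z. x \<in> A \<Longrightarrow> y \<in> A \<Longrightarrow> z \<in> A \<Longrightarrow> (x - y) \<star> z = x \<star> z - y \<star> z"
      "\<And>x y z. x \<in> A \<Longrightarrow> y \<in> A \<Longrightarrow> z \<in> A \<Longrightarrow> z \<star> (x - y) = z \<star> x - z \<star> y"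
    and Z: "0 \<in> Z" "Z \<subseteq> A" "\<And>x y. x \<in> Z \<Longrightarrow> y \<in> Z \<Longrightarrow> x + y \<in> Z" "\<And>x y. x \<in> Z \<Longrightarrow> y \<in> Z \<Longrightarrow> x - y \<in> Z"
      "\<And>x y. x \<in> A \<Longrightarrow> y \<in> Z \<Longrightarrow> x \<star> y \<in> Z" "\<And>x y. x \<in> Z \<Longrightarrow> y \<in> A \<Longrightarrow> x \<star> y \<in> Z"
    and prime: "\<And>x y. x \<in> A \<Longrightarrow> y \<in> A \<Longrightarrow> (\<And>h. h \<in> A \<Longrightarrow> x \<star> h \<star> y \<in> Z) \<Longrightarrow> x \<in> Z \<or> y \<in> Z"
begin

definition lid :: "'a set \<Rightarrow> bool"
  where "lid P \<longleftrightarrow> P \<subseteq> A \<and> Z \<subseteq> P \<and> (\<forall>x\<in>P. \<forall>y\<in>P. x + y \<in> P) \<and> (\<forall>x\<in>P. \<forall>y\<in>P. x - y \<in> P)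
    \<and> (\<forall>a\<in>A. \<forall>x\<in>P. a \<star> x \<in> P)"

definition eqv :: "'a \<Rightarrow> 'a \<Rightarrow> bool" (infix "\<approx>" 50) where "x \<approx> y \<longleftrightarrow> x - y \<in> Z"

lemma lidD:
  assumes "lid P"
  shows "x \<in> P \<Longrightarrow> x \<in> A" "x \<in> Z \<Longrightarrow> x \<in> P" "x \<in> P \<Longrightarrow> y \<in> P \<Longrightarrow> x + y \<in> P"
    "x \<in> P \<Longrightarrow> y \<in> P \<Longrightarrow> x - y \<in> P" "a \<in> A \<Longrightarrow> x \<in> P \<Longrightarrow> a \<star> x \<in> P"
  using assms by (auto simp: lid_def)

lemma eqv_refl [simp]: "x \<approx> x" by (simp add: eqv_def Z)
lemma eqv_trans [trans]: "x \<approx> y \<Longrightarrow> y \<approx> z \<Longrightarrow> x \<approx> z"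
  using Z(3)[of "x - y" "y - z"] by (simp add: eqv_def)
lemma eqv_sym: "x \<approx> y \<Longrightarrow> y \<approx> x"
  using Z(4)[of 0 "x - y"] Z(1) by (simp add: eqv_def)
lemma eqv_add: "x \<approx> y \<Longrightarrow> x' \<approx> y' \<Longrightarrow> x + x' \<approx> y + y'"
  using Z(3)[of "x - y" "x' - y'"] by (simp add: eqv_def algebra_simps)
lemma eqv_diff: "x \<approx> y \<Longrightarrow> x' \<approx> y' \<Longrightarrow> x - x' \<approx> y - y'"
  using Z(4)[of "x - y" "x' - y'"] by (simp add: eqv_def algebra_simps)
lemma eqv_mulR: "x \<in> A \<Longrightarrow> y \<in> A \<Longrightarrow> z \<in> A \<Longrightarrow> x \<approx> y \<Longrightarrow> x \<star> z \<approx> y \<star> z"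
  using Z(6)[of "x - y" z] by (simp add: eqv_def distr)
lemma eqv_mulL: "x \<in> A \<Longrightarrow> y \<in> A \<Longrightarrow> z \<in> A \<Longrightarrow> x \<approx> y \<Longrightarrow> z \<star> x \<approx> z \<star> y"
  using Z(5)[of z "x - y"] by (simp add: eqv_def distr)
lemma eqv_0: "x \<approx> 0 \<longleftrightarrow> x \<in> Z" by (simp add: eqv_def)
lemma eqv_Z: "x \<approx> y \<Longrightarrow> x \<in> Z \<longleftrightarrow> y \<in> Z"
  using eqv_trans eqv_sym eqv_0 by blast

text \<open>Brauer's argument modulo \<open>Z\<close>. In a minimal nonzero left ideal
  \<open>L\<close> primeness gives \<open>l\<close> and \<open>a\<close> with
  \<open>l \<star> a\<close> nonzero. By minimality \<open>L \<star> a\<close> is all of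
  \<open>L\<close>, so some \<open>e\<close> fixes \<open>a\<close> from the left, and the
  annihilator of \<open>a\<close> in \<open>L\<close> is zero; it contains
  \<open>e \<star> e - e\<close>.\<close>

lemma idempotent_exists:
  fixes m :: "'a set \<Rightarrow> nat"
  assumes wf: "\<And>P Q. lid P \<Longrightarrow> lid Q \<Longrightarrow> P \<subset> Q \<Longrightarrow> m P < m Q"
    and T: "lid T" "\<not> T \<subseteq> Z"
  obtains g where "g \<in> T" "g \<notin> Z" "g \<star> g \<approx> g"
proof -
  obtain L where L: "lid L" "L \<subseteq> T" "\<not> L \<subseteq> Z"
    and min: "\<And>P. lid P \<Longrightarrow> P \<subseteq> T \<Longrightarrow> \<not> P \<subseteq> Z \<Longrightarrow> m L \<le> m P"
    using ex_has_least_nat[of "\<lambda>P. lid P \<and> P \<subseteq> T \<and> \<not> P \<subseteq> Z" T m] T by blast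
  have minL: "P \<subseteq> Z \<or> P = L" if "lid P" "P \<subseteq> L" for P
    using min[of P] wf[OF that(1) L(1)] that L(2) by force
  obtain l where l: "l \<in> L" "l \<notin> Z" using L(3) by auto
  note LA = lidD(1)[OF L(1)]
  have "\<exists>h\<in>A. l \<star> h \<star> l \<notin> Z" using prime[of l l] l LA by blast
  then obtain h where h: "h \<in> A" "l \<star> h \<star> l \<notin> Z" by blast
  define a where "a = h \<star> l"
  have a: "a \<in> L" "l \<star> a \<notin> Z"
    using h l LA lidD(5)[OF L(1)] by (auto simp: a_def assoc)
  let ?P = "{v \<in> L. \<exists>u\<in>L. v \<approx> u \<star> a}"
  have "lid ?P"
    unfolding lid_def
  proof (safe)
    fix x assume "x \<in> Z"
    thus "x \<in> L" by (rule lidD(2)[OF L(1)])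
    have "0 \<star> a \<in> Z" by (intro Z(6) Z(1) LA a)
    hence "x \<approx> 0 \<star> a" using \<open>x \<in> Z\<close> by (simp add: eqv_def Z(4))
    thus "\<exists>u\<in>L. x \<approx> u \<star> a" using lidD(2)[OF L(1) Z(1)] by blast
  next
    fix x y u w assume *: "x \<in> L" "y \<in> L" "u \<in> L" "w \<in> L" "x \<approx> u \<star> a" "y \<approx> w \<star> a"
    show "x + y \<in> L" "x - y \<in> L" using * lidD(3,4)[OF L(1)] by auto
    show "\<exists>u\<in>L. x + y \<approx> u \<star> a"
      using eqv_add[OF *(5,6)] * a LA by (intro bexI[of _ "u + w"] lidD(3)[OF L(1)]) (auto simp: distr)
    show "\<exists>u\<in>L. x - y \<approx> u \<star> a"
      using eqv_diff[OF *(5,6)] * a LA by (intro bexI[of _ "u - w"] lidD(4)[OF L(1)]) (auto simp: distr)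
  next
    fix b x u assume *: "b \<in> A" "x \<in> L" "u \<in> L" "x \<approx> u \<star> a"
    show "b \<star> x \<in> L" using * lidD(5)[OF L(1)] by auto
    show "\<exists>u\<in>L. b \<star> x \<approx> u \<star> a"
      using eqv_mulL[OF _ _ *(1,4)] * a LA A
      by (intro bexI[of _ "b \<star> u"] lidD(5)[OF L(1)]) (auto simp: assoc)
  qed (use LA in auto)
  moreover have "l \<star> a \<in> ?P" using lidD(5)[OF L(1) LA[OF l(1)] a(1)] eqv_refl[of "l \<star> a"] l(1) by blast
  ultimately have "?P = L" using minL[of ?P] a by blast
  then obtain e where e: "e \<in> L" "a \<approx> e \<star> a" using a by blast
  let ?N = "{u \<in> L. u \<star> a \<in> Z}"
  have "lid ?N"
    unfolding lid_def using lidD[OF L(1)] Z a LA by (auto simp: distr assoc A)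
  hence N: "?N \<subseteq> Z" using minL[of ?N] l a by auto
  have "(e \<star> e - e) \<star> a = e \<star> (e \<star> a) - e \<star> a" using e a LA A by (simp add: distr assoc)
  moreover have "e \<star> (e \<star> a) \<approx> e \<star> a"
    using eqv_mulL[OF _ _ _ eqv_sym[OF e(2)]] e a LA A by auto
  ultimately have "e \<star> e - e \<in> ?N"
    using e LA lidD(4,5)[OF L(1)] by (auto simp: eqv_def)
  hence "e \<star> e \<approx> e" using N by (auto simp: eqv_def)
  moreover have "e \<notin> Z"
  proof
    assume "e \<in> Z"
    hence "a \<in> Z" using eqv_Z[OF e(2)] Z(6) a LA by auto
    thus False using a Z(5) l LA by auto
  qed
  ultimately show ?thesis using that e L(2) by auto
qed

text \<open>A prime Artinian ring is simple. An idempotent \<open>e\<close> of \<open>M\<close> with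
  smallest left annihilator satisfies \<open>f = f \<star> e\<close> for all \<open>f\<close> in
  \<open>M\<close>, since otherwise it could be enlarged. So \<open>M\<close> annihilates
  \<open>one - e\<close>, which must vanish by primeness.\<close>

lemma one_in_ideal:
  fixes m :: "'a set \<Rightarrow> nat"
  assumes wf: "\<And>P Q. lid P \<Longrightarrow> lid Q \<Longrightarrow> P \<subset> Q \<Longrightarrow> m P < m Q"
    and M: "lid M" "\<not> M \<subseteq> Z" "\<And>x y. x \<in> M \<Longrightarrow> y \<in> A \<Longrightarrow> x \<star> y \<in> M"
  shows "one \<in> M"
proof -
  let ?ann = "\<lambda>e. {f \<in> A. f \<star> e \<in> Z}"
  note MA = lidD(1)[OF M(1)]
  have ann: "lid (?ann e)" if "e \<in> A" for e
    unfolding lid_def using Z that by (auto simp: distr assoc A)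
  \<comment> \<open>The zero idempotent makes the minimal choice possible.\<close>
  have "0 \<star> 0 \<approx> 0" unfolding eqv_0 using Z by auto
  then obtain e where e: "e \<in> M" "e \<star> e \<approx> e"
    and min: "\<And>g. g \<in> M \<Longrightarrow> g \<star> g \<approx> g \<Longrightarrow> m (?ann e) \<le> m (?ann g)"
    using ex_has_least_nat[of "\<lambda>e. e \<in> M \<and> e \<star> e \<approx> e" 0 "\<lambda>e. m (?ann e)"] lidD(2)[OF M(1) Z(1)]
    by blast
  have eA: "e \<in> A" using e MA by auto
  have T: "M \<inter> ?ann e \<subseteq> Z"
  proof (rule ccontr)
    assume "\<not> M \<inter> ?ann e \<subseteq> Z"
    moreover have "lid (M \<inter> ?ann e)"
      using M(1) ann[OF eA] unfolding lid_def by blast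
    ultimately obtain g where g: "g \<in> M" "g \<in> A" "g \<star> e \<in> Z" "g \<notin> Z" "g \<star> g \<approx> g"
      using idempotent_exists[where m = m, OF wf] by blast
    note [simp] = A eA g(2) assoc distr
    \<comment> \<open>As \<open>g \<star> e\<close> is zero, this is the idempotent generated
      jointly by \<open>e\<close> and \<open>g\<close>: it fixes both from the left, so its
      annihilator shrinks, and \<open>g\<close> witnesses that it does so strictly.\<close>
    define e' where "e' = e + g - e \<star> g"
    have e'A: "e' \<in> A" by (simp add: e'_def)
    have e'M: "e' \<in> M" using e g lidD[OF M(1)] by (simp add: e'_def)
    have "e' \<star> e = e \<star> e + g \<star> e - e \<star> (g \<star> e)" by (simp add: e'_def)
    also have "\<dots> \<approx> e + 0 - 0"
      using e(2) g(3) by (intro eqv_diff eqv_add) (simp_all only: eqv_0 Z(5)[OF eA])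
    finally have e'e: "e' \<star> e \<approx> e" by simp
    have "e' \<star> g = e \<star> g + g \<star> g - e \<star> (g \<star> g)" by (simp add: e'_def)
    also have "\<dots> \<approx> e \<star> g + g - e \<star> g"
      using g(5) by (intro eqv_add eqv_diff eqv_mulL) (auto simp del: assoc)
    finally have "e' \<star> g \<approx> e \<star> g + g - e \<star> g" .
    hence e'g: "e' \<star> g \<approx> g" by simp
    have "e' \<star> e' = e' \<star> e + e' \<star> g - (e' \<star> e) \<star> g"
      using e'A by (subst (2) e'_def) simp
    also have "\<dots> \<approx> e + g - e \<star> g"
      using e'A by (intro eqv_add eqv_diff e'e e'g eqv_mulR) auto
    finally have "e' \<star> e' \<approx> e'" by (simp add: e'_def)
    hence "m (?ann e) \<le> m (?ann e')" by (rule min[OF e'M])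
    moreover have "?ann e' \<subset> ?ann e"
    proof (intro psubsetI)
      show "?ann e' \<subseteq> ?ann e"
      proof safe
        fix f assume f: "f \<in> A" "f \<star> e' \<in> Z"
        have "f \<star> (e' \<star> e) \<approx> f \<star> e" using f e'A by (intro eqv_mulL e'e) auto
        moreover have "f \<star> (e' \<star> e) \<in> Z" using Z(6)[OF f(2) eA] f e'A by simp
        ultimately show "f \<star> e \<in> Z" using eqv_Z by blast
      qed
      have "g \<star> e' = g \<star> e + g \<star> g - (g \<star> e) \<star> g" by (simp add: e'_def)
      also have "\<dots> \<approx> 0 + g - 0"
        using g Z(6) by (intro eqv_add eqv_diff) (auto simp: eqv_0 simp del: assoc)
      finally have "g \<star> e' \<notin> Z" using eqv_Z g by simp
      hence "g \<in> ?ann e" "g \<notin> ?ann e'" using g(2,3) by (simp_all only: mem_Collect_eq simp_thms)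
      thus "?ann e' \<noteq> ?ann e" by (metis (no_types, lifting))
    qed
    ultimately show False using wf[OF ann[OF e'A] ann[OF eA]] by auto
  qed
  have fe: "f - f \<star> e \<in> Z" if "f \<in> M" for f
  proof -
    have fA: "f \<in> A" using that MA by auto
    have "(f - f \<star> e) \<star> e = f \<star> e - f \<star> (e \<star> e)" using fA eA by (simp add: A assoc distr)
    moreover have "f \<star> e \<approx> f \<star> (e \<star> e)"
      using e(2) eqv_sym fA eA A by (intro eqv_mulL) auto
    ultimately have "(f - f \<star> e) \<star> e \<in> Z" by (simp add: eqv_def)
    thus ?thesis using T that M(3)[OF that eA] lidD(4)[OF M(1)] fA eA A by auto
  qed
  obtain f where f: "f \<in> M" "f \<notin> Z" using M(2) by auto
  have "f \<star> h \<star> (one - e) \<in> Z" if "h \<in> A" for h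
    using fe[OF M(3)[OF f(1) that]] f MA that A eA by (simp add: distr one)
  hence "one - e \<in> Z" using prime[of f "one - e"] f MA A eA by auto
  hence "(one - e) + e \<in> M" using lidD(2,3)[OF M(1)] e by blast
  thus ?thesis by simp
qed

end


section \<open>Subcoalgebras and the wedge filtration\<close>

context coalgebra
begin

definition findim :: "'h set \<Rightarrow> bool"
  where "findim C \<longleftrightarrow> (\<exists>T. finite T \<and> C \<subseteq> span T)"

lemma findim_subset: "findim D \<Longrightarrow> C \<subseteq> D \<Longrightarrow> findim C"
  by (auto simp: findim_def)

lemma findim_basis:
  assumes "findim C" "subspace C"
  obtains B where "B \<subseteq> C" "independent B" "finite B" "span B = C" "card B = dim C"
proof -
  obtain B where B: "B \<subseteq> C" "independent B" "C \<subseteq> span B" "card B = dim C"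
    using basis_exists[of C] by blast
  obtain T where T: "finite T" "C \<subseteq> span T" using assms by (auto simp: findim_def)
  have "finite B" using independent_span_bound[OF T(1) B(2)] B(1) T(2) by auto
  moreover have "span B = C"
    using B assms(2) span_minimal by blast
  ultimately show ?thesis using that B by blast
qed

lemma dim_less:
  assumes "findim V" "subspace U" "subspace V" "U \<subset> V"
  shows "dim U < dim V"
proof -
  have "findim U" using findim_subset[OF assms(1)] assms(4) by blast
  then obtain B where B: "B \<subseteq> U" "independent B" "finite B" "span B = U" "card B = dim U"
    using findim_basis[OF _ assms(2)] by metis
  obtain B' where B': "finite B'" "span B' = V" "card B' = dim V"
    using findim_basis[OF assms(1,3)] by metis
  obtain x where x: "x \<in> V" "x \<notin> U" using assms by blast
  have "independent (insert x B)" using B x by (simp add: independent_insert)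
  moreover have "insert x B \<subseteq> span B'" using B' x B assms by blast
  ultimately have "card (insert x B) \<le> card B'"
    using independent_span_bound[OF B'(1)] by blast
  moreover have "x \<notin> B" using x B by blast
  ultimately show ?thesis using B B' by simp
qed

text \<open>Stability under both actions of the dual algebra replaces the condition that the
  comultiplication sends \<open>C\<close> to \<open>C \<otimes> C\<close>;
  \<open>subcoalgebra_iff\<close> identifies the two.\<close>

definition subcoalg :: "'h set \<Rightarrow> bool"
  where "subcoalg C \<longleftrightarrow> subspace C \<and> (\<forall>x\<in>C. \<forall>f. functional f \<longrightarrow> R f x \<in> C \<and> L f x \<in> C)"

definition simple_subcoalg :: "'h set \<Rightarrow> bool"
  where "simple_subcoalg C \<longleftrightarrow> subcoalg C \<and> C \<noteq> {0} \<and> (\<forall>D. subcoalg D \<and> D \<subseteq> C \<longrightarrow> D = {0} \<or> D = C)"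

lemma subcoalgD:
  assumes "subcoalg C"
  shows "subspace C" "x \<in> C \<Longrightarrow> functional f \<Longrightarrow> R f x \<in> C" "x \<in> C \<Longrightarrow> functional f \<Longrightarrow> L f x \<in> C"
  using assms by (auto simp: subcoalg_def)

lemma subcoalg_Int: "subcoalg C \<Longrightarrow> subcoalg D \<Longrightarrow> subcoalg (C \<inter> D)"
  by (auto simp: subcoalg_def subspace_inter)

lemma R_linear: "functional f \<Longrightarrow> R f (x + y) = R f x + R f y" "functional f \<Longrightarrow> R f (c *s x) = c *s R f x"
  "functional f \<Longrightarrow> R f 0 = 0"
  using linD[OF lin_R'] by blast+

lemma L_linear: "functional f \<Longrightarrow> L f (x + y) = L f x + L f y" "functional f \<Longrightarrow> L f (c *s x) = c *s L f x"
  "functional f \<Longrightarrow> L f 0 = 0"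
  using linD[OF lin_L'] by blast+

lemma subcoalg_span:
  assumes "\<And>x f. x \<in> X \<Longrightarrow> functional f \<Longrightarrow> R f x \<in> span X \<and> L f x \<in> span X"
  shows "subcoalg (span X)"
  unfolding subcoalg_def
proof (intro conjI ballI allI impI subspace_span)
  fix x f assume x: "x \<in> span X" and f: "functional f"
  show "R f x \<in> span X"
    using x by (induction rule: span_induct_alt)
      (auto simp: R_linear f assms span_zero span_add span_scale)
  show "L f x \<in> span X"
    using x by (induction rule: span_induct_alt)
      (auto simp: L_linear f assms span_zero span_add span_scale)
qed

lemma subcoalg_span_Union:
  assumes "\<And>C. C \<in> \<C> \<Longrightarrow> subcoalg C"
  shows "subcoalg (span (\<Union>\<C>))"
  by (rule subcoalg_span) (use assms subcoalgD in \<open>blast intro: span_base\<close>)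

lemma R_eq_0:
  assumes "subcoalg C" "x \<in> C" "functional f" "\<And>y. y \<in> C \<Longrightarrow> f y = 0"
  shows "R f x = 0"
proof (rule eq_if_functionals_eq)
  fix g assume g: "functional g"
  have "g (R f x) = f (L g x)" using assms(3) g by (simp add: f_R f_L)
  also have "\<dots> = g 0" using assms g by (simp add: subcoalgD linD(5)[OF g])
  finally show "g (R f x) = g 0" .
qed

text \<open>This puts to use that the coproduct of \<open>x\<close> lies in
  \<open>C \<otimes> C\<close>. The difference of the two forms is split by a projection
  \<open>t\<close> onto \<open>C\<close> applied to the second factor: one part dies because
  \<open>R f x\<close> lies in \<open>C\<close>, the other because \<open>R f x = 0\<close> when
  \<open>f\<close> vanishes on \<open>C\<close>.\<close>

lemma subcoalg_cm_eq:
  assumes C: "subcoalg C" "x \<in> C" and \<phi>: "bilin scale s \<phi>" and \<psi>: "bilin scale s \<psi>"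
    and eq: "\<And>a b. a \<in> C \<Longrightarrow> b \<in> C \<Longrightarrow> \<phi> a b = \<psi> a b"
  shows "cm \<phi> x = cm \<psi> x"
proof -
  obtain t where t: "endo t" "\<And>x. t x \<in> C" "\<And>x. x \<in> C \<Longrightarrow> t x = x"
    by (rule projection_exists[OF subcoalgD(1)[OF C(1)]]) blast
  define \<chi> where "\<chi> a b = \<phi> a b - \<psi> a b" for a b
  have \<chi>: "bilin scale s \<chi>"
    unfolding \<chi>_def by (intro bilinI lin_diff bilinD[OF \<phi>] bilinD[OF \<psi>])
  have *: "cm (\<lambda>a b. \<chi> a (t b)) x = 0"
  proof (rule cm_eq_0[where K = "{0}" and U = C and s = s])
    show "bilin scale s (\<lambda>a b. \<chi> a (t b))"
      by (intro bilinI lin_bilin1[OF \<chi>] lin_bilin2[OF \<chi>] lin_intros t)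
    show "\<chi> a (t b) = 0" if "a \<in> C" for a b using eq[OF that t(2)] by (simp add: \<chi>_def)
    show "\<chi> a (t b) = 0" if "b \<in> {0}" for a b
      using that by (simp add: linD(5)[OF t(1)] linD(5)[OF bilinD(2)[OF \<chi>]])
  qed (use C subcoalgD in auto)
  have "cm (\<lambda>a b. \<chi> a (b - t b)) x = 0"
  proof (rule cm_eq_0[where K = C and U = "{0}" and s = s])
    show "bilin scale s (\<lambda>a b. \<chi> a (b - t b))"
      by (intro bilinI lin_bilin1[OF \<chi>] lin_bilin2[OF \<chi>] lin_intros t)
    show "\<chi> a (b - t b) = 0" if "b \<in> C" for a b
      using that by (simp add: t linD(5)[OF bilinD(2)[OF \<chi>]])
    show "\<chi> a (b - t b) = 0" if "a \<in> {0}" for a b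
      using that by (simp add: linD(5)[OF bilinD(1)[OF \<chi>]])
  qed (use C subcoalgD R_eq_0 in auto)
  hence "cm \<chi> x = 0"
    using * by (simp add: linD(6)[OF bilinD(2)[OF \<chi>]] sweedler_diff)
  thus ?thesis unfolding \<chi>_def sweedler_diff by simp
qed

text \<open>The fundamental theorem of coalgebras: the subbimodule over the dual algebra generated
  by \<open>X\<close> is spanned by the middle factors of the iterated coproducts of the elements of
  \<open>X\<close>, and these are finite in number.\<close>

lemma findim_subcoalg_exists:
  assumes "finite X" "X \<subseteq> D" "subcoalg D"
  obtains C where "subcoalg C" "findim C" "X \<subseteq> C" "C \<subseteq> D"
proof -
  let ?G = "{L g (R f x) | g f x. functional g \<and> functional f \<and> x \<in> X}"
  have "subcoalg (span ?G)"
  proof (rule subcoalg_span)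
    fix y h assume "y \<in> ?G" and h: "functional h"
    then obtain g f x where y: "y = L g (R f x)" and gf: "functional g" "functional f" and "x \<in> X"
      by blast
    have "L h y = L (conv g h) (R f x)" "R h y = L g (R (conv h f) x)"
      unfolding y using gf h by (simp_all add: L_L L_R[symmetric] R_R)
    hence "L h y \<in> ?G" "R h y \<in> ?G"
      using gf h lin_conv \<open>x \<in> X\<close> by blast+
    thus "R h y \<in> span ?G \<and> L h y \<in> span ?G" by (simp add: span_base)
  qed
  moreover have "X \<subseteq> span ?G"
  proof
    fix x assume "x \<in> X"
    hence "L counit (R counit x) \<in> ?G" using lin_counit_ax by blast
    thus "x \<in> span ?G" by (simp add: span_base)
  qed
  moreover have "span ?G \<subseteq> D"
    using assms subcoalgD by (intro span_minimal) blast+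
  moreover have "findim (span ?G)"
    unfolding findim_def
  proof (intro exI conjI span_minimal subspace_span subsetI)
    let ?T = "\<Union>x\<in>X. \<Union>(a, b)\<in>set (delta x). snd ` set (delta a)"
    show "finite ?T" using assms(1) by auto
    fix y assume "y \<in> ?G"
    then obtain g f x where y: "y = L g (R f x)" and gf: "functional g" "functional f" and "x \<in> X"
      by blast
    have sl: "(\<Sum>p\<leftarrow>l. F p) \<in> span ?T" if "\<And>p. p \<in> set l \<Longrightarrow> F p \<in> span ?T" for F and l :: "('h \<times> 'h) list"
      using that by (induction l) (auto simp: span_zero span_add)
    have "y = cm (\<lambda>a b. f b *s L g a) x"
      unfolding y R_def by (simp add: sweedler_hom[OF lin_L'] gf linD(4)[OF lin_L'])
    also have "\<dots> \<in> span ?T"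
      unfolding sweedler_def L_def
    proof (rule sl, clarsimp, intro span_scale sl, clarsimp)
      fix a b a' b' assume "(a, b) \<in> set (delta x)" "(a', b') \<in> set (delta a)"
      hence "b' \<in> ?T" using \<open>x \<in> X\<close> by force
      thus "g a' *s b' \<in> span ?T" by (intro span_scale span_base)
    qed
    finally show "y \<in> span ?T" .
  qed
  ultimately show ?thesis using that by blast
qed

text \<open>\<open>x\<close> is in \<open>wedge K (Suc n)\<close> iff its coproduct lies in
  \<open>wedge K n \<otimes> H + H \<otimes> K\<close>, tested by the functionals that vanish on
  \<open>K\<close>. So \<open>wedge K n\<close> is the wedge of n + 1 copies of
  \<open>K\<close>.\<close>

primrec wedge :: "'h set \<Rightarrow> nat \<Rightarrow> 'h set" where
  "wedge K 0 = K"
| "wedge K (Suc n) = {x. \<forall>f. functional f \<longrightarrow> (\<forall>k\<in>K. f k = 0) \<longrightarrow> R f x \<in> wedge K n}"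

lemma conv_vanish_left:
  assumes "subcoalg K" "functional f" "functional g" "\<And>k. k \<in> K \<Longrightarrow> f k = 0" "k \<in> K"
  shows "conv f g k = 0"
  using assms by (simp add: f_R[symmetric] subcoalgD)

lemma conv_vanish_right:
  assumes "subcoalg K" "functional f" "functional g" "\<And>k. k \<in> K \<Longrightarrow> g k = 0" "k \<in> K"
  shows "conv f g k = 0"
  using assms by (simp add: f_L[symmetric] subcoalgD)

text \<open>Stability under \<open>R\<close> holds because the functionals vanishing on
  \<open>K\<close> form an ideal for \<open>conv\<close>; stability under \<open>L\<close> because
  \<open>L\<close> commutes with \<open>R\<close>.\<close>

lemma subcoalg_wedge:
  assumes K: "subcoalg K"
  shows "subcoalg (wedge K n)"
proof (induction n)
  case (Suc n)
  have "subspace (wedge K (Suc n))"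
    using subcoalgD(1)[OF Suc] unfolding subspace_def by (auto simp: R_linear)
  moreover have "R g x \<in> wedge K (Suc n)" "L g x \<in> wedge K (Suc n)"
    if x: "x \<in> wedge K (Suc n)" and g: "functional g" for x g
  proof -
    have "R f (R g x) \<in> wedge K n" if f: "functional f" "\<forall>k\<in>K. f k = 0" for f
      using x f g lin_conv[OF f(1) g] conv_vanish_left[OF K f(1) g] by (simp add: R_R)
    thus "R g x \<in> wedge K (Suc n)" by simp
    have "R f (L g x) \<in> wedge K n" if f: "functional f" "\<forall>k\<in>K. f k = 0" for f
      using x f g subcoalgD(3)[OF Suc, of "R f x" g] by (simp add: L_R[symmetric])
    thus "L g x \<in> wedge K (Suc n)" by simp
  qed
  ultimately show ?case by (simp add: subcoalg_def)
qed (use K in simp)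

lemma wedge_Suc: "subcoalg K \<Longrightarrow> wedge K n \<subseteq> wedge K (Suc n)"
proof (induction n)
  case 0
  thus ?case using subcoalgD(2)[OF 0] by auto
next
  case (Suc n)
  thus ?case by auto
qed

lemma wedge_mono: "subcoalg K \<Longrightarrow> m \<le> n \<Longrightarrow> wedge K m \<subseteq> wedge K n"
  using lift_Suc_mono_le[of "wedge K"] wedge_Suc by blast

text \<open>The form in which the filtration is used throughout: a bilinear map is tested on pairs
  from \<open>C\<close> and \<open>K\<close>, and on pairs whose first factor lies one level lower.
  The subcoalgebra \<open>D\<close> confines the second factor, which matters when the map is
  controlled only there.\<close>

lemma wedge_cm_eq_0:
  assumes K: "subcoalg K" "K \<subseteq> D" and C: "subcoalg C" "x \<in> C" "C \<subseteq> wedge K m" "C \<subseteq> D"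
    and D: "subcoalg D" and \<psi>: "bilin scale s \<psi>"
    and base: "\<And>a b. a \<in> C \<Longrightarrow> b \<in> K \<Longrightarrow> \<psi> a b = 0"
    and step: "\<And>n a b. m = Suc n \<Longrightarrow> a \<in> C \<Longrightarrow> a \<in> wedge K n \<Longrightarrow> b \<in> D \<Longrightarrow> \<psi> a b = 0"
  shows "cm \<psi> x = 0"
proof (cases m)
  case 0
  have "vector_space s" using linD(2)[OF bilinD(1)[OF \<psi>]] .
  hence "cm \<psi> x = cm (\<lambda>a b. 0) x"
    using C 0 base
    by (intro subcoalg_cm_eq[OF C(1,2) \<psi>] bilinI lin_zero vector_space_axioms) auto
  thus ?thesis by simp
next
  case (Suc n)
  obtain t where t: "endo t" "\<And>x. t x \<in> C" "\<And>x. x \<in> C \<Longrightarrow> t x = x"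
    by (rule projection_exists[OF subcoalgD(1)[OF C(1)]]) blast
  obtain t' where t': "endo t'" "\<And>x. t' x \<in> D" "\<And>x. x \<in> D \<Longrightarrow> t' x = x"
    by (rule projection_exists[OF subcoalgD(1)[OF D]]) blast
  have b: "bilin scale s (\<lambda>a b. \<psi> (t a) (t' b))"
    by (intro bilinI lin_bilin1[OF \<psi>] lin_bilin2[OF \<psi>] t t')
  have "cm \<psi> x = cm (\<lambda>a b. \<psi> (t a) (t' b)) x"
  proof (rule subcoalg_cm_eq[OF C(1,2) \<psi> b])
    fix a b assume "a \<in> C" "b \<in> C"
    thus "\<psi> a b = \<psi> (t a) (t' b)" using t(3) t'(3) C(4) by auto
  qed
  also have "\<dots> = 0"
  proof (rule cm_eq_0[OF b subcoalgD(1)[OF K(1)], where U = "C \<inter> wedge K n"])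
    show "R f x \<in> C \<inter> wedge K n" if "functional f" "\<And>k. k \<in> K \<Longrightarrow> f k = 0" for f
      using C that Suc subcoalgD(2)[OF C(1,2)] by auto
    show "\<psi> (t a) (t' b) = 0" if "a \<in> C \<inter> wedge K n" for a b
      using step[OF Suc _ _ t'(2), of a b] that t(3) by auto
    show "\<psi> (t a) (t' b) = 0" if "b \<in> K" for a b
      using base[OF t(2) that, of a] t'(3)[of b] K(2) that by auto
  qed
  finally show ?thesis .
qed

text \<open>The extra \<open>Suc\<close> counts factors: m + 1 and n + 1 copies of \<open>K\<close>
  make m + n + 2.\<close>

lemma wedge_add:
  assumes K: "subcoalg K"
    and "\<And>g. functional g \<Longrightarrow> (\<And>y. y \<in> wedge K n \<Longrightarrow> g y = 0) \<Longrightarrow> R g x \<in> wedge K m"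
  shows "x \<in> wedge K (Suc (m + n))"
  using assms(2)
proof (induction n arbitrary: x)
  case (Suc n)
  have "R h x \<in> wedge K (Suc (m + n))" if h: "functional h" "\<forall>k\<in>K. h k = 0" for h
  proof (rule Suc.IH)
    fix g assume g: "functional g" "\<And>y. y \<in> wedge K n \<Longrightarrow> g y = 0"
    have "conv g h y = 0" if "y \<in> wedge K (Suc n)" for y
      using that g h by (simp add: f_R[symmetric])
    thus "R g (R h x) \<in> wedge K m"
      unfolding R_R[OF g(1) h(1)] by (intro Suc.prems lin_conv g(1) h(1))
  qed
  thus ?case by simp
qed simp

end

section \<open>Exhaustion by wedge powers\<close>

context coalgebra
begin

lemma subspace_UN_wedge:
  assumes "subcoalg K"
  shows "subspace (\<Union>n. wedge K n)"
  unfolding subspace_def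
proof (intro conjI ballI allI)
  note s = subcoalgD(1)[OF subcoalg_wedge[OF assms]]
  show "0 \<in> (\<Union>n. wedge K n)" using subspace_0[OF s] by blast
  fix x assume "x \<in> (\<Union>n. wedge K n)"
  then obtain m where m: "x \<in> wedge K m" by blast
  thus "c *s x \<in> (\<Union>n. wedge K n)" for c using subspace_scale[OF s] by blast
  fix y assume "y \<in> (\<Union>n. wedge K n)"
  then obtain n where n: "y \<in> wedge K n" by blast
  have "x \<in> wedge K (max m n)" "y \<in> wedge K (max m n)"
    using m n wedge_mono[OF assms, of m "max m n"] wedge_mono[OF assms, of n "max m n"] by auto
  thus "x + y \<in> (\<Union>n. wedge K n)" using subspace_add[OF s] by blast
qed

lemma findim_subset_wedge:
  assumes K: "subcoalg K" and N: "findim N" "subspace N" "N \<subseteq> (\<Union>n. wedge K n)"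
  shows "\<exists>n. N \<subseteq> wedge K n"
proof -
  obtain B where B: "B \<subseteq> N" "finite B" "span B = N"
    using findim_basis[OF N(1,2)] by metis
  have "\<forall>b\<in>B. \<exists>n. b \<in> wedge K n" using B N by blast
  then obtain f where f: "\<And>b. b \<in> B \<Longrightarrow> b \<in> wedge K (f b)" by metis
  define n where "n = Max (insert 0 (f ` B))"
  have "B \<subseteq> wedge K n"
  proof
    fix b assume "b \<in> B"
    hence "f b \<le> n" using B by (auto simp: n_def)
    thus "b \<in> wedge K n" using f[OF \<open>b \<in> B\<close>] wedge_mono[OF K] by blast
  qed
  hence "span B \<subseteq> wedge K n" by (intro span_minimal subcoalgD(1) subcoalg_wedge K)
  thus ?thesis using B by blast
qed

text \<open>The annihilators in the dual algebra of \<open>D\<close> of the proper subcoalgebras all contain that of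
  their sum \<open>N\<close>; if the latter were not of square zero, then the dual algebra would be prime,
  hence simple.\<close>

lemma conv_eq_0_of_unique_maximal:
  assumes D: "subcoalg D" "findim D" and N: "subcoalg N" "N \<subset> D" "N \<noteq> {0}"
    and max: "\<And>C. subcoalg C \<Longrightarrow> C \<subset> D \<Longrightarrow> C \<subseteq> N"
    and f: "functional f" "\<And>x. x \<in> N \<Longrightarrow> f x = 0" and g: "functional g" "\<And>x. x \<in> N \<Longrightarrow> g x = 0"
    and "x \<in> D"
  shows "conv f g x = 0"
proof (rule ccontr)
  assume nz: "conv f g x \<noteq> 0"
  obtain B where B: "B \<subseteq> D" "independent B" "finite B" "span B = D"
    using findim_basis[OF D(2) subcoalgD(1)[OF D(1)]] by metis
  \<comment> \<open>\<open>\<iota>\<close> encodes the restriction of a functional to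
    \<open>D\<close> by a vector with the same coordinates, so that \<open>dim\<close> becomes
    available as the measure on left ideals.\<close>
  define \<iota> :: "('h \<Rightarrow> 'k) \<Rightarrow> 'h" where "\<iota> f = (\<Sum>b\<in>B. f b *s b)" for f
  define A where "A = {f. functional f}"
  define Z where "Z = {f. functional f \<and> (\<forall>x\<in>D. f x = 0)}"
  define M where "M = {f. functional f \<and> (\<forall>x\<in>N. f x = 0)}"
  \<comment> \<open>The largest subcoalgebra of \<open>D\<close> on which \<open>u\<close> vanishes.
    It is proper when \<open>u\<close> is nonzero on \<open>D\<close>, hence contained in
    \<open>N\<close>.\<close>
  define ker where "ker u = {x \<in> D. \<forall>h h'. functional h \<longrightarrow> functional h' \<longrightarrow> u (L h (R h' x)) = 0}"
    for u :: "'h \<Rightarrow> 'k"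
  have fun_add: "functional (u + v)" "functional (u - v)" if "functional u" "functional v" for u v
    using lin_add[OF that] lin_diff[OF that] by (simp_all add: plus_fun_def fun_diff_def)
  have ker: "ker u \<subseteq> N" if u: "u \<in> A" "u \<notin> Z" for u
  proof (rule max)
    have u': "functional u" using u by (simp add: A_def)
    have "subspace (ker u)"
      unfolding ker_def subspace_def using subcoalgD(1)[OF D(1)]
      by (auto simp: R_linear L_linear linD[OF u'] subspace_def)
    moreover have "R k y \<in> ker u" "L k y \<in> ker u" if "y \<in> ker u" "functional k" for y k
      using that D lin_conv by (auto simp: ker_def subcoalgD R_R L_R[symmetric])
        (auto simp: L_R R_R L_L lin_conv)
    ultimately show "subcoalg (ker u)" by (auto simp: subcoalg_def)
    obtain y where y: "y \<in> D" "u y \<noteq> 0" using u by (auto simp: A_def Z_def)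
    have "y \<notin> ker u"
      using y lin_counit_ax by (auto simp: ker_def intro!: exI[of _ counit])
    thus "ker u \<subset> D" using y by (auto simp: ker_def)
  qed
  have Zideal: "conv u v \<in> Z" "conv v u \<in> Z" if "functional u" "v \<in> Z" for u v
    using that D lin_conv conv_vanish_left[OF D(1)] conv_vanish_right[OF D(1)] by (auto simp: Z_def)
  \<comment> \<open>If the ideals of \<open>u\<close> and \<open>v\<close> had product zero, the
    ideal of \<open>v\<close> would move \<open>D\<close> into \<open>ker u\<close>, hence into
    \<open>N\<close>, where \<open>f\<close> vanishes. Then \<open>L f x\<close> would lie in
    \<open>ker v\<close>, again inside \<open>N\<close>, and \<open>conv f g x = g (L f x)\<close>
    would vanish.\<close>
  have prime: "u \<in> Z \<or> v \<in> Z"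
    if u: "u \<in> A" and v: "v \<in> A" and uv: "\<And>h. h \<in> A \<Longrightarrow> conv (conv u h) v \<in> Z" for u v
  proof (rule ccontr)
    assume *: "\<not> (u \<in> Z \<or> v \<in> Z)"
    have u': "functional u" and v': "functional v" using u v by (auto simp: A_def)
    have 1: "R (conv (conv k v) k') y \<in> N" if "y \<in> D" and k: "functional k" "functional k'" for y k k'
    proof -
      let ?w = "conv (conv k v) k'"
      have w: "functional ?w" using k v' by (intro lin_conv)
      have "u (L h (R h' (R ?w y))) = 0" if h: "functional h" "functional h'" for h h'
      proof -
        have "u (L h (R h' (R ?w y))) = conv (conv h u) (conv h' ?w) y"
          using h u' w by (simp add: R_R f_L f_R lin_conv)
        also have "conv (conv h u) (conv h' ?w) = conv h (conv (conv (conv u (conv h' k)) v) k')"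
          using h u' v' k by (simp add: conv_assoc lin_conv)
        also have "\<dots> y = 0"
          using Zideal(1)[OF h(1) Zideal(2)[OF k(2) uv[of "conv h' k"]]] \<open>y \<in> D\<close> h k
          by (simp add: A_def Z_def lin_conv)
        finally show ?thesis .
      qed
      hence "R ?w y \<in> ker u" using D \<open>y \<in> D\<close> w by (auto simp: ker_def subcoalgD)
      thus ?thesis using ker[OF u] * by blast
    qed
    have "v (L k (R k' (L f x))) = 0" if k: "functional k" "functional k'" for k k'
    proof -
      have "v (L k (R k' (L f x))) = conv (conv k v) k' (L f x)"
        using k v' by (simp add: f_L f_R lin_conv)
      also have "\<dots> = f (R (conv (conv k v) k') x)"
        using k v' f by (simp add: f_L f_R lin_conv)
      also have "\<dots> = 0" using 1[OF \<open>x \<in> D\<close> k] by (rule f)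
      finally show ?thesis .
    qed
    hence "L f x \<in> ker v" using D \<open>x \<in> D\<close> f by (auto simp: ker_def subcoalgD)
    hence "g (L f x) = 0" using ker[OF v] * g by blast
    thus False using nz g by (simp add: f_L)
  qed
  interpret prime_artinian conv counit A Z
  proof
    show "conv (u + v) w = conv u w + conv v w" "conv (u - v) w = conv u w - conv v w"
      if "u \<in> A" "v \<in> A" "w \<in> A" for u v w
      by (auto simp: conv_def fun_eq_iff algebra_simps sweedler_add sweedler_diff)
    show "conv w (u + v) = conv w u + conv w v" "conv w (u - v) = conv w u - conv w v"
      if "u \<in> A" "v \<in> A" "w \<in> A" for u v w
      by (auto simp: conv_def fun_eq_iff algebra_simps sweedler_add sweedler_diff)
    show "0 \<in> Z" using lin_zero[OF vs] by (simp add: Z_def zero_fun_def)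
  qed (use Zideal prime in \<open>auto simp: A_def Z_def fun_add lin_conv lin_counit_ax conv_assoc conv_counit\<close>)
  have \<iota>: "\<iota> (u + v) = \<iota> u + \<iota> v" "\<iota> (\<lambda>x. c * u x) = c *s \<iota> u" for u v c
    by (auto simp: \<iota>_def algebra_simps sum.distrib scale_sum_right)
  have lid_dim: "dim (\<iota> ` P) < dim (\<iota> ` Q)" if P: "lid P" and Q: "lid Q" and "P \<subset> Q" for P Q
  proof (rule dim_less)
    have "findim (span B)" using B by (auto simp: findim_def)
    thus "findim (\<iota> ` Q)"
    proof (rule findim_subset)
      show "\<iota> ` Q \<subseteq> span B"
        unfolding \<iota>_def by (intro image_subsetI span_sum span_scale span_base)
    qed
    have "subspace (\<iota> ` P)" if P: "lid P" for P
      unfolding subspace_def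
    proof (intro conjI ballI allI)
      have "\<iota> 0 = 0" by (simp add: \<iota>_def)
      thus "0 \<in> \<iota> ` P" using lidD(2)[OF P Z(1)] by force
      fix a assume "a \<in> \<iota> ` P"
      then obtain u where u: "u \<in> P" "a = \<iota> u" by blast
      \<comment> \<open>Multiplication by \<open>c\<close> is convolution with \<open>c\<close>
        times the counit, so left ideals are subspaces.\<close>
      show "c *s a \<in> \<iota> ` P" for c
      proof -
        have 1: "functional (\<lambda>x. c * counit x)" by (rule lin_timesR[OF lin_counit_ax])
        have u': "functional u" using lidD(1)[OF P u(1)] by (simp add: A_def)
        have "conv (\<lambda>x. c * counit x) u = (\<lambda>x. c * conv counit u x)"
          unfolding conv_def by (simp add: sweedler_hom[OF lin_timesR[OF lin_ident[OF vs(2)]]] mult.assoc)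
        hence "conv (\<lambda>x. c * counit x) u = (\<lambda>x. c * u x)" using conv_counit(1)[OF u'] by simp
        hence "(\<lambda>x. c * u x) \<in> P" using lidD(5)[OF P, of "\<lambda>x. c * counit x" u] u 1 by (simp add: A_def)
        thus ?thesis using u \<iota>(2)[of c u] by (metis imageI)
      qed
      fix b assume "b \<in> \<iota> ` P"
      then obtain v where v: "v \<in> P" "b = \<iota> v" by blast
      show "a + b \<in> \<iota> ` P" using lidD(3)[OF P u(1) v(1)] u v \<iota>(1) by (metis imageI)
    qed
    thus "subspace (\<iota> ` P)" "subspace (\<iota> ` Q)" using P Q by auto
    show "\<iota> ` P \<subset> \<iota> ` Q"
    proof
      show "\<iota> ` P \<subseteq> \<iota> ` Q" using \<open>P \<subset> Q\<close> by blast
      obtain u where u: "u \<in> Q" "u \<notin> P" using \<open>P \<subset> Q\<close> by blast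
      have "\<iota> u \<notin> \<iota> ` P"
      proof
        assume "\<iota> u \<in> \<iota> ` P"
        then obtain v where v: "v \<in> P" "\<iota> u = \<iota> v" by blast
        have uv: "functional u" "functional v"
          using lidD(1)[OF P v(1)] lidD(1)[OF Q u(1)] by (auto simp: A_def)
        have "(\<Sum>b\<in>B. (u b - v b) *s b) = 0"
          using v(2) by (simp add: \<iota>_def scale_left_diff_distrib sum_subtractf)
        hence eq: "u b = v b" if "b \<in> B" for b
          using independentD[OF B(2) B(3) subset_refl, of "\<lambda>b. u b - v b" b] that by simp
        interpret vp: vector_space_pair scale "(*) :: 'k \<Rightarrow> 'k \<Rightarrow> 'k"
          using vs by (simp add: vector_space_pair_def)
        have "u y = v y" if "y \<in> D" for y
          by (rule vp.linear_eq_on[OF uv, of _ B]) (use B that eq in auto)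
        hence "u - v \<in> Z" using fun_add(2)[OF uv] by (simp add: Z_def)
        hence "(u - v) + v \<in> P" using lidD(2,3)[OF P] v by blast
        thus False using u by simp
      qed
      thus "\<iota> ` P \<noteq> \<iota> ` Q" using u by blast
    qed
  qed
  \<comment> \<open>\<open>M\<close> is a nonzero two-sided ideal of a simple ring. Once the counit
    lies in it, the counit vanishes on the subcoalgebra \<open>N\<close>, which forces
    \<open>N\<close> to be zero.\<close>
  have "counit \<in> M"
  proof (rule one_in_ideal[where m = "\<lambda>P. dim (\<iota> ` P)"])
    show "lid M"
      unfolding lid_def using N(2) conv_vanish_right[OF N(1)]
      by (auto simp: M_def Z_def A_def fun_add lin_conv)
    obtain y where y: "y \<in> D" "y \<notin> N" using N by blast
    obtain u where "functional u" "\<And>z. z \<in> N \<Longrightarrow> u z = 0" "u y = 1"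
      using functional_separates_subspace[OF subcoalgD(1)[OF N(1)] y(2)] by metis
    thus "\<not> M \<subseteq> Z" using y by (auto simp: M_def Z_def)
    show "conv u v \<in> M" if "u \<in> M" "v \<in> A" for u v
      using that conv_vanish_left[OF N(1)] lin_conv by (auto simp: M_def A_def)
  qed (rule lid_dim)
  have "y = 0" if "y \<in> N" for y
  proof (rule eq_if_functionals_eq)
    fix u assume u: "functional u"
    have "u y = counit (R u y)" using u by (simp add: counit_R)
    also have "\<dots> = 0" using \<open>counit \<in> M\<close> subcoalgD(2)[OF N(1) that u] by (simp add: M_def)
    finally show "u y = u 0" by (simp add: linD(5)[OF u])
  qed
  hence "N = {0}" using subspace_0[OF subcoalgD(1)[OF N(1)]] by blast
  thus False using N(3) by blast
qed

text \<open>Let \<open>N\<close> be the sum of the proper subcoalgebras, covered by induction. If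
  \<open>N\<close> is proper and nonzero, its annihilator in the dual algebra of \<open>D\<close>
  squares to zero, so the coproduct of \<open>D\<close> lies in
  \<open>N \<otimes> D + D \<otimes> N\<close>, and \<open>wedge_add\<close> applies. The other
  cases are \<open>D\<close> being \<open>N\<close>, zero or simple.\<close>

lemma findim_subset_UN_wedge:
  assumes "findim D" "subcoalg D" and K: "subcoalg K"
    and "\<And>C. simple_subcoalg C \<Longrightarrow> C \<subseteq> D \<Longrightarrow> C \<subseteq> K"
  shows "D \<subseteq> (\<Union>n. wedge K n)"
  using assms(1,2,4)
proof (induction "dim D" arbitrary: D rule: less_induct)
  case less
  note D = less.prems(1,2) and Ds = subcoalgD(1)[OF less.prems(2)]
  let ?W = "\<Union>n. wedge K n"
  define N where "N = span (\<Union>{C. subcoalg C \<and> C \<subset> D})"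
  have N: "subcoalg N" unfolding N_def by (rule subcoalg_span_Union) auto
  have ND: "N \<subseteq> D" unfolding N_def by (rule span_minimal[OF _ Ds]) auto
  have max: "C \<subseteq> N" if "subcoalg C" "C \<subset> D" for C
    unfolding N_def using that by (blast intro: span_base)
  have "C \<subseteq> ?W" if "subcoalg C" "C \<subset> D" for C
  proof (rule less.hyps)
    show "dim C < dim D" using dim_less[OF D(1) subcoalgD(1)[OF that(1)] Ds that(2)] .
    show "findim C" using findim_subset[OF D(1)] that(2) by blast
  qed (use that less.prems in blast)+
  hence NW: "N \<subseteq> ?W" unfolding N_def by (intro span_minimal subspace_UN_wedge[OF K]) blast
  consider "N = D" | "D = {0}" | "N = {0}" "D \<noteq> {0}" | "N \<subset> D" "N \<noteq> {0}" using ND by blast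
  thus ?case
  proof cases
    case 1
    thus ?thesis using NW by simp
  next
    case 2
    thus ?thesis using subspace_0[OF subspace_UN_wedge[OF K]] by simp
  next
    case 3
    have "simple_subcoalg D"
      unfolding simple_subcoalg_def using 3 D max
      by (metis psubsetI subset_singletonD subspace_0 subcoalgD(1) empty_iff)
    hence "D \<subseteq> wedge K 0" using less.prems(3) by simp
    thus ?thesis by blast
  next
    case 4
    have "findim N" using findim_subset[OF D(1) ND] .
    then obtain n where n: "N \<subseteq> wedge K n"
      using findim_subset_wedge[OF K _ subcoalgD(1)[OF N] NW] by blast
    have "x \<in> wedge K (Suc (n + n))" if x: "x \<in> D" for x
    proof (rule wedge_add[OF K])
      fix g assume g: "functional g" "\<And>y. y \<in> wedge K n \<Longrightarrow> g y = 0"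
      have "R g x \<in> N"
      proof (rule ccontr)
        assume "R g x \<notin> N"
        then obtain f where f: "functional f" "\<And>y. y \<in> N \<Longrightarrow> f y = 0" "f (R g x) = 1"
          using functional_separates_subspace[OF subcoalgD(1)[OF N]] by metis
        have "conv f g x = 0"
          by (rule conv_eq_0_of_unique_maximal[OF D(2,1) N 4 max f(1,2) g(1) _ x]) (use g n in blast)+
        thus False using f by (simp add: f_R)
      qed
      thus "R g x \<in> wedge K n" using n by blast
    qed
    thus ?thesis by blast
  qed
qed

lemma wedge_exhausts:
  assumes K: "subcoalg K" and "\<And>C. simple_subcoalg C \<Longrightarrow> C \<subseteq> K"
  shows "x \<in> (\<Union>n. wedge K n)"
proof -
  have "subcoalg UNIV" by (simp add: subcoalg_def)
  then obtain C where "subcoalg C" "findim C" "x \<in> C"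
    using findim_subcoalg_exists[of "{x}" UNIV] by auto
  thus ?thesis using findim_subset_UN_wedge[OF _ _ K] assms(2) by blast
qed

text \<open>A simple \<open>C\<close> lies in each wedge power or meets it in zero. If the least
  level containing \<open>C\<close> were positive, \<open>R f y\<close> would be zero for
  \<open>y\<close> in \<open>C\<close> and every \<open>f\<close> vanishing on \<open>K\<close>;
  applying the counit gives \<open>f y = 0\<close>, so \<open>y\<close> is in
  \<open>K\<close>.\<close>

lemma simple_subset_wedge_base:
  assumes K: "subcoalg K" and C: "simple_subcoalg C" "C \<subseteq> (\<Union>n. wedge K n)"
  shows "C \<subseteq> K"
proof -
  have Cs: "subcoalg C" "C \<noteq> {0}" using C by (auto simp: simple_subcoalg_def)
  have CI: "C \<inter> wedge K n = {0} \<or> C \<subseteq> wedge K n" for n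
  proof -
    have "subcoalg (C \<inter> wedge K n)" using Cs(1) subcoalg_wedge[OF K] by (rule subcoalg_Int)
    thus ?thesis using C(1) unfolding simple_subcoalg_def by blast
  qed
  obtain x where x: "x \<in> C" "x \<noteq> 0" using Cs subspace_0[OF subcoalgD(1)[OF Cs(1)]] by blast
  then obtain n where "C \<inter> wedge K n \<noteq> {0}" using C(2) by blast
  hence ex: "\<exists>n. C \<subseteq> wedge K n" using CI by blast
  define n where "n = (LEAST n. C \<subseteq> wedge K n)"
  have n: "C \<subseteq> wedge K n" unfolding n_def by (rule LeastI_ex[OF ex])
  show ?thesis
  proof (cases n)
    case (Suc m)
    have "\<not> C \<subseteq> wedge K m" using not_less_Least[of m "\<lambda>n. C \<subseteq> wedge K n"] Suc n_def by simp
    hence m: "C \<inter> wedge K m = {0}" using CI by blast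
    show ?thesis
    proof
      fix y assume y: "y \<in> C"
      show "y \<in> K"
      proof (rule ccontr)
        assume "y \<notin> K"
        then obtain f where f: "functional f" "\<And>k. k \<in> K \<Longrightarrow> f k = 0" "f y = 1"
          using functional_separates_subspace[OF subcoalgD(1)[OF K]] by metis
        have "R f y \<in> C \<inter> wedge K m" using y f n Suc subcoalgD[OF Cs(1)] by auto
        hence "R f y = 0" using m by blast
        hence "f y = 0" using counit_R[OF f(1), of y] linD(5)[OF lin_counit_ax] by simp
        thus False using f by simp
      qed
    qed
  qed (use n in simp)
qed

end


section \<open>Hopf algebras\<close>

text \<open>The multiplication is a parameter and not that of a type class, so that results carry over
  to the Hopf algebra with opposite multiplication and comultiplication.\<close>

locale hopf = coalgebra scale delta counit
  for scale :: "'k::field \<Rightarrow> 'h::ab_group_add \<Rightarrow> 'h" (infixr "*s" 75)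
    and delta counit +
  fixes mul :: "'h \<Rightarrow> 'h \<Rightarrow> 'h" (infixl "\<odot>" 70)
    and one :: 'h ("\<one>")
    and S :: "'h \<Rightarrow> 'h"
  assumes bilin_mul: "bilin scale scale (\<odot>)"
    and mul_assoc: "x \<odot> y \<odot> z = x \<odot> (y \<odot> z)"
    and one_mul [simp]: "\<one> \<odot> x = x" and mul_one [simp]: "x \<odot> \<one> = x"
    and cm_mul_ax: "bilin scale (*) \<phi> \<Longrightarrow>
      sweedler delta \<phi> (x \<odot> y) = sweedler delta (\<lambda>a b. sweedler delta (\<lambda>c d. \<phi> (a \<odot> c) (b \<odot> d)) y) x"
    and cm_one_ax: "bilin scale (*) \<phi> \<Longrightarrow> sweedler delta \<phi> \<one> = \<phi> \<one> \<one>"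
    and counit_mul: "counit (x \<odot> y) = counit x * counit y"
    and counit_one: "counit \<one> = 1"
    and lin_S_ax: "lin scale scale S"
    and S_l: "sweedler delta (\<lambda>a b. S a \<odot> b) x = counit x *s \<one>"
    and S_r: "sweedler delta (\<lambda>a b. a \<odot> S b) x = counit x *s \<one>"
begin

lemmas lin_mul1 = lin_bilin1[OF bilin_mul]
lemmas lin_mul2 = lin_bilin2[OF bilin_mul]
lemmas lin_S = lin_comp[OF lin_S_ax]
lemmas hlin = lin_intros lin_mul1 lin_mul2 lin_S

lemmas mul_simps = linD(3-8)[OF bilinD(1)[OF bilin_mul]] linD(3-8)[OF bilinD(2)[OF bilin_mul]]

lemmas cm_mul1 = sweedler_hom[OF bilinD(1)[OF bilin_mul]]
lemmas cm_mul2 = sweedler_hom[OF bilinD(2)[OF bilin_mul]]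
lemmas cm_scale = sweedler_hom[OF lin_scaleR[OF lin_ident[OF vector_space_axioms]]]

lemma cm_mul:
  assumes \<phi>: "bilin scale s \<phi>"
  shows "cm \<phi> (x \<odot> y) = cm (\<lambda>a b. cm (\<lambda>c d. \<phi> (a \<odot> c) (b \<odot> d)) y) x"
proof -
  interpret s: vector_space s using linD(2)[OF bilinD(1)[OF \<phi>]] .
  show ?thesis
  proof (rule s.eq_if_functionals_eq)
    fix f assume f: "lin s (*) f"
    have "bilin scale (*) (\<lambda>a b. f (\<phi> a b))" by (intro bilinI lin_comp[OF f] bilinD[OF \<phi>])
    from cm_mul_ax[OF this]
    show "f (cm \<phi> (x \<odot> y)) = f (cm (\<lambda>a b. cm (\<lambda>c d. \<phi> (a \<odot> c) (b \<odot> d)) y) x)"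
      by (simp add: sweedler_hom[OF f])
  qed
qed

lemma cm_one:
  assumes \<phi>: "bilin scale s \<phi>"
  shows "cm \<phi> \<one> = \<phi> \<one> \<one>"
proof -
  interpret s: vector_space s using linD(2)[OF bilinD(1)[OF \<phi>]] .
  show ?thesis
  proof (rule s.eq_if_functionals_eq)
    fix f assume f: "lin s (*) f"
    have "bilin scale (*) (\<lambda>a b. f (\<phi> a b))" by (intro bilinI lin_comp[OF f] bilinD[OF \<phi>])
    from cm_one_ax[OF this] show "f (cm \<phi> \<one>) = f (\<phi> \<one> \<one>)"
      by (simp add: sweedler_hom[OF f])
  qed
qed

lemma S_one: "S \<one> = \<one>"
proof -
  have "bilin scale scale (\<lambda>a b. S a \<odot> b)" by (intro hlin)
  from cm_one[OF this] show ?thesis by (simp add: S_l counit_one)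
qed

lemma counit_S: "counit (S x) = counit x"
proof -
  have "counit (cm (\<lambda>a b. S a \<odot> b) x) = counit x"
    by (simp add: S_l counit_one linD(4)[OF lin_counit_ax])
  hence "cm (\<lambda>a b. counit (S a) * counit b) x = counit x"
    by (simp add: sweedler_hom[OF lin_counit_ax] counit_mul)
  moreover have "counit (S (cm (\<lambda>a b. counit b *s a) x)) = cm (\<lambda>a b. counit (S a) * counit b) x"
    by (simp add: sweedler_hom[OF lin_counit] sweedler_hom[OF lin_S_ax] sweedler_hom[OF lin_counit_ax]
        linD(4)[OF lin_S_ax] linD(4)[OF lin_counit_ax] mult.commute)
  ultimately show ?thesis by (simp add: counit_r)
qed

lemma cm_counit_l: "lin scale s f \<Longrightarrow> cm (\<lambda>a b. s (counit a) (f b)) x = f x"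
  using sweedler_hom[of scale s f delta "\<lambda>a b. counit a *s b" x] by (simp add: linD(4) counit_l)

lemma cm_counit_r: "lin scale s f \<Longrightarrow> cm (\<lambda>a b. s (counit b) (f a)) x = f x"
  using sweedler_hom[of scale s f delta "\<lambda>a b. counit b *s a" x] by (simp add: linD(4) counit_r)

text \<open>Both sides equal \<open>S(x\<^sub>1 y\<^sub>1) x\<^sub>2 y\<^sub>2 S(y\<^sub>3) S(x\<^sub>3)\<close>.\<close>

lemma S_mul: "S (x \<odot> y) = S y \<odot> S x"
proof -
  let ?T = "\<lambda>a b c d e f. S (a \<odot> d) \<odot> (b \<odot> e \<odot> (S f \<odot> S c))"
  have inner1: "cm (\<lambda>b c. cm (\<lambda>e f. ?T a b c d e f) v) u = counit u *s counit v *s S (a \<odot> d)"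
    for a d u v
  proof -
    have "cm (\<lambda>e f. ?T a b c d e f) v = S (a \<odot> d) \<odot> (b \<odot> (cm (\<lambda>e f. e \<odot> S f) v \<odot> S c))" for b c
      by (simp add: cm_mul1 cm_mul2 mul_assoc)
    hence "cm (\<lambda>b c. cm (\<lambda>e f. ?T a b c d e f) v) u = cm (\<lambda>b c. counit v *s (S (a \<odot> d) \<odot> (b \<odot> S c))) u"
      by (simp add: S_r mul_simps)
    also have "\<dots> = counit v *s (S (a \<odot> d) \<odot> cm (\<lambda>b c. b \<odot> S c) u)"
      by (simp only: cm_scale cm_mul2)
    finally show ?thesis by (simp add: S_r mul_simps mult.commute)
  qed
  have "cm (\<lambda>a u. cm (\<lambda>d v. cm (\<lambda>b c. cm (\<lambda>e f. ?T a b c d e f) v) u) y) x = S (x \<odot> y)"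
  proof -
    have "cm (\<lambda>a u. cm (\<lambda>d v. counit u *s counit v *s S (a \<odot> d)) y) x
      = cm (\<lambda>a u. counit u *s S (a \<odot> y)) x"
    proof (rule sweedler_cong)
      fix a u
      have "lin scale scale (\<lambda>d. counit u *s S (a \<odot> d))" by (intro hlin)
      from cm_counit_r[OF this, of y]
      show "cm (\<lambda>d v. counit u *s counit v *s S (a \<odot> d)) y = counit u *s S (a \<odot> y)"
        by (simp add: mult.commute)
    qed
    also have "\<dots> = S (x \<odot> y)" by (rule cm_counit_r) (intro hlin)
    finally show ?thesis by (simp add: inner1)
  qed
  moreover have "cm (\<lambda>a u. cm (\<lambda>d v. cm (\<lambda>b c. cm (\<lambda>e f. ?T a b c d e f) v) u) y) x
      = cm (\<lambda>u c. cm (\<lambda>v f. cm (\<lambda>a b. cm (\<lambda>d e. ?T a b c d e f) v) u) y) x"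
  proof -
    have "cm (\<lambda>a u. cm (\<lambda>d v. cm (\<lambda>b c. cm (\<lambda>e f. ?T a b c d e f) v) u) y) x
      = cm (\<lambda>a u. cm (\<lambda>b c. cm (\<lambda>d v. cm (\<lambda>e f. ?T a b c d e f) v) y) u) x"
      by (subst sweedler_swap) (rule refl)
    also have "\<dots> = cm (\<lambda>u c. cm (\<lambda>a b. cm (\<lambda>d v. cm (\<lambda>e f. ?T a b c d e f) v) y) u) x"
      by (rule coassoc[symmetric, where s = scale]) (intro hlin)+
    also have "\<dots> = cm (\<lambda>u c. cm (\<lambda>a b. cm (\<lambda>v f. cm (\<lambda>d e. ?T a b c d e f) v) y) u) x"
      by (subst coassoc[symmetric, where s = scale]; (intro hlin)?) (rule refl)
    also have "\<dots> = cm (\<lambda>u c. cm (\<lambda>v f. cm (\<lambda>a b. cm (\<lambda>d e. ?T a b c d e f) v) u) y) x"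
      by (subst sweedler_swap) (rule refl)
    finally show ?thesis .
  qed
  moreover have "cm (\<lambda>u c. cm (\<lambda>v f. cm (\<lambda>a b. cm (\<lambda>d e. ?T a b c d e f) v) u) y) x = S y \<odot> S x"
  proof -
    have inner2: "cm (\<lambda>a b. cm (\<lambda>d e. ?T a b c d e f) v) u = counit u *s counit v *s (S f \<odot> S c)"
      for u v c f
    proof -
      have "bilin scale scale (\<lambda>a b. S a \<odot> b)" by (intro hlin)
      from cm_mul[OF this, of u v]
      have "cm (\<lambda>a b. cm (\<lambda>d e. S (a \<odot> d) \<odot> (b \<odot> e)) v) u = counit (u \<odot> v) *s \<one>" by (simp add: S_l)
      hence "cm (\<lambda>a b. cm (\<lambda>d e. S (a \<odot> d) \<odot> (b \<odot> e)) v) u \<odot> (S f \<odot> S c)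
        = counit u *s counit v *s (S f \<odot> S c)" by (simp add: counit_mul mul_simps)
      thus ?thesis by (simp add: cm_mul1 mul_assoc)
    qed
    have "cm (\<lambda>u c. cm (\<lambda>v f. counit u *s counit v *s (S f \<odot> S c)) y) x
      = cm (\<lambda>u c. counit u *s (S y \<odot> S c)) x"
    proof (rule sweedler_cong)
      fix u c
      have "lin scale scale (\<lambda>f. counit u *s (S f \<odot> S c))" by (intro hlin)
      from cm_counit_l[OF this, of y]
      show "cm (\<lambda>v f. counit u *s counit v *s (S f \<odot> S c)) y = counit u *s (S y \<odot> S c)"
        by (simp add: mult.commute)
    qed
    also have "\<dots> = S y \<odot> S x" by (rule cm_counit_l) (intro hlin)
    finally show ?thesis by (simp add: inner2)
  qed
  ultimately show ?thesis by simp
qed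

text \<open>Both sides equal \<open>\<phi> (S(x\<^sub>1)\<^sub>1 x\<^sub>2 S(x\<^sub>5)) (S(x\<^sub>1)\<^sub>2 x\<^sub>3 S(x\<^sub>4))\<close>.\<close>

lemma cm_S:
  assumes \<phi>: "bilin scale s \<phi>"
  shows "cm \<phi> (S x) = cm (\<lambda>a b. \<phi> (S b) (S a)) x"
proof -
  note vs' = linD(2)[OF bilinD(1)[OF \<phi>]]
  note h = hlin lin_sweedler_inner[OF _ vector_space_axioms vs'] lin_bilin1[OF \<phi>] lin_bilin2[OF \<phi>]
  let ?F = "\<lambda>a p q w. cm (\<lambda>u v. \<phi> (u \<odot> p) (v \<odot> q \<odot> w)) (S a)"
  \<comment> \<open>\<open>a\<close>, \<open>b\<close> and \<open>z\<close> stand for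
    \<open>x\<^sub>1\<close>, the pair \<open>x\<^sub>2, x\<^sub>3\<close> and the pair
    \<open>x\<^sub>4, x\<^sub>5\<close>: the pairs are split into \<open>p\<close>, \<open>q\<close>
    and \<open>c\<close>, \<open>d\<close>, while \<open>u\<close>, \<open>v\<close> come from
    \<open>S a\<close>.\<close>
  define G where "G a b z = cm (\<lambda>c d. cm (\<lambda>u v. cm (\<lambda>p q. \<phi> (u \<odot> p \<odot> S d) (v \<odot> q \<odot> S c)) b) (S a)) z" for a b z
  have G2: "lin scale s (\<lambda>b. G a b z)" "lin scale s (\<lambda>a. G a b z)" "lin scale s (\<lambda>z. G a b z)" for a b z
    unfolding G_def by (intro h)+
  have "cm (\<lambda>a y. cm (\<lambda>b z. G a b z) y) x = cm \<phi> (S x)"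
  proof -
    have inner: "cm (\<lambda>b z. cm (\<lambda>c d. cm (\<lambda>p q. \<phi> (u \<odot> p \<odot> S d) (v \<odot> q \<odot> S c)) b) z) y
      = s (counit y) (\<phi> u v)" for u v y
    proof -
      let ?\<Psi> = "\<lambda>p q c d. \<phi> (u \<odot> p \<odot> S d) (v \<odot> q \<odot> S c)"
      have "cm (\<lambda>b z. cm (\<lambda>c d. cm (\<lambda>p q. ?\<Psi> p q c d) b) z) y
        = cm (\<lambda>b z. cm (\<lambda>p q. cm (\<lambda>c d. ?\<Psi> p q c d) z) b) y"
        by (subst sweedler_swap) (rule refl)
      also have "\<dots> = cm (\<lambda>p w. cm (\<lambda>q z. cm (\<lambda>c d. ?\<Psi> p q c d) z) w) y"
        by (rule coassoc[where s = s]) (intro h)+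
      also have "\<dots> = cm (\<lambda>p w. cm (\<lambda>r d. cm (\<lambda>q c. ?\<Psi> p q c d) r) w) y"
        by (subst coassoc[where s = s, symmetric]; (intro h)?) (rule refl)
      also have "\<dots> = cm (\<lambda>p w. cm (\<lambda>r d. s (counit r) (\<phi> (u \<odot> p \<odot> S d) v)) w) y"
      proof (intro sweedler_cong)
        fix p w r d
        have "cm (\<lambda>q c. ?\<Psi> p q c d) r = \<phi> (u \<odot> p \<odot> S d) (v \<odot> cm (\<lambda>q c. q \<odot> S c) r)"
          by (simp add: sweedler_hom[OF bilinD(2)[OF \<phi>]] cm_mul2 mul_assoc)
        thus "cm (\<lambda>q c. ?\<Psi> p q c d) r = s (counit r) (\<phi> (u \<odot> p \<odot> S d) v)"
          by (simp add: S_r mul_simps linD(4)[OF bilinD(2)[OF \<phi>]])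
      qed
      also have "\<dots> = cm (\<lambda>p w. \<phi> (u \<odot> p \<odot> S w) v) y"
        by (subst cm_counit_l; (intro h)?) (rule refl)
      also have "\<dots> = \<phi> (u \<odot> cm (\<lambda>p w. p \<odot> S w) y) v"
        by (simp add: sweedler_hom[OF bilinD(1)[OF \<phi>]] cm_mul2 mul_assoc)
      also have "\<dots> = s (counit y) (\<phi> u v)"
        by (simp add: S_r mul_simps linD(4)[OF bilinD(1)[OF \<phi>]])
      finally show ?thesis .
    qed
    have "cm (\<lambda>b z. G a b z) y = s (counit y) (cm \<phi> (S a))" for a y
    proof -
      have "cm (\<lambda>b z. G a b z) y
        = cm (\<lambda>b z. cm (\<lambda>u v. cm (\<lambda>c d. cm (\<lambda>p q. \<phi> (u \<odot> p \<odot> S d) (v \<odot> q \<odot> S c)) b) z) (S a)) y"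
        unfolding G_def by (subst sweedler_swap) (rule refl)
      also have "\<dots> = cm (\<lambda>u v. s (counit y) (\<phi> u v)) (S a)"
        by (subst sweedler_swap) (simp only: inner)
      also have "\<dots> = s (counit y) (cm \<phi> (S a))"
        by (simp add: sweedler_hom[OF lin_scaleR[OF lin_ident[OF vs']]])
      finally show ?thesis .
    qed
    hence "cm (\<lambda>a y. cm (\<lambda>b z. G a b z) y) x = cm (\<lambda>a y. s (counit y) (cm \<phi> (S a))) x" by simp
    also have "\<dots> = cm \<phi> (S x)" by (rule cm_counit_r) (intro h \<phi>)
    finally show ?thesis .
  qed
  moreover have "cm (\<lambda>a y. cm (\<lambda>b z. G a b z) y) x = cm (\<lambda>y z. cm (\<lambda>a b. G a b z) y) x"
    by (rule coassoc[where s = s, symmetric]) (rule G2)+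
  moreover have "cm (\<lambda>y z. cm (\<lambda>a b. G a b z) y) x = cm (\<lambda>a b. \<phi> (S b) (S a)) x"
  proof -
    have "cm (\<lambda>a b. G a b z) y = s (counit y) (cm (\<lambda>c d. \<phi> (S d) (S c)) z)" for y z
    proof -
      have "cm (\<lambda>a b. cm (\<lambda>u v. cm (\<lambda>p q. \<phi> (u \<odot> p \<odot> S d) (v \<odot> q \<odot> S c)) b) (S a)) y
        = s (counit y) (\<phi> (S d) (S c))" for c d
      proof -
        have b: "bilin scale s (\<lambda>u v. \<phi> (u \<odot> S d) (v \<odot> S c))" by (intro h)
        have "cm (\<lambda>a b. cm (\<lambda>u v. cm (\<lambda>p q. \<phi> (u \<odot> p \<odot> S d) (v \<odot> q \<odot> S c)) b) (S a)) y
          = cm (\<lambda>a b. cm (\<lambda>u v. \<phi> (u \<odot> S d) (v \<odot> S c)) (S a \<odot> b)) y"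
          by (simp add: cm_mul[OF b])
        also have "\<dots> = cm (\<lambda>u v. \<phi> (u \<odot> S d) (v \<odot> S c)) (cm (\<lambda>a b. S a \<odot> b) y)"
          by (rule sweedler_hom[OF lin_cm[OF b lin_ident[OF vector_space_axioms]], symmetric])
        also have "\<dots> = s (counit y) (\<phi> (S d) (S c))"
          using linD(4)[OF lin_cm[OF b lin_ident[OF vector_space_axioms]]] cm_one[OF b] by (simp add: S_l)
        finally show ?thesis .
      qed
      hence "cm (\<lambda>a b. G a b z) y = cm (\<lambda>c d. s (counit y) (\<phi> (S d) (S c))) z"
        unfolding G_def by (subst sweedler_swap) simp
      thus ?thesis by (simp add: sweedler_hom[OF lin_scaleR[OF lin_ident[OF vs']]])
    qed
    hence "cm (\<lambda>y z. cm (\<lambda>a b. G a b z) y) x = cm (\<lambda>y z. s (counit y) (cm (\<lambda>c d. \<phi> (S d) (S c)) z)) x"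
      by simp
    also have "\<dots> = cm (\<lambda>c d. \<phi> (S d) (S c)) x" by (rule cm_counit_l) (intro h)
    finally show ?thesis .
  qed
  ultimately show ?thesis by simp
qed

end


section \<open>Subalgebras and the antipode\<close>

context hopf
begin

definition subalg :: "'h set \<Rightarrow> bool"
  where "subalg A \<longleftrightarrow> subspace A \<and> \<one> \<in> A \<and> (\<forall>x\<in>A. \<forall>y\<in>A. x \<odot> y \<in> A)"

lemma subalgD:
  assumes "subalg A"
  shows "subspace A" "\<one> \<in> A" "x \<in> A \<Longrightarrow> y \<in> A \<Longrightarrow> x \<odot> y \<in> A"
  using assms by (auto simp: subalg_def)

lemma subalg_Inter: "(\<And>A. A \<in> \<A> \<Longrightarrow> subalg A) \<Longrightarrow> subalg (\<Inter>\<A>)"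
  by (auto simp: subalg_def subspace_Inter)

lemma subalg_hull: "subalg (subalg hull X)"
  unfolding hull_def by (rule subalg_Inter) auto

lemma vanish_on_imp_mem:
  assumes "subspace U" "\<And>h. functional h \<Longrightarrow> (\<And>u. u \<in> U \<Longrightarrow> h u = 0) \<Longrightarrow> h x = 0"
  shows "x \<in> U"
proof (rule ccontr)
  assume "x \<notin> U"
  then obtain h where "functional h" "\<And>u. u \<in> U \<Longrightarrow> h u = 0" "h x = 1"
    using functional_separates_subspace[OF assms(1)] by metis
  thus False using assms(2)[of h] by simp
qed

text \<open>The set \<open>G\<close> of elements of \<open>A\<close> with coproduct in
  \<open>A \<otimes> A\<close>, expressed as invariance under a projection \<open>t\<close> onto
  \<open>A\<close> in both factors, is a subalgebra because the comultiplication is multiplicative.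
  It contains \<open>X\<close>, hence \<open>A\<close>.\<close>

lemma subcoalg_subalg_hull:
  assumes X: "subcoalg X"
  shows "subcoalg (subalg hull X)"
proof -
  define A where "A = subalg hull X"
  have A: "subalg A" unfolding A_def by (rule subalg_hull)
  have XA: "X \<subseteq> A" unfolding A_def by (rule hull_subset)
  obtain t where t: "endo t" "\<And>x. t x \<in> A" "\<And>x. x \<in> A \<Longrightarrow> t x = x"
    by (rule projection_exists[OF subalgD(1)[OF A]]) blast
  have bt: "bilin scale (*) (\<lambda>a b. \<phi> (t a) (t b))" if "bilin scale (*) \<phi>" for \<phi>
    by (intro bilinI lin_bilin1[OF that] lin_bilin2[OF that] t)
  define G where "G = {x \<in> A. \<forall>\<phi>. bilin scale (*) \<phi> \<longrightarrow> cm \<phi> x = cm (\<lambda>a b. \<phi> (t a) (t b)) x}"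
  have GD: "cm \<phi> x = cm (\<lambda>a b. \<phi> (t a) (t b)) x" if "x \<in> G" "bilin scale (*) \<phi>" for x \<phi>
    using that by (simp add: G_def)
  have "subalg G"
    unfolding subalg_def
  proof (intro conjI ballI)
    show "subspace G"
      unfolding subspace_def
    proof (intro conjI ballI allI)
      note l = linD[OF lin_cm[OF _ lin_ident[OF vector_space_axioms]]]
      have "cm \<phi> 0 = cm (\<lambda>a b. \<phi> (t a) (t b)) 0" if "bilin scale (*) \<phi>" for \<phi>
        using l(5)[OF that] l(5)[OF bt[OF that]] by simp
      thus "0 \<in> G" using subspace_0[OF subalgD(1)[OF A]] by (simp add: G_def)
      fix x assume x: "x \<in> G"
      have "cm \<phi> (c *s x) = cm (\<lambda>a b. \<phi> (t a) (t b)) (c *s x)" if "bilin scale (*) \<phi>" for \<phi> c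
        using l(4)[OF that] l(4)[OF bt[OF that]] GD[OF x that] by simp
      thus "c *s x \<in> G" for c
        using x subspace_scale[OF subalgD(1)[OF A]] by (simp add: G_def)
      fix y assume y: "y \<in> G"
      have "cm \<phi> (x + y) = cm (\<lambda>a b. \<phi> (t a) (t b)) (x + y)" if "bilin scale (*) \<phi>" for \<phi>
        using l(3)[OF that] l(3)[OF bt[OF that]] GD[OF x that] GD[OF y that] by simp
      thus "x + y \<in> G"
        using x y subspace_add[OF subalgD(1)[OF A]] by (simp add: G_def)
    qed
    have "cm \<phi> \<one> = cm (\<lambda>a b. \<phi> (t a) (t b)) \<one>" if "bilin scale (*) \<phi>" for \<phi>
      using cm_one[OF that] cm_one[OF bt[OF that]] t(3)[OF subalgD(2)[OF A]] by simp
    thus "\<one> \<in> G" using subalgD(2)[OF A] by (simp add: G_def)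
    fix x y assume x: "x \<in> G" and y: "y \<in> G"
    have "cm \<phi> (x \<odot> y) = cm (\<lambda>a b. \<phi> (t a) (t b)) (x \<odot> y)" if \<phi>: "bilin scale (*) \<phi>" for \<phi>
    proof -
      have *: "cm \<phi> (x \<odot> y) = cm (\<lambda>a b. cm (\<lambda>c d. \<phi> (t a \<odot> t c) (t b \<odot> t d)) y) x"
        if \<phi>: "bilin scale (*) \<phi>" for \<phi>
      proof -
        note h = hlin lin_bilin1[OF \<phi>] lin_bilin2[OF \<phi>] lin_comp[OF t(1)]
        have "cm \<phi> (x \<odot> y) = cm (\<lambda>a b. cm (\<lambda>c d. \<phi> (a \<odot> c) (b \<odot> d)) y) x" by (rule cm_mul[OF \<phi>])
        also have "\<dots> = cm (\<lambda>a b. cm (\<lambda>c d. \<phi> (t a \<odot> c) (t b \<odot> d)) y) x"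
          by (rule GD[OF x]) (intro h)
        also have "\<dots> = cm (\<lambda>a b. cm (\<lambda>c d. \<phi> (t a \<odot> t c) (t b \<odot> t d)) y) x"
          by (intro sweedler_cong GD[OF y]) (intro h)
        finally show ?thesis .
      qed
      show ?thesis
        unfolding *[OF \<phi>] *[OF bt[OF \<phi>]] by (simp add: t subalgD(3)[OF A])
    qed
    thus "x \<odot> y \<in> G" using x y subalgD(3)[OF A] by (auto simp: G_def)
  qed
  moreover have "X \<subseteq> G"
  proof
    fix x assume x: "x \<in> X"
    have "cm \<phi> x = cm (\<lambda>a b. \<phi> (t a) (t b)) x" if "bilin scale (*) \<phi>" for \<phi>
      by (rule subcoalg_cm_eq[OF X x that bt[OF that]]) (simp add: t(3) subsetD[OF XA])
    thus "x \<in> G" using x XA by (auto simp: G_def)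
  qed
  ultimately have AG: "A \<subseteq> G" unfolding A_def by (intro hull_minimal)
  have "R f x \<in> A" "L f x \<in> A" if x: "x \<in> A" and f: "functional f" for x f
  proof -
    have xG: "x \<in> G" using AG x by blast
    show "R f x \<in> A"
    proof (rule vanish_on_imp_mem[OF subalgD(1)[OF A]])
      fix h assume h: "functional h" "\<And>u. u \<in> A \<Longrightarrow> h u = 0"
      have "h (R f x) = cm (\<lambda>a b. h a * f b) x" using h f by (simp add: f_R conv_def)
      also have "\<dots> = cm (\<lambda>a b. h (t a) * f (t b)) x"
        by (rule GD[OF xG]) (intro hlin lin_comp[OF h(1)] lin_comp[OF f])
      finally show "h (R f x) = 0" by (simp add: h t)
    qed
    show "L f x \<in> A"
    proof (rule vanish_on_imp_mem[OF subalgD(1)[OF A]])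
      fix h assume h: "functional h" "\<And>u. u \<in> A \<Longrightarrow> h u = 0"
      have "h (L f x) = cm (\<lambda>a b. f a * h b) x" using h f by (simp add: f_L conv_def)
      also have "\<dots> = cm (\<lambda>a b. f (t a) * h (t b)) x"
        by (rule GD[OF xG]) (intro hlin lin_comp[OF h(1)] lin_comp[OF f])
      finally show "h (L f x) = 0" by (simp add: h t)
    qed
  qed
  thus ?thesis using subalgD(1)[OF A] by (auto simp: subcoalg_def A_def)
qed

lemma subcoalg_cm_eq_0:
  assumes C: "subcoalg C" "x \<in> C" and \<phi>: "bilin scale s \<phi>"
    and "\<And>a b. a \<in> C \<Longrightarrow> b \<in> C \<Longrightarrow> \<phi> a b = 0"
  shows "cm \<phi> x = 0"
proof -
  have "vector_space s" using linD(2)[OF bilinD(1)[OF \<phi>]] .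
  hence "cm \<phi> x = cm (\<lambda>a b. 0) x"
    by (intro subcoalg_cm_eq[OF C \<phi>] bilinI lin_zero vector_space_axioms assms)
  thus ?thesis by simp
qed

text \<open>Multiply the two coproducts. A product of terms with second factors in \<open>K\<close>
  has its second factor in \<open>K\<close>; in all other products one first factor has dropped a
  level, and induction on m + n applies.\<close>

lemma wedge_mul:
  assumes K: "subcoalg K" "subalg K"
  shows "x \<in> wedge K m \<Longrightarrow> y \<in> wedge K n \<Longrightarrow> x \<odot> y \<in> wedge K (m + n)"
proof (induction "m + n" arbitrary: m n x y)
  case 0
  thus ?case using subalgD(3)[OF K(2)] by simp
next
  case (Suc l)
  note W = subcoalg_wedge[OF K(1)]
  note KW = wedge_mono[OF K(1), of 0, simplified]
  have "R f (x \<odot> y) \<in> wedge K l" if f: "functional f" "\<forall>k\<in>K. f k = 0" for f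
  proof (rule vanish_on_imp_mem[OF subcoalgD(1)[OF W]])
    fix h assume h: "functional h" "\<And>u. u \<in> wedge K l \<Longrightarrow> h u = 0"
    note hf = hlin lin_comp[OF h(1)] lin_comp[OF f(1)]
    have b: "bilin scale (*) (\<lambda>a b. h a * f b)" by (intro hf)
    have "h (R f (x \<odot> y)) = cm (\<lambda>a b. cm (\<lambda>c d. h (a \<odot> c) * f (b \<odot> d)) y) x"
      using h f by (simp add: f_R conv_def cm_mul[OF b])
    also have "\<dots> = 0"
    proof (rule wedge_cm_eq_0[OF K(1) KW W Suc.prems(1) subset_refl subset_refl W])
      show "bilin scale (*) (\<lambda>a b. cm (\<lambda>c d. h (a \<odot> c) * f (b \<odot> d)) y)" by (intro hf)
    next
      fix a b assume a: "a \<in> wedge K m" and b: "b \<in> K"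
      show "cm (\<lambda>c d. h (a \<odot> c) * f (b \<odot> d)) y = 0"
      proof (rule wedge_cm_eq_0[OF K(1) KW W Suc.prems(2) subset_refl subset_refl W])
        show "bilin scale (*) (\<lambda>c d. h (a \<odot> c) * f (b \<odot> d))" by (intro hf)
        show "h (a \<odot> c) * f (b \<odot> d) = 0" if "d \<in> K" for c d
          using f(2) subalgD(3)[OF K(2) b that] by simp
        show "h (a \<odot> c) * f (b \<odot> d) = 0" if "n = Suc n'" "c \<in> wedge K n'" for n' c d
          using h(2) Suc.hyps(1)[OF _ a that(2)] Suc.hyps(2) that(1) by simp
      qed
    next
      fix m' a b assume m: "m = Suc m'" and a: "a \<in> wedge K m'"
      show "cm (\<lambda>c d. h (a \<odot> c) * f (b \<odot> d)) y = 0"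
      proof (rule subcoalg_cm_eq_0[OF W Suc.prems(2)])
        show "bilin scale (*) (\<lambda>c d. h (a \<odot> c) * f (b \<odot> d))" by (intro hf)
        show "h (a \<odot> c) * f (b \<odot> d) = 0" if "c \<in> wedge K n" for c d
          using h(2) Suc.hyps(1)[OF _ a that] Suc.hyps(2) m by simp
      qed
    qed
    finally show "h (R f (x \<odot> y)) = 0" .
  qed
  hence "x \<odot> y \<in> wedge K (Suc l)" by simp
  thus ?case using Suc.hyps(2) by simp
qed

text \<open>Takeuchi: with \<open>t\<close> a projection onto \<open>K\<close> and \<open>\<gamma> = \<epsilon> - id * S t\<close>, which vanishes on \<open>K\<close>,
  one has \<open>S = S t + S * \<gamma>\<close>.\<close>

lemma antipode_closed:
  assumes K: "subcoalg K" "subalg K" "\<And>x. x \<in> K \<Longrightarrow> S x \<in> K" "\<And>x. x \<in> (\<Union>n. wedge K n)"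
    and B: "subcoalg B" "subalg B" "K \<subseteq> B" and "x \<in> B"
  shows "S x \<in> B"
proof -
  obtain t where t: "endo t" "\<And>x. t x \<in> K" "\<And>x. x \<in> K \<Longrightarrow> t x = x"
    by (rule projection_exists[OF subalgD(1)[OF K(2)]]) blast
  define \<gamma> where "\<gamma> x = counit x *s \<one> - cm (\<lambda>a b. a \<odot> S (t b)) x" for x
  note ht = hlin lin_comp[OF t(1)]
  have l\<gamma>: "lin scale scale (\<lambda>x. \<gamma> (g x))" if "endo g" for g
    unfolding \<gamma>_def by (intro ht that)
  have \<gamma>K: "\<gamma> k = 0" if "k \<in> K" for k
  proof -
    have "cm (\<lambda>a b. a \<odot> S (t b)) k = cm (\<lambda>a b. a \<odot> S b) k"
      by (rule subcoalg_cm_eq[OF K(1) that, where s = scale]; (intro ht)?) (simp add: t)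
    thus ?thesis by (simp add: \<gamma>_def S_r)
  qed
  have \<gamma>B: "\<gamma> b \<in> B" if b: "b \<in> B" for b
  proof -
    have "cm (\<lambda>a b. a \<odot> S (t b)) b \<in> B"
    proof (rule vanish_on_imp_mem[OF subalgD(1)[OF B(2)]])
      fix h assume h: "functional h" "\<And>u. u \<in> B \<Longrightarrow> h u = 0"
      show "h (cm (\<lambda>a b. a \<odot> S (t b)) b) = 0"
        unfolding sweedler_hom[OF h(1)]
      proof (rule subcoalg_cm_eq_0[OF B(1) b, where s = "(*)"])
        show "bilin scale (*) (\<lambda>a b. h (a \<odot> S (t b)))" by (intro ht lin_comp[OF h(1)])
        show "h (a \<odot> S (t c)) = 0" if "a \<in> B" for a c
          using that K(3)[OF t(2)] B subalgD(3)[OF B(2)] by (intro h) auto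
      qed
    qed
    thus ?thesis
      unfolding \<gamma>_def using subalgD[OF B(2)] by (intro subspace_diff subspace_scale) auto
  qed
  have S: "S x = S (t x) + cm (\<lambda>a b. S a \<odot> \<gamma> b) x" for x
  proof -
    have "cm (\<lambda>a b. S a \<odot> cm (\<lambda>c d. c \<odot> S (t d)) b) x = cm (\<lambda>a b. cm (\<lambda>c d. S a \<odot> c \<odot> S (t d)) b) x"
      by (simp add: cm_mul2 mul_assoc)
    also have "\<dots> = cm (\<lambda>a b. cm (\<lambda>a' a''. S a' \<odot> a'' \<odot> S (t b)) a) x"
      by (rule coassoc[symmetric, where s = scale]) (intro ht)+
    also have "\<dots> = cm (\<lambda>a b. cm (\<lambda>a' a''. S a' \<odot> a'') a \<odot> S (t b)) x"
      by (simp add: cm_mul1)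
    also have "\<dots> = cm (\<lambda>a b. counit a *s S (t b)) x" by (simp add: S_l mul_simps)
    also have "\<dots> = S (t x)" by (rule cm_counit_l) (intro ht)
    finally have 1: "cm (\<lambda>a b. S a \<odot> cm (\<lambda>c d. c \<odot> S (t d)) b) x = S (t x)" .
    have "cm (\<lambda>a b. counit b *s S a) x = S x" by (rule cm_counit_r) (intro ht)
    thus ?thesis unfolding \<gamma>_def by (simp add: mul_simps sweedler_diff 1)
  qed
  have "S x \<in> B" if "x \<in> B" "x \<in> wedge K n" for n x
    using that
  proof (induction n arbitrary: x)
    case 0
    thus ?case using K(3) B(3) by auto
  next
    case (Suc n)
    have CB: "subcoalg (B \<inter> wedge K (Suc n))" using B(1) subcoalg_wedge[OF K(1)] by (rule subcoalg_Int)
    have "cm (\<lambda>a b. S a \<odot> \<gamma> b) x \<in> B"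
    proof (rule vanish_on_imp_mem[OF subalgD(1)[OF B(2)]])
      fix h assume h: "functional h" "\<And>u. u \<in> B \<Longrightarrow> h u = 0"
      show "h (cm (\<lambda>a b. S a \<odot> \<gamma> b) x) = 0"
        unfolding sweedler_hom[OF h(1)]
      \<comment> \<open>Either the second factor is in \<open>K\<close>, where
        \<open>\<gamma>\<close> vanishes, or the first has dropped a level and the induction
        hypothesis applies. Second factors are confined to \<open>B\<close> because
        \<open>\<gamma>\<close> is known to preserve \<open>B\<close>.\<close>
      proof (rule wedge_cm_eq_0[OF K(1) B(3) CB _ _ _ B(1), where s = "(*)" and m = "Suc n"])
        show "bilin scale (*) (\<lambda>a b. h (S a \<odot> \<gamma> b))" by (intro ht l\<gamma> lin_comp[OF h(1)])
        show "h (S a \<odot> \<gamma> b) = 0" if "b \<in> K" for a b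
          using \<gamma>K[OF that] by (simp add: mul_simps linD(5)[OF h(1)])
        show "h (S a \<odot> \<gamma> b) = 0" 
          if "Suc n = Suc m" "a \<in> B \<inter> wedge K (Suc n)" "a \<in> wedge K m" "b \<in> B" for m a b
          using that by (intro h subalgD(3)[OF B(2)] \<gamma>B Suc.IH) auto
      qed (use Suc.prems in auto)
    qed
    moreover have "S (t x) \<in> B" using K(3)[OF t(2)] B(3) by auto
    ultimately show ?case using S[of x] subspace_add[OF subalgD(1)[OF B(2)]] by metis
  qed
  thus ?thesis using \<open>x \<in> B\<close> K(4)[of x] by blast
qed

end


section \<open>Linear retractions onto Hopf subalgebras\<close>

context hopf
begin

text \<open>The quotient \<open>wedge K (Suc n) / wedge K n\<close> is a right Hopf module over \<open>K\<close>; in Sweedler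
  notation \<open>x \<mapsto> \<pi>(x\<^sub>0) x\<^sub>1\<close>, where \<open>\<pi>(x) = x\<^sub>0 S(x\<^sub>1)\<close> is followed by a linear section, lifts the
  identity of the quotient to a \<open>K\<close>-linear map.\<close>

lemma wedge_step_retraction:
  assumes K: "subcoalg K" "subalg K" "\<And>x. x \<in> K \<Longrightarrow> S x \<in> K"
  obtains r where "endo r" "\<And>x. x \<in> wedge K (Suc n) \<Longrightarrow> r x \<in> wedge K n"
    "\<And>x. x \<in> wedge K n \<Longrightarrow> r x = x"
    "\<And>x k. x \<in> wedge K (Suc n) \<Longrightarrow> k \<in> K \<Longrightarrow> r (x \<odot> k) = r x \<odot> k"
proof -
  let ?F = "wedge K n" and ?F' = "wedge K (Suc n)"
  note F = subcoalg_wedge[OF K(1), of n] and F' = subcoalg_wedge[OF K(1), of "Suc n"]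
  have KF': "K \<subseteq> ?F'" using wedge_mono[OF K(1), of 0 "Suc n"] by (simp only: wedge.simps(1) le0)
  have FK: "x \<odot> k \<in> wedge K m" if "x \<in> wedge K m" "k \<in> K" for x k m
    using wedge_mul[OF K(1,2) that(1), of k 0] that(2) by simp
  obtain q where q: "endo q" "\<And>x. q x \<in> ?F" "\<And>x. x \<in> ?F \<Longrightarrow> q x = x"
    by (rule projection_exists[OF subcoalgD(1)[OF F]]) blast
  obtain t where t: "endo t" "\<And>x. t x \<in> K" "\<And>x. x \<in> K \<Longrightarrow> t x = x"
    by (rule projection_exists[OF subcoalgD(1)[OF K(1)]]) blast
  \<comment> \<open>The quotient map modulo \<open>wedge K n\<close> followed by its linear section
    onto the kernel of \<open>q\<close>.\<close>
  define e where "e x = x - q x" for x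
  have e: "endo e" unfolding e_def by (intro lin_intros q)
  have eF: "e x = 0" if "x \<in> ?F" for x using q(3)[OF that] by (simp add: e_def)
  note he = hlin lin_comp[OF e] lin_comp[OF t(1)]
  \<comment> \<open>This is \<open>e(x\<^sub>1 S(x\<^sub>2)) x\<^sub>3\<close>. Up to terms with
    first factor in \<open>wedge K n\<close>, which \<open>e\<close> kills by \<open>eS\<close>, the
    later factors already lie in \<open>K\<close>, where \<open>t\<close> is the identity.\<close>
  define \<sigma> where "\<sigma> x = cm (\<lambda>a b. cm (\<lambda>c d. e (a \<odot> S (t c)) \<odot> t d) b) x" for x
  have \<sigma>: "endo \<sigma>" unfolding \<sigma>_def by (intro he)
  have eS: "e (a \<odot> S (t c)) = 0" if "a \<in> ?F" for a c
    by (rule eF, rule FK[OF that K(3)[OF t(2)]])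
  have \<sigma>F: "\<sigma> x = 0" if "x \<in> ?F" for x
    unfolding \<sigma>_def
    by (rule subcoalg_cm_eq_0[OF F that, where s = scale]; (intro he)?)
      (simp add: eS mul_simps)
  \<comment> \<open>Replacing \<open>e(a S(c)) d\<close> by \<open>a S(c) d\<close> costs
    \<open>q(a S(c)) d\<close>, which stays in \<open>wedge K n\<close>; the antipode axiom then
    collapses the sum to \<open>x\<close>.\<close>
  have \<sigma>F': "x - \<sigma> x \<in> ?F" if x: "x \<in> ?F'" for x
  proof (rule vanish_on_imp_mem[OF subcoalgD(1)[OF F]])
    fix h assume h: "functional h" "\<And>u. u \<in> ?F \<Longrightarrow> h u = 0"
    note hh = he lin_comp[OF h(1)]
    let ?\<psi> = "\<lambda>a b. counit b * h a - cm (\<lambda>c d. h (e (a \<odot> S (t c)) \<odot> t d)) b"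
    have "cm ?\<psi> x = 0"
    proof (rule wedge_cm_eq_0[OF K(1) KF' F' x subset_refl subset_refl F'])
      show "bilin scale (*) ?\<psi>" by (intro hh)
      fix a b assume a: "a \<in> ?F'" and b: "b \<in> K"
      have "cm (\<lambda>c d. h (e (a \<odot> S (t c)) \<odot> t d)) b = cm (\<lambda>c d. h (a \<odot> S c \<odot> d)) b"
      proof (rule subcoalg_cm_eq[OF K(1) b, where s = "(*)"])
        show "h (e (a \<odot> S (t c)) \<odot> t d) = h (a \<odot> S c \<odot> d)" if cd: "c \<in> K" "d \<in> K" for c d
        proof -
          have "e (a \<odot> S c) \<odot> d = a \<odot> S c \<odot> d - q (a \<odot> S c) \<odot> d"
            by (simp add: e_def mul_simps)
          moreover have "h (q (a \<odot> S c) \<odot> d) = 0" by (intro h FK q cd)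
          ultimately show ?thesis using cd by (simp add: t linD(6)[OF h(1)])
        qed
      qed (intro hh)+
      also have "\<dots> = counit b * h a"
        using S_l by (simp add: sweedler_hom[OF h(1), symmetric] mul_assoc cm_mul2[symmetric]
            mul_simps linD(4)[OF h(1)])
      finally show "?\<psi> a b = 0" by simp
    next
      fix m a b assume "Suc n = Suc m" and a: "a \<in> wedge K m"
      hence "a \<in> ?F" by simp
      thus "?\<psi> a b = 0" by (simp add: h eS mul_simps linD(5)[OF h(1)])
    qed
    moreover have "cm (\<lambda>a b. counit b * h a) x = h x" by (rule cm_counit_r[OF h(1)])
    ultimately show "h (x - \<sigma> x) = 0"
      unfolding \<sigma>_def by (simp add: sweedler_diff linD(6)[OF h(1)] sweedler_hom[OF h(1)])
  qed
  have \<sigma>K: "\<sigma> (x \<odot> k) = \<sigma> x \<odot> k" if x: "x \<in> ?F'" and k: "k \<in> K" for x k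
  proof -
    let ?\<phi> = "\<lambda>a b. cm (\<lambda>c d. cm (\<lambda>c d. e (a \<odot> S (t c)) \<odot> t d) d) b"
    let ?l = "\<lambda>a b. cm (\<lambda>c d. cm (\<lambda>u v. e (a \<odot> c \<odot> S (t u)) \<odot> t v) (b \<odot> d)) k"
    let ?r = "\<lambda>a b. cm (\<lambda>u v. e (a \<odot> S (t u)) \<odot> t v \<odot> k) b"
    have 1: "\<sigma> (x \<odot> k) = cm ?l x"
      unfolding \<sigma>_def by (rule cm_mul[where s = scale]) (intro he)
    have 2: "\<sigma> x \<odot> k = cm ?r x" unfolding \<sigma>_def by (simp add: cm_mul1)
    have "cm (\<lambda>a b. ?l a b - ?r a b) x = 0"
    proof (rule wedge_cm_eq_0[OF K(1) KF' F' x subset_refl subset_refl F'])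
      show "bilin scale scale (\<lambda>a b. ?l a b - ?r a b)" by (intro he)
    next
      fix m a b assume "Suc n = Suc m" and "a \<in> wedge K m"
      hence a: "a \<in> ?F" by simp
      have "?l a b = 0"
        by (rule subcoalg_cm_eq_0[OF K(1) k, where s = scale]; (intro he)?)
          (simp add: eS FK a mul_simps)
      thus "?l a b - ?r a b = 0" by (simp add: eS a mul_simps)
    next
      fix a b assume a: "a \<in> ?F'" and b: "b \<in> K"
      \<comment> \<open>Here \<open>c\<close>, \<open>u'\<close>, \<open>v'\<close> come from the
        iterated coproduct of \<open>k\<close>. Since \<open>S\<close> reverses products,
        \<open>c\<close> stands next to \<open>S u'\<close> and the two cancel, leaving
        \<open>k\<close> on the right.\<close>
      let ?\<Psi> = "\<lambda>c u u' v v'. e (a \<odot> c \<odot> S u' \<odot> S u) \<odot> (v \<odot> v')"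
      have "?l a b = cm (\<lambda>c d. cm (\<lambda>u v. cm (\<lambda>u' v'. e (a \<odot> c \<odot> S (t (u \<odot> u'))) \<odot> t (v \<odot> v')) d) b) k"
        by (subst cm_mul[where s = scale]; (intro he)?) (rule refl)
      also have "\<dots> = cm (\<lambda>c d. cm (\<lambda>u v. cm (\<lambda>u' v'. ?\<Psi> c u u' v v') d) b) k"
      proof (rule subcoalg_cm_eq[OF K(1) k, where s = scale])
        fix c d assume "c \<in> K" "d \<in> K"
        show "cm (\<lambda>u v. cm (\<lambda>u' v'. e (a \<odot> c \<odot> S (t (u \<odot> u'))) \<odot> t (v \<odot> v')) d) b
          = cm (\<lambda>u v. cm (\<lambda>u' v'. ?\<Psi> c u u' v v') d) b"
        proof (rule subcoalg_cm_eq[OF K(1) b, where s = scale])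
          fix u v assume "u \<in> K" "v \<in> K"
          thus "cm (\<lambda>u' v'. e (a \<odot> c \<odot> S (t (u \<odot> u'))) \<odot> t (v \<odot> v')) d
            = cm (\<lambda>u' v'. ?\<Psi> c u u' v v') d"
            by (intro subcoalg_cm_eq[OF K(1) \<open>d \<in> K\<close>, where s = scale]; (intro he)?)
              (simp add: t subalgD(3)[OF K(2)] S_mul mul_assoc)
        qed (intro he)+
      qed (intro he)+
      also have "\<dots> = cm (\<lambda>c d. cm (\<lambda>u' v'. cm (\<lambda>u v. ?\<Psi> c u u' v v') b) d) k"
        by (subst sweedler_swap) (rule refl)
      also have "\<dots> = cm (\<lambda>c v'. cm (\<lambda>c u'. cm (\<lambda>u v. ?\<Psi> c u u' v v') b) c) k"
        by (rule coassoc[where s = scale, symmetric]) (intro he)+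
      also have "\<dots> = cm (\<lambda>c v'. counit c *s cm (\<lambda>u v. e (a \<odot> S u) \<odot> (v \<odot> v')) b) k"
      proof (rule sweedler_cong)
        fix c v'
        have "endo (\<lambda>y. cm (\<lambda>u v. e (a \<odot> y \<odot> S u) \<odot> (v \<odot> v')) b)" by (intro he)
        from sweedler_hom[OF this, of delta "\<lambda>c u'. c \<odot> S u'" c] linD(4)[OF this, of "counit c" \<one>]
        show "cm (\<lambda>c u'. cm (\<lambda>u v. ?\<Psi> c u u' v v') b) c
          = counit c *s cm (\<lambda>u v. e (a \<odot> S u) \<odot> (v \<odot> v')) b"
          by (simp add: S_r mul_assoc)
      qed
      also have "\<dots> = cm (\<lambda>u v. e (a \<odot> S u) \<odot> (v \<odot> k)) b"
        by (rule cm_counit_l) (intro he)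
      also have "\<dots> = ?r a b"
        by (rule subcoalg_cm_eq[OF K(1) b, where s = scale]; (intro he)?) (simp add: t mul_assoc)
      finally show "?l a b - ?r a b = 0" by simp
    qed
    thus ?thesis using 1 2 by (simp add: sweedler_diff)
  qed
  show ?thesis
  proof (rule that[of "\<lambda>x. x - \<sigma> x"])
    show "endo (\<lambda>x. x - \<sigma> x)" by (intro lin_intros \<sigma>)
  qed (use \<sigma>F \<sigma>F' \<sigma>K in \<open>auto simp: mul_simps\<close>)
qed

text \<open>\<open>P n\<close> composes the one-step retractions down from level n to
  \<open>K\<close>. As each of them fixes the lower level, the maps \<open>P n\<close> agree
  wherever they are meant to apply and can be glued by evaluating at the least level containing
  \<open>x\<close>.\<close>

lemma retraction_exists:
  assumes K: "subcoalg K" "subalg K" "\<And>x. x \<in> K \<Longrightarrow> S x \<in> K" "\<And>x. x \<in> (\<Union>n. wedge K n)"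
  obtains p where "endo p" "\<And>x. p x \<in> K" "\<And>x. x \<in> K \<Longrightarrow> p x = x"
    "\<And>x k. k \<in> K \<Longrightarrow> p (x \<odot> k) = p x \<odot> k"
proof -
  have "\<exists>r. endo r \<and> (\<forall>x\<in>wedge K (Suc n). r x \<in> wedge K n) \<and> (\<forall>x\<in>wedge K n. r x = x)
      \<and> (\<forall>x\<in>wedge K (Suc n). \<forall>k\<in>K. r (x \<odot> k) = r x \<odot> k)" for n
    using wedge_step_retraction[OF K(1-3), of n] by metis
  then obtain r where r: "\<And>n. endo (r n)" "\<And>n x. x \<in> wedge K (Suc n) \<Longrightarrow> r n x \<in> wedge K n"
    "\<And>n x. x \<in> wedge K n \<Longrightarrow> r n x = x"
    "\<And>n x k. x \<in> wedge K (Suc n) \<Longrightarrow> k \<in> K \<Longrightarrow> r n (x \<odot> k) = r n x \<odot> k"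
    by metis
  define P where "P = rec_nat (\<lambda>x. x) (\<lambda>n f x. f (r n x))"
  have P: "P 0 = (\<lambda>x. x)" "P (Suc n) = (\<lambda>x. P n (r n x))" for n by (simp_all add: P_def)
  have P1: "endo (P n)" for n
  proof (induction n)
    case 0
    show ?case unfolding P by (rule lin_ident[OF vector_space_axioms])
  next
    case (Suc n)
    show ?case unfolding P by (rule lin_comp[OF Suc r(1)])
  qed
  have P2: "x \<in> wedge K n \<Longrightarrow> P n x \<in> K" for n x
    by (induction n arbitrary: x) (simp_all only: P r wedge.simps(1))
  have P3: "x \<in> wedge K n \<Longrightarrow> k \<in> K \<Longrightarrow> P n (x \<odot> k) = P n x \<odot> k" for n x k
    by (induction n arbitrary: x) (simp_all only: P r)
  have P4: "n \<le> m \<Longrightarrow> x \<in> wedge K n \<Longrightarrow> P m x = P n x" for n m x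
  proof (induction m rule: dec_induct)
    case (step m)
    hence "x \<in> wedge K m" using wedge_mono[OF K(1)] by blast
    thus ?case using step by (simp add: P r)
  qed simp
  define N where "N x = (LEAST n. x \<in> wedge K n)" for x
  have N: "x \<in> wedge K (N x)" for x
  proof -
    have "\<exists>n. x \<in> wedge K n" using K(4)[of x] by blast
    thus ?thesis unfolding N_def by (rule LeastI_ex)
  qed
  have p: "P (N x) x = P n x" if "x \<in> wedge K n" for x n
  proof -
    have "N x \<le> n" unfolding N_def using that by (rule Least_le)
    thus ?thesis by (rule P4[OF _ N, symmetric])
  qed
  show ?thesis
  proof (rule that[of "\<lambda>x. P (N x) x"])
    show "endo (\<lambda>x. P (N x) x)"
    proof (rule linI[OF vector_space_axioms vector_space_axioms])
      fix x y c
      let ?n = "max (N x) (N y)"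
      have xy: "x \<in> wedge K ?n" "y \<in> wedge K ?n"
        using N[of x] N[of y] wedge_mono[OF K(1), of "N x" ?n] wedge_mono[OF K(1), of "N y" ?n] by auto
      from xy have "x + y \<in> wedge K ?n"
        by (rule subspace_add[OF subcoalgD(1)[OF subcoalg_wedge[OF K(1)]]])
      with xy show "P (N (x + y)) (x + y) = P (N x) x + P (N y) y"
        using p[of x ?n] p[of y ?n] p[of "x + y" ?n] linD(3)[OF P1] by simp
      have "c *s x \<in> wedge K (N x)"
        by (rule subspace_scale[OF subcoalgD(1)[OF subcoalg_wedge[OF K(1)]] N])
      thus "P (N (c *s x)) (c *s x) = c *s P (N x) x"
        using p[of "c *s x" "N x"] linD(4)[OF P1] by simp
    qed
    show "P (N x) x \<in> K" for x by (rule P2[OF N])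
    show "P (N x) x = x" if "x \<in> K" for x using p[of x 0] that by (simp add: P)
    show "P (N (x \<odot> k)) (x \<odot> k) = P (N x) x \<odot> k" if "k \<in> K" for x k
    proof -
      have "x \<odot> k \<in> wedge K (N x)" using wedge_mul[OF K(1,2) N, of k 0] that by simp
      from p[OF this] show ?thesis using P3[OF N that] by simp
    qed
  qed
qed

text \<open>For a \<open>K\<close>-linear retraction \<open>p\<close>, the map \<open>E(x) = x\<^sub>1 S(p(x\<^sub>2))\<close> kills \<open>H K\<^sup>+\<close>; so \<open>S p\<close> is
  a right convolution inverse of the inclusion of \<open>B\<close> and agrees with \<open>S\<close> on \<open>B\<close>.\<close>

lemma augmentation_ideal_determines:
  assumes K: "subcoalg K" "subalg K" "\<And>x. x \<in> K \<Longrightarrow> S x \<in> K" "\<And>x. x \<in> (\<Union>n. wedge K n)"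
    and inj: "inj S" and B: "subcoalg B" "subalg B"
    and BK: "\<And>y. y \<in> B \<Longrightarrow> counit y = 0 \<Longrightarrow> y \<in> span {h \<odot> k | h k. k \<in> K \<and> counit k = 0}"
  shows "B \<subseteq> K"
proof
  obtain p where p: "endo p" "\<And>x. p x \<in> K" "\<And>x. x \<in> K \<Longrightarrow> p x = x"
    "\<And>x k. k \<in> K \<Longrightarrow> p (x \<odot> k) = p x \<odot> k"
    using retraction_exists[OF K] by metis
  note hp = hlin lin_comp[OF p(1)]
  define E where "E x = cm (\<lambda>a b. a \<odot> S (p b)) x" for x
  have E: "lin scale scale (\<lambda>x. E (g x))" if "endo g" for g unfolding E_def by (intro hp that)
  note E' = E[OF lin_ident[OF vector_space_axioms]]
  have Ek: "E (h \<odot> k) = counit k *s E h" if k: "k \<in> K" for h k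
  proof -
    have "E (h \<odot> k) = cm (\<lambda>a b. cm (\<lambda>c d. a \<odot> c \<odot> S (p (b \<odot> d))) k) h"
      unfolding E_def by (rule cm_mul[where s = scale]) (intro hp)
    also have "\<dots> = cm (\<lambda>a b. cm (\<lambda>c d. a \<odot> (c \<odot> S d) \<odot> S (p b)) k) h"
      by (intro sweedler_cong subcoalg_cm_eq[OF K(1) k, where s = scale]; (intro hp)?)
        (simp add: p(4) S_mul mul_assoc)
    also have "\<dots> = cm (\<lambda>a b. counit k *s (a \<odot> S (p b))) h"
      by (simp add: cm_mul1[symmetric] cm_mul2[symmetric] S_r mul_simps)
    finally show ?thesis unfolding E_def by (simp add: cm_scale)
  qed
  have E0: "E y = 0" if "y \<in> B" "counit y = 0" for y
    using BK[OF that]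
  proof (induction rule: span_induct_alt)
    case base
    show ?case by (rule linD(5)[OF E'])
  next
    case (step c z y)
    then obtain h k where "z = h \<odot> k" "k \<in> K" "counit k = 0" by blast
    hence "E z = 0" using Ek by simp
    thus ?case using step by (simp add: linD(3,4)[OF E'])
  qed
  have E1: "E y = counit y *s \<one>" if y: "y \<in> B" for y
  proof -
    have one: "E \<one> = \<one>"
    proof -
      have "E \<one> = \<one> \<odot> S (p \<one>)" unfolding E_def by (rule cm_one[where s = scale]) (intro hp)
      thus ?thesis using p(3)[OF subalgD(2)[OF K(2)]] by (simp add: S_one)
    qed
    have "y - counit y *s \<one> \<in> B"
      using subalgD[OF B(2)] y by (intro subspace_diff subspace_scale) auto
    moreover have "counit (y - counit y *s \<one>) = 0"
      by (simp add: linD(4,6)[OF lin_counit_ax] counit_one)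
    ultimately have "E (y - counit y *s \<one>) = 0" by (rule E0)
    thus ?thesis by (simp add: linD(4,6)[OF E'] one)
  qed
  fix y assume y: "y \<in> B"
  \<comment> \<open>The expression \<open>S(y\<^sub>1) y\<^sub>2 S(p(y\<^sub>3))\<close> is computed
    in two ways: cancelling the first two factors gives \<open>S(p(y))\<close>, and grouping the
    last two as \<open>E(y\<^sub>2)\<close> gives \<open>S(y)\<close>.\<close>
  have "S (p y) = cm (\<lambda>a b. counit a *s S (p b)) y" by (rule cm_counit_l[symmetric]) (intro hp)
  also have "\<dots> = cm (\<lambda>a b. cm (\<lambda>a' a''. S a' \<odot> a'') a \<odot> S (p b)) y"
    by (simp add: S_l mul_simps)
  also have "\<dots> = cm (\<lambda>a b. cm (\<lambda>a' a''. S a' \<odot> a'' \<odot> S (p b)) a) y" by (simp add: cm_mul1)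
  also have "\<dots> = cm (\<lambda>a b. cm (\<lambda>a' a''. S a \<odot> a' \<odot> S (p a'')) b) y"
    by (rule coassoc[where s = scale]) (intro hp)+
  also have "\<dots> = cm (\<lambda>a b. S a \<odot> E b) y" unfolding E_def by (simp add: cm_mul2 mul_assoc)
  also have "\<dots> = cm (\<lambda>a b. counit b *s S a) y"
    by (rule subcoalg_cm_eq[OF B(1) y, where s = scale]; (intro hp E)?) (simp add: E1 mul_simps)
  also have "\<dots> = S y" by (rule cm_counit_r) (intro hp)
  finally have "p y = y" using inj by (simp add: inj_eq)
  thus "y \<in> K" using p(2)[of y] by simp
qed

end


section \<open>Noetherian Hopf algebras\<close>

context hopf
begin

definition lideal :: "'h set \<Rightarrow> bool"
  where "lideal I \<longleftrightarrow> 0 \<in> I \<and> (\<forall>x\<in>I. \<forall>y\<in>I. x + y \<in> I) \<and> (\<forall>r. \<forall>x\<in>I. r \<odot> x \<in> I)"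

definition noeth :: bool
  where "noeth \<longleftrightarrow> (\<forall>I. lideal I \<longrightarrow>
    (\<exists>F. finite F \<and> F \<subseteq> I \<and> (\<forall>J. lideal J \<longrightarrow> F \<subseteq> J \<longrightarrow> I \<subseteq> J)))"

lemma chain_stabilizes:
  assumes noeth and J: "\<And>n. lideal (J n)" "\<And>n. J n \<subseteq> J (Suc n)"
  shows "\<exists>n. \<forall>m\<ge>n. J m = J n"
proof -
  have mono: "J m \<subseteq> J n" if "m \<le> n" for m n
    using that by (rule lift_Suc_mono_le[of J, OF J(2)])
  have "lideal (\<Union>n. J n)"
    unfolding lideal_def
  proof (intro conjI ballI allI)
    show "0 \<in> (\<Union>n. J n)" using J(1) by (auto simp: lideal_def)
    fix x assume "x \<in> (\<Union>n. J n)"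
    then obtain m where m: "x \<in> J m" by blast
    thus "r \<odot> x \<in> (\<Union>n. J n)" for r using J(1)[of m] unfolding lideal_def by blast
    fix y assume "y \<in> (\<Union>n. J n)"
    then obtain n where n: "y \<in> J n" by blast
    have "x \<in> J (max m n)" "y \<in> J (max m n)"
      using m n mono[of m "max m n"] mono[of n "max m n"] by auto
    thus "x + y \<in> (\<Union>n. J n)" using J(1)[of "max m n"] unfolding lideal_def by blast
  qed
  then obtain F where F: "finite F" "F \<subseteq> (\<Union>n. J n)" "\<And>I. lideal I \<Longrightarrow> F \<subseteq> I \<Longrightarrow> (\<Union>n. J n) \<subseteq> I"
    using \<open>noeth\<close> unfolding noeth_def by meson
  from F(2) have "\<forall>x\<in>F. \<exists>n. x \<in> J n" by blast
  then obtain g where g: "\<And>x. x \<in> F \<Longrightarrow> x \<in> J (g x)" by metis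
  define n where "n = Max (insert 0 (g ` F))"
  have "F \<subseteq> J n"
  proof
    fix x assume "x \<in> F"
    hence "g x \<le> n" using F(1) by (auto simp: n_def)
    thus "x \<in> J n" using g[OF \<open>x \<in> F\<close>] mono by blast
  qed
  hence *: "(\<Union>n. J n) \<subseteq> J n" by (rule F(3)[OF J(1)])
  have "J m = J n" if "n \<le> m" for m using * mono[OF that] by blast
  thus ?thesis by blast
qed

section \<open>Free modules of finite rank and injectivity of the antipode\<close>

definition submodule :: "'h set \<Rightarrow> ('h \<Rightarrow> 'h) set \<Rightarrow> bool"
  where "submodule I N \<longleftrightarrow> (\<lambda>i. 0) \<in> N \<and> (\<forall>v\<in>N. \<forall>w\<in>N. (\<lambda>i. v i + w i) \<in> N)
    \<and> (\<forall>r. \<forall>v\<in>N. (\<lambda>i. r \<odot> v i) \<in> N) \<and> (\<forall>v\<in>N. \<forall>i. i \<notin> I \<longrightarrow> v i = 0)"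

lemma submoduleD:
  assumes "submodule I N"
  shows "(\<lambda>i. 0) \<in> N" "v \<in> N \<Longrightarrow> w \<in> N \<Longrightarrow> (\<lambda>i. v i + w i) \<in> N"
    "v \<in> N \<Longrightarrow> (\<lambda>i. r \<odot> v i) \<in> N" "v \<in> N \<Longrightarrow> i \<notin> I \<Longrightarrow> v i = 0"
  using assms by (auto simp: submodule_def)

text \<open>Elements of the free module on \<open>I\<close> are functions supported in
  \<open>I\<close>. By induction on the rank, a submodule is controlled by its \<open>i\<close>-th
  coordinates, a left ideal \<open>J n\<close>, and by its elements with zero \<open>i\<close>-th
  coordinate, \<open>N' n\<close>.\<close>

lemma submodule_chain_stabilizes:
  assumes noeth "finite I"
    and "\<And>n. submodule I (N n)" "\<And>n. N n \<subseteq> N (Suc n)"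
  shows "\<exists>n. \<forall>m\<ge>n. N m = N n"
  using assms(2-4)
proof (induction I arbitrary: N)
  case empty
  have "N n = {\<lambda>i. 0}" for n
    using submoduleD(1,4)[OF empty(1)] by (auto simp: fun_eq_iff)
  thus ?case by simp
next
  case (insert i I)
  note N = submoduleD[OF insert.prems(1)]
  have mono: "N m \<subseteq> N n" if "m \<le> n" for m n
    using that by (rule lift_Suc_mono_le[of N, OF insert.prems(2)])
  define N' where "N' n = {v \<in> N n. v i = 0}" for n
  define J where "J n = (\<lambda>v. v i) ` N n" for n
  have N': "submodule I (N' n)" for n
    using insert.prems(1)[of n] unfolding submodule_def N'_def
    by (auto simp: mul_simps)
  have "N' n \<subseteq> N' (Suc n)" for n using insert.prems(2) by (auto simp: N'_def)
  from insert.IH[of N', OF N' this] obtain n1 where n1: "\<And>m. m \<ge> n1 \<Longrightarrow> N' m = N' n1" by blast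
  have "lideal (J n)" for n
    unfolding lideal_def J_def
  proof (intro conjI ballI allI)
    show "0 \<in> (\<lambda>v. v i) ` N n" using N(1)[of n] by force
    fix x assume "x \<in> (\<lambda>v. v i) ` N n"
    then obtain v where v: "v \<in> N n" "x = v i" by blast
    show "r \<odot> x \<in> (\<lambda>v. v i) ` N n" for r using N(3)[OF v(1), of r] v(2) by force
    fix y assume "y \<in> (\<lambda>v. v i) ` N n"
    then obtain w where w: "w \<in> N n" "y = w i" by blast
    show "x + y \<in> (\<lambda>v. v i) ` N n" using N(2)[OF v(1) w(1)] v(2) w(2) by force
  qed
  moreover have "J n \<subseteq> J (Suc n)" for n using insert.prems(2)[of n] by (auto simp: J_def)
  ultimately obtain n2 where n2: "\<And>m. m \<ge> n2 \<Longrightarrow> J m = J n2"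
    using chain_stabilizes[OF \<open>noeth\<close>, of J] by blast
  define n where "n = max n1 n2"
  have "N m \<subseteq> N n" if m: "m \<ge> n" for m
  proof
    fix v assume v: "v \<in> N m"
    have "J m = J n" using n2[of m] n2[of n] m by (simp add: n_def)
    hence "v i \<in> J n" using v by (auto simp: J_def)
    then obtain w where w: "w \<in> N n" "w i = v i" by (auto simp: J_def)
    have "(\<lambda>j. v j + (- \<one>) \<odot> w j) \<in> N m"
      using N(2)[OF v N(3)[of w m "- \<one>"]] w(1) mono[OF m] by blast
    hence vw: "(\<lambda>j. v j - w j) \<in> N m" by (simp add: mul_simps)
    hence "(\<lambda>j. v j - w j) \<in> N' m" using w(2) by (simp add: N'_def)
    also have "N' m = N' n" using n1[of m] n1[of n] m by (simp add: n_def)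
    finally have "(\<lambda>j. v j - w j) \<in> N n" by (simp add: N'_def)
    from N(2)[OF this w(1)] show "v \<in> N n" by simp
  qed
  thus ?case using mono by blast
qed

text \<open>A linear section of \<open>T\<close> over the image of \<open>C\<close> does it. With
  \<open>S\<close> for \<open>T\<close>, functionals that vanish on the kernel become functionals of
  \<open>S y\<close>.\<close>

lemma functional_factors:
  assumes T: "endo T" and f: "functional f" and C: "subspace C"
    and ker: "\<And>y. y \<in> C \<Longrightarrow> T y = 0 \<Longrightarrow> f y = 0"
  shows "\<exists>g. functional g \<and> (\<forall>y\<in>C. g (T y) = f y)"
proof -
  interpret vp: vector_space_pair scale scale
    using vector_space_axioms by (simp add: vector_space_pair_def)
  obtain B where B: "B \<subseteq> T ` C" "independent B" "T ` C \<subseteq> span B"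
    using basis_exists[of "T ` C"] by metis
  have "\<forall>b\<in>B. \<exists>y\<in>C. T y = b" using B(1) by blast
  then obtain s0 where s0: "\<And>b. b \<in> B \<Longrightarrow> s0 b \<in> C" "\<And>b. b \<in> B \<Longrightarrow> T (s0 b) = b" by metis
  obtain s where s: "endo s" "\<forall>b\<in>B. s b = s0 b"
    using vp.linear_independent_extend[OF B(2)] by blast
  have *: "s z \<in> C \<and> T (s z) = z" if "z \<in> span B" for z
    using that
  proof (induction rule: span_induct_alt)
    case base
    show ?case by (simp add: linD(5)[OF s(1)] linD(5)[OF T] subspace_0[OF C])
  next
    case (step c b y)
    thus ?case using s(2) s0 subspace_add[OF C subspace_scale[OF C]]
      by (simp add: linD(3,4)[OF s(1)] linD(3,4)[OF T])
  qed
  show ?thesis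
  proof (intro exI conjI ballI)
    show "functional (\<lambda>z. f (s z))" by (rule lin_comp[OF f s(1)])
    fix y assume y: "y \<in> C"
    hence Ty: "s (T y) \<in> C" "T (s (T y)) = T y" using * B(3) by blast+
    have "f (s (T y) - y) = 0"
      using Ty y subspace_diff[OF C] by (intro ker) (auto simp: linD(6)[OF T])
    thus "f (s (T y)) = f y" by (simp add: linD(6)[OF f])
  qed
qed

lemma cm_L:
  assumes \<phi>: "bilin scale s \<phi>" and f: "functional f"
  shows "cm \<phi> (L f x) = cm (\<lambda>a b. \<phi> (L f a) b) x"
proof -
  note vs' = linD(2)[OF bilinD(1)[OF \<phi>]]
  note h = lin_scaleL[OF vs'] lin_scaleR lin_bilin1[OF \<phi>] lin_bilin2[OF \<phi>] lin_comp[OF f]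
    lin_ident[OF vector_space_axioms]
  note c = lin_cm[OF \<phi> lin_ident[OF vector_space_axioms]]
  have "cm \<phi> (L f x) = cm (\<lambda>a b. s (f a) (cm \<phi> b)) x"
    unfolding L_def by (simp add: sweedler_hom[OF c] linD(4)[OF c])
  also have "\<dots> = cm (\<lambda>a b. cm (\<lambda>c d. s (f a) (\<phi> c d)) b) x"
    by (simp add: sweedler_hom[OF lin_scaleR[OF lin_ident[OF vs']]])
  also have "\<dots> = cm (\<lambda>a b. cm (\<lambda>a' a''. s (f a') (\<phi> a'' b)) a) x"
    by (rule coassoc[where s = s, symmetric]) (intro h)+
  also have "\<dots> = cm (\<lambda>a b. \<phi> (L f a) b) x"
    unfolding L_def by (simp add: sweedler_hom[OF bilinD(1)[OF \<phi>]] linD(4)[OF bilinD(1)[OF \<phi>]])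
  finally show ?thesis .
qed

text \<open>If \<open>b\<^sub>1, \<dots>, b\<^sub>m\<close> is a basis of \<open>ker S\<close> in a finite-dimensional subcoalgebra and
  \<open>\<Delta> b\<^sub>j = \<Sum> b\<^sub>i \<otimes> a\<^sub>i\<^sub>j\<close> modulo terms with second factor in \<open>ker S\<close>, then the matrix \<open>(S a\<^sub>i\<^sub>j)\<close>
  has the left inverse \<open>(a\<^sub>i\<^sub>j)\<close> and is killed by the row \<open>(b\<^sub>1, \<dots>, b\<^sub>m)\<close>. Over a
  Noetherian ring a matrix with a left inverse is invertible.\<close>

lemma inj_antipode:
  assumes noeth
  shows "inj S"
proof -
  have "x = 0" if Sx: "S x = 0" for x
  proof -
    obtain C where C: "subcoalg C" "findim C" "x \<in> C"
      using findim_subcoalg_exists[of "{x}" UNIV] by (auto simp: subcoalg_def)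
    note Cs = subcoalgD(1)[OF C(1)]
    define J where "J = {y \<in> C. S y = 0}"
    have J: "subspace J" "findim J"
      using Cs findim_subset[OF C(2), of J] by (auto simp: J_def subspace_def linD[OF lin_S_ax])
    obtain B where B: "B \<subseteq> J" "independent B" "finite B" "span B = J"
      using findim_basis[OF J(2,1)] by metis
    have JC: "J \<subseteq> C" by (auto simp: J_def)
    obtain B1 where B1: "B \<subseteq> B1" "B1 \<subseteq> C" "independent B1" "C \<subseteq> span B1"
      using maximal_independent_subset_extend[OF order.trans[OF B(1) JC] B(2)] by metis
    obtain T where T: "finite T" "C \<subseteq> span T" using C(2) by (auto simp: findim_def)
    have finB1: "finite B1" using independent_span_bound[OF T(1) B1(3)] B1(2) T(2) by blast
    interpret vp: vector_space_pair scale "(*) :: 'k \<Rightarrow> 'k \<Rightarrow> 'k"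
      using vs by (simp add: vector_space_pair_def)
    interpret vp': vector_space_pair scale scale
      using vs by (simp add: vector_space_pair_def)
    have "\<exists>c. functional c \<and> (\<forall>j\<in>B1. c j = (if j = i then 1 else 0))" for i
      using vp.linear_independent_extend[OF B1(3), of "\<lambda>j. if j = i then 1 else 0"] by blast
    \<comment> \<open>With these coordinate functionals the coproduct of \<open>j\<close> is the sum
      of the tensors \<open>i \<otimes> L (c i) j\<close> over \<open>B1\<close>, so the matrix
      entries are \<open>L (c i) j\<close>.\<close>
    then obtain c where c: "\<And>i. functional (c i)" "\<And>i j. j \<in> B1 \<Longrightarrow> c i j = (if j = i then 1 else 0)"
      by metis
    have expand: "a = (\<Sum>i\<in>B1. c i a *s i)" if "a \<in> C" for a
    proof (rule vp'.linear_eq_on[of "\<lambda>a. a" "\<lambda>a. \<Sum>i\<in>B1. c i a *s i" a B1])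
      show "endo (\<lambda>a. \<Sum>i\<in>B1. c i a *s i)"
        by (rule linI[OF vs(1) vs(1)])
          (simp_all add: linD(3,4)[OF c(1)] scale_left_distrib sum.distrib scale_sum_right)
      show "b = (\<Sum>i\<in>B1. c i b *s i)" if "b \<in> B1" for b
        using that finB1 c(2)[OF that] by (simp add: if_distrib[of "\<lambda>x. x *s _"] cong: if_cong)
    qed (use that B1(4) lin_ident[OF vs(1)] in auto)
    have cJ: "c i y = 0" if "i \<in> B1 - B" "y \<in> J" for i y
    proof (rule vp.linear_eq_0_on_span[OF c(1)])
      show "y \<in> span B" using B(4) that(2) by simp
      fix j assume "j \<in> B"
      hence "j \<in> B1" "j \<noteq> i" using B1(1) that(1) by auto
      thus "c i j = 0" using c(2) by simp
    qed
    \<comment> \<open>On \<open>C\<close> the functional \<open>c i\<close> vanishes on the kernel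
      of \<open>S\<close>, so it has the form \<open>g (S y)\<close>. As \<open>S\<close> reverses
      the comultiplication, \<open>h (S (L (c i) j))\<close> becomes an evaluation of the coproduct
      of \<open>S j = 0\<close>.\<close>
    have SL: "S (L (c i) j) = 0" if i: "i \<in> B1 - B" and j: "j \<in> J" for i j
    proof (rule eq_if_functionals_eq)
      fix h assume h: "functional h"
      obtain g where g: "functional g" "\<And>y. y \<in> C \<Longrightarrow> g (S y) = c i y"
        using functional_factors[OF lin_S_ax c(1) Cs, of i] cJ[OF i] by (auto simp: J_def)
      note hh = hlin lin_comp[OF h] lin_comp[OF g(1)] lin_comp[OF c(1)]
      have b: "bilin scale (*) (\<lambda>a b. h a * g b)" by (intro hh)
      have "h (S (L (c i) j)) = cm (\<lambda>a b. c i a * h (S b)) j"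
        unfolding L_def
        by (simp add: sweedler_hom[OF lin_S_ax] sweedler_hom[OF h] linD(4)[OF lin_S_ax] linD(4)[OF h])
      also have "\<dots> = cm (\<lambda>a b. h (S b) * g (S a)) j"
        using j JC by (intro subcoalg_cm_eq[OF C(1), where s = "(*)"]; (intro hh)?) (auto simp: g)
      also have "\<dots> = cm (\<lambda>a b. h a * g b) (S j)" by (rule cm_S[OF b, symmetric])
      also have "\<dots> = 0" using j linD(5)[OF lin_cm[OF b lin_ident[OF vs(1)]]] by (simp add: J_def)
      finally show "h (S (L (c i) j)) = h 0" by (simp add: linD(5)[OF h])
    qed
    \<comment> \<open>Taking \<open>c i\<close> for \<open>f\<close> shows that the matrix has a
      left inverse; taking the counit shows that it kills the row of basis vectors.\<close>
    have key: "(\<Sum>k\<in>B. L f k \<odot> S (L (c k) j)) = f j *s \<one>" if f: "functional f" and j: "j \<in> J" for f j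
    proof -
      note hh = hlin lin_L[OF f] lin_comp[OF c(1)]
      have jC: "j \<in> C" using j JC by blast
      have b: "bilin scale scale (\<lambda>a b. a \<odot> S b)" by (intro hh)
      have b1: "bilin scale scale (\<lambda>a b. L f a \<odot> S b)" by (intro hh)
      have "f j *s \<one> = cm (\<lambda>a b. a \<odot> S b) (L f j)" by (simp add: S_r counit_L f)
      also have "\<dots> = cm (\<lambda>a b. L f a \<odot> S b) j" by (rule cm_L[OF b f])
      also have "\<dots> = cm (\<lambda>a b. L f (\<Sum>i\<in>B1. c i a *s i) \<odot> S b) j"
      proof (rule subcoalg_cm_eq[OF C(1) jC b1])
        have "endo (\<lambda>a. \<Sum>i\<in>B1. c i a *s i)"
          by (rule linI[OF vs(1) vs(1)])
            (simp_all add: linD(3,4)[OF c(1)] scale_left_distrib sum.distrib scale_sum_right)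
        thus "bilin scale scale (\<lambda>a b. L f (\<Sum>i\<in>B1. c i a *s i) \<odot> S b)" by (intro hh)
        show "L f a \<odot> S b = L f (\<Sum>i\<in>B1. c i a *s i) \<odot> S b" if "a \<in> C" for a b
          using expand[OF that] by metis
      qed
      also have "\<dots> = cm (\<lambda>a b. \<Sum>i\<in>B1. L f i \<odot> S (c i a *s b)) j"
        by (simp add: linD[OF lin_L'[OF f]] mul_simps linD(4)[OF lin_S_ax])
      also have "\<dots> = (\<Sum>i\<in>B1. L f i \<odot> S (L (c i) j))"
        unfolding sweedler_sum L_def by (simp add: sweedler_hom[OF lin_S_ax] cm_mul2)
      also have "\<dots> = (\<Sum>i\<in>B. L f i \<odot> S (L (c i) j))"
        by (rule sum.mono_neutral_right[OF finB1 B1(1)]) (use SL[OF _ j] in \<open>auto simp: mul_simps\<close>)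
      finally show ?thesis by simp
    qed
    \<comment> \<open>Right multiplication of rows by the matrix with entries
      \<open>S (L (c k) j)\<close>; it is left linear, and surjective by the left inverse.\<close>
    define F where "F v = (\<lambda>j. if j \<in> B then \<Sum>k\<in>B. v k \<odot> S (L (c k) j) else 0)" for v :: "'h \<Rightarrow> 'h"
    define V where "V = {v :: 'h \<Rightarrow> 'h. \<forall>i. i \<notin> B \<longrightarrow> v i = 0}"
    have F: "F (\<lambda>i. v i + w i) = (\<lambda>i. F v i + F w i)" "F (\<lambda>i. r \<odot> v i) = (\<lambda>i. r \<odot> F v i)"
      "F (\<lambda>i. 0) = (\<lambda>i. 0)" for v w r
      by (auto simp: F_def fun_eq_iff mul_simps sum.distrib mul_assoc)
    have Fn: "(F ^^ n) (\<lambda>i. v i + w i) = (\<lambda>i. (F ^^ n) v i + (F ^^ n) w i)"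
      "(F ^^ n) (\<lambda>i. r \<odot> v i) = (\<lambda>i. r \<odot> (F ^^ n) v i)" "(F ^^ n) (\<lambda>i. 0) = (\<lambda>i. 0)" for n v w r
      by (induction n) (simp_all add: F)
    have surj: "\<exists>u\<in>V. F u = v" if v: "v \<in> V" for v
    proof
      let ?u = "\<lambda>k. if k \<in> B then \<Sum>i\<in>B. v i \<odot> L (c i) k else 0"
      show "?u \<in> V" by (simp add: V_def)
      have "F ?u j = v j" if j: "j \<in> B" for j
      proof -
        have jJ: "j \<in> J" using j B(1) by blast
        have "F ?u j = (\<Sum>k\<in>B. \<Sum>i\<in>B. v i \<odot> (L (c i) k \<odot> S (L (c k) j)))"
          using j by (simp add: F_def mul_simps mul_assoc)
        also have "\<dots> = (\<Sum>i\<in>B. v i \<odot> (\<Sum>k\<in>B. L (c i) k \<odot> S (L (c k) j)))"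
          by (subst sum.swap) (simp add: mul_simps)
        also have "\<dots> = (\<Sum>i\<in>B. c i j *s v i)" by (simp add: key[OF c(1) jJ] mul_simps)
        also have "\<dots> = v j"
          using j B1(1) B(3) c(2) by (simp add: subset_iff if_distrib[of "\<lambda>x. x *s _"] cong: if_cong)
        finally show ?thesis .
      qed
      thus "F ?u = v" using v by (auto simp: fun_eq_iff V_def) (auto simp: F_def)
    qed
    have surjn: "\<exists>u\<in>V. (F ^^ n) u = v" if "v \<in> V" for v n
      using that
    proof (induction n arbitrary: v)
      case (Suc n)
      obtain w where w: "w \<in> V" "F w = v" using surj[OF Suc.prems] by blast
      obtain u where "u \<in> V" "(F ^^ n) u = w" using Suc.IH[OF w(1)] by blast
      thus ?case using w(2) by (intro bexI[of _ u]) auto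
    qed auto
    \<comment> \<open>The kernels of the iterates of \<open>F\<close> stabilize, so the surjective
      map \<open>F\<close> is injective: a row killed by \<open>F\<close> is the image of some
      \<open>u\<close> under the n-th iterate, and \<open>u\<close> lies in the stable
      kernel.\<close>
    define N where "N n = {v \<in> V. (F ^^ n) v = (\<lambda>i. 0)}" for n
    have "submodule B (N n)" for n
      by (auto simp: submodule_def N_def V_def Fn mul_simps)
    moreover have "N n \<subseteq> N (Suc n)" for n by (auto simp: N_def F)
    ultimately obtain n where n: "\<And>m. m \<ge> n \<Longrightarrow> N m = N n"
      using submodule_chain_stabilizes[OF assms B(3), of N] by blast
    \<comment> \<open>The row whose entries are the basis vectors themselves; its vanishing forces
      the basis to be empty.\<close>
    define v where "v = (\<lambda>k. if k \<in> B then k else 0)"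
    have "v \<in> V" by (simp add: v_def V_def)
    then obtain u where u: "u \<in> V" "(F ^^ n) u = v" using surjn by blast
    have "F v = (\<lambda>i. 0)"
    proof
      fix j
      show "F v j = 0"
      proof (cases "j \<in> B")
        case True
        hence j: "j \<in> J" using B(1) by blast
        have "F v j = (\<Sum>k\<in>B. L counit k \<odot> S (L (c k) j))" using True by (simp add: F_def v_def)
        also have "\<dots> = counit j *s \<one>" by (rule key[OF lin_counit_ax j])
        also have "counit j = 0" using counit_S[of j] j by (simp add: J_def linD(5)[OF lin_counit_ax])
        finally show ?thesis by simp
      qed (simp add: F_def)
    qed
    hence "u \<in> N (Suc n)" using u by (simp add: N_def)
    hence "u \<in> N n" using n[of "Suc n"] by simp
    hence v0: "v = (\<lambda>i. 0)" using u by (simp add: N_def)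
    have "k = 0" if "k \<in> B" for k using fun_cong[OF v0, of k] that by (simp add: v_def)
    hence "B = {}" using B(2) dependent_zero by blast
    moreover have "x \<in> J" using Sx C by (simp add: J_def)
    ultimately show "x = 0" using B(4) by auto
  qed
  hence "x = y" if "S x = S y" for x y
    using that linD(6)[OF lin_S_ax, of x y] by (metis diff_self eq_iff_diff_eq_0)
  thus ?thesis by (auto intro: injI)
qed

text \<open>\<open>H K\<^sup>+\<close> is a finitely generated left ideal; its generators lie in \<open>H L\<^sup>+\<close> for a Hopf subalgebra
  \<open>L\<close> of \<open>K\<close> that is finitely generated over \<open>K0\<close>, and \<open>L = K\<close>.\<close>

lemma finitely_generated_over:
  assumes noeth
    and K0: "subcoalg K0" "subalg K0" "\<And>x. x \<in> K0 \<Longrightarrow> S x \<in> K0" "\<And>C. simple_subcoalg C \<Longrightarrow> C \<subseteq> K0"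
    and K: "subcoalg K" "subalg K" "K0 \<subseteq> K"
  shows "\<exists>X. finite X \<and> X \<subseteq> K \<and> (\<forall>A. subalg A \<longrightarrow> K0 \<union> X \<subseteq> A \<longrightarrow> K \<subseteq> A)"
proof -
  let ?P = "\<lambda>Y. {h \<odot> k | h k. k \<in> Y \<and> counit k = 0}"
  have lid: "lideal (span (?P Y))" for Y
    unfolding lideal_def
  proof (intro conjI ballI allI span_zero span_add)
    fix r x assume "x \<in> span (?P Y)"
    thus "r \<odot> x \<in> span (?P Y)"
    proof (induction rule: span_induct_alt)
      case (step c z y)
      then obtain h k where "z = h \<odot> k" "k \<in> Y" "counit k = 0" by blast
      hence "r \<odot> z \<in> ?P Y" using mul_assoc[of r h k] by (metis (mono_tags, lifting) mem_Collect_eq)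
      thus ?case using step by (simp add: mul_simps span_add span_scale span_base)
    qed (simp add: mul_simps span_zero)
  qed
  obtain F where F: "finite F" "F \<subseteq> span (?P K)" "\<And>J. lideal J \<Longrightarrow> F \<subseteq> J \<Longrightarrow> span (?P K) \<subseteq> J"
    using \<open>noeth\<close> lid[of K] unfolding noeth_def by meson
  have "\<exists>Y. finite Y \<and> Y \<subseteq> K \<and> x \<in> span (?P Y)" if "x \<in> span (?P K)" for x
    using that
  proof (induction rule: span_induct_alt)
    case base
    show ?case by (rule exI[of _ "{}"]) (simp add: span_zero)
  next
    case (step c z y)
    then obtain Y where Y: "finite Y" "Y \<subseteq> K" "y \<in> span (?P Y)" by blast
    obtain h k where z: "z = h \<odot> k" "k \<in> K" "counit k = 0" using step by blast
    have "z \<in> ?P (insert k Y)" using z by blast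
    moreover have "span (?P Y) \<subseteq> span (?P (insert k Y))" by (rule span_mono) blast
    hence "y \<in> span (?P (insert k Y))" using Y(3) by blast
    ultimately have "c *s z + y \<in> span (?P (insert k Y))"
      by (intro span_add[OF span_scale[OF span_base]])
    thus ?case using Y z by (intro exI[of _ "insert k Y"]) auto
  qed
  hence "\<forall>x\<in>F. \<exists>Y. finite Y \<and> Y \<subseteq> K \<and> x \<in> span (?P Y)" using F(2) by blast
  from bchoice[OF this] obtain Y
    where "\<forall>x\<in>F. finite (Y x) \<and> Y x \<subseteq> K \<and> x \<in> span (?P (Y x))" by blast
  hence Y: "\<And>x. x \<in> F \<Longrightarrow> finite (Y x)" "\<And>x. x \<in> F \<Longrightarrow> Y x \<subseteq> K"
    "\<And>x. x \<in> F \<Longrightarrow> x \<in> span (?P (Y x))" by simp_all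
  have "finite (\<Union>x\<in>F. Y x)" "(\<Union>x\<in>F. Y x) \<subseteq> K" using F(1) Y(1,2) by auto
  \<comment> \<open>The finitely many elements of \<open>K\<close> that occur in the generators
    \<open>F\<close> are enclosed in a finite-dimensional subcoalgebra, so that the algebra
    generated together with \<open>K0\<close> is again a subcoalgebra.\<close>
  then obtain C where C: "subcoalg C" "findim C" "(\<Union>x\<in>F. Y x) \<subseteq> C" "C \<subseteq> K"
    using findim_subcoalg_exists[OF _ _ K(1)] by metis
  have U: "subcoalg (span (\<Union>{K0, C}))" by (rule subcoalg_span_Union) (use K0 C in auto)
  define L where "L = subalg hull (span (\<Union>{K0, C}))"
  have L: "subcoalg L" "subalg L"
    unfolding L_def using subcoalg_subalg_hull[OF U] subalg_hull by auto
  have "\<Union>{K0, C} \<subseteq> span (\<Union>{K0, C})" by (rule span_superset)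
  hence K0L: "K0 \<subseteq> L" "C \<subseteq> L" unfolding L_def using hull_subset[of "span (\<Union>{K0, C})" subalg] by auto
  have SL: "S x \<in> L" if "x \<in> L" for x
    by (rule antipode_closed[OF K0(1-3) wedge_exhausts[OF K0(1,4)] L K0L(1) that])
  have "\<And>C. simple_subcoalg C \<Longrightarrow> C \<subseteq> L" using K0(4) K0L(1) by blast
  note wL = wedge_exhausts[OF L(1) this]
  have "F \<subseteq> span (?P L)"
  proof
    fix x assume x: "x \<in> F"
    have "span (?P (Y x)) \<subseteq> span (?P L)"
      by (rule span_mono) (use x C(3) K0L(2) in blast)
    thus "x \<in> span (?P L)" using Y(3)[OF x] by blast
  qed
  hence PL: "span (?P K) \<subseteq> span (?P L)" by (rule F(3)[OF lid])
  have "K \<subseteq> L"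
  \<comment> \<open>\<open>L\<close> plays the part of the Hopf subalgebra with a retraction,
    \<open>K\<close> that of the subbialgebra shown to lie in it.\<close>
  proof (rule augmentation_ideal_determines[OF L SL wL inj_antipode[OF \<open>noeth\<close>] K(1,2)])
    fix y assume "y \<in> K" "counit y = 0"
    hence "\<one> \<odot> y \<in> ?P K" by blast
    hence "\<one> \<odot> y \<in> span (?P K)" by (rule span_base)
    thus "y \<in> span (?P L)" using subsetD[OF PL] unfolding one_mul by blast
  qed
  moreover obtain X where X: "X \<subseteq> C" "finite X" "span X = C"
    using findim_basis[OF C(2) subcoalgD(1)[OF C(1)]] by metis
  have "L \<subseteq> A" if A: "subalg A" "K0 \<union> X \<subseteq> A" for A
  proof -
    have "span X \<subseteq> A" using A by (intro span_minimal subalgD) auto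
    hence "\<Union>{K0, C} \<subseteq> A" using A X by auto
    hence "span (\<Union>{K0, C}) \<subseteq> A" by (rule span_minimal[OF _ subalgD(1)[OF A(1)]])
    thus ?thesis unfolding L_def using A(1) by (rule hull_minimal)
  qed
  ultimately show ?thesis using X C(4) by (intro exI[of _ X]) blast
qed

end


section \<open>The Hopf coradical\<close>

context hopf
begin

definition corad :: "'h set" where "corad = span (\<Union>{C. simple_subcoalg C})"

lemma subcoalg_corad: "subcoalg corad"
  unfolding corad_def by (rule subcoalg_span_Union) (simp add: simple_subcoalg_def)

lemma simple_subset_corad: "simple_subcoalg C \<Longrightarrow> C \<subseteq> corad"
  unfolding corad_def using span_superset[of "\<Union>{C. simple_subcoalg C}"] by blast

lemma subalg_hull_span: "subalg hull (span X) = subalg hull X"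
proof
  have "span X \<subseteq> subalg hull X"
    by (intro span_minimal hull_subset subalgD(1) subalg_hull)
  thus "subalg hull (span X) \<subseteq> subalg hull X" using subalg_hull by (rule hull_minimal)
  show "subalg hull X \<subseteq> subalg hull (span X)" by (rule hull_mono[OF span_superset])
qed

text \<open>If \<open>H\<close> is generated by a subcoalgebra \<open>C\<close>, the wedge filtration starting from the algebra
  generated by the coradical of \<open>C\<close> is an exhaustive algebra and coalgebra filtration, so its first
  term contains the coradical of \<open>H\<close>.\<close>

lemma hopf_coradical_finitely_generated:
  assumes F: "finite F" "subalg hull F = UNIV"
  shows "\<exists>X. finite X \<and> subalg hull corad = subalg hull X"
proof -
  obtain C where C: "subcoalg C" "findim C" "F \<subseteq> C"
    using findim_subcoalg_exists[OF F(1), of UNIV] by (auto simp: subcoalg_def)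
  have CI: "subcoalg (C \<inter> corad)" using C(1) subcoalg_corad by (rule subcoalg_Int)
  define K where "K = subalg hull (C \<inter> corad)"
  have K: "subcoalg K" "subalg K" "C \<inter> corad \<subseteq> K"
    unfolding K_def by (rule subcoalg_subalg_hull[OF CI], rule subalg_hull, rule hull_subset)
  let ?W = "\<Union>n. wedge K n"
  have "C \<subseteq> ?W"
    by (rule findim_subset_UN_wedge[OF C(2,1) K(1)]) (use K(3) simple_subset_corad in blast)
  moreover have "subalg ?W"
    unfolding subalg_def
  proof (intro conjI ballI subspace_UN_wedge[OF K(1)])
    have "\<one> \<in> wedge K 0" using subalgD(2)[OF K(2)] by simp
    thus "\<one> \<in> ?W" by blast
    show "x \<odot> y \<in> ?W" if "x \<in> ?W" "y \<in> ?W" for x y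
      using that wedge_mul[OF K(1,2)] by blast
  qed
  ultimately have "subalg hull F \<subseteq> ?W" using C(3) by (intro hull_minimal) auto
  hence W: "?W = UNIV" using F(2) by blast
  have "\<Union>{C. simple_subcoalg C} \<subseteq> K"
    using simple_subset_wedge_base[OF K(1)] W by blast
  hence "corad \<subseteq> K" unfolding corad_def by (intro span_minimal subalgD(1) K)
  hence "subalg hull corad \<subseteq> K" using K(2) by (rule hull_minimal)
  moreover have "K \<subseteq> subalg hull corad" unfolding K_def by (rule hull_mono) blast
  moreover obtain X where X: "finite X" "span X = C \<inter> corad"
    using findim_basis[OF findim_subset[OF C(2) Int_lower1] subcoalgD(1)[OF CI]] by metis
  ultimately have "subalg hull corad = subalg hull X"
    using subalg_hull_span[of X] unfolding K_def by simp
  thus ?thesis using X(1) by blast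
qed

text \<open>\<open>S\<close> reverses the comultiplication, so it exchanges the actions
  \<open>R\<close> and \<open>L\<close>. By injectivity every functional factors through
  \<open>S\<close>; hence subcoalgebras of the image of \<open>C\<close> pull back to subcoalgebras
  of \<open>C\<close>.\<close>

lemma simple_S_image:
  assumes inj: "inj S" and C: "simple_subcoalg C"
  shows "simple_subcoalg (S ` C)"
proof -
  have Cs: "subcoalg C" "C \<noteq> {0}" using C by (auto simp: simple_subcoalg_def)
  note S0 = linD(5)[OF lin_S_ax]
  have Sz: "S x = 0 \<longleftrightarrow> x = 0" for x using inj_eq[OF inj, of x 0] by (simp add: S0)
  have factor: "\<exists>g. functional g \<and> (\<forall>y. g (S y) = f y)" if f: "functional f" for f
    using functional_factors[OF lin_S_ax f subspace_UNIV] by (simp add: Sz linD(5)[OF f])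
  have RS: "R f (S x) = S (L (\<lambda>y. f (S y)) x)" "L f (S x) = S (R (\<lambda>y. f (S y)) x)"
    if f: "functional f" for f x
  proof -
    note hf = hlin lin_comp[OF f]
    have "bilin scale scale (\<lambda>a b. f b *s a)" "bilin scale scale (\<lambda>a b. f a *s b)" by (intro hf)+
    from cm_S[OF this(1)] cm_S[OF this(2)]
    show "R f (S x) = S (L (\<lambda>y. f (S y)) x)" "L f (S x) = S (R (\<lambda>y. f (S y)) x)"
      unfolding R_def L_def by (simp_all add: sweedler_hom[OF lin_S_ax] linD(4)[OF lin_S_ax])
  qed
  have "subspace (S ` C)"
    unfolding subspace_def
  proof (intro conjI ballI allI)
    note s = subcoalgD(1)[OF Cs(1)]
    show "0 \<in> S ` C" using subspace_0[OF s] S0 by force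
    fix x assume "x \<in> S ` C"
    then obtain a where a: "a \<in> C" "x = S a" by blast
    thus "c *s x \<in> S ` C" for c
      using subspace_scale[OF s a(1), of c] by (simp add: linD(4)[OF lin_S_ax, symmetric])
    fix y assume "y \<in> S ` C"
    then obtain b where b: "b \<in> C" "y = S b" by blast
    thus "x + y \<in> S ` C"
      using a subspace_add[OF s a(1) b(1)] by (simp add: linD(3)[OF lin_S_ax, symmetric])
  qed
  hence "subcoalg (S ` C)"
    unfolding subcoalg_def
  proof (intro conjI ballI allI impI)
    fix z f assume "z \<in> S ` C" and f: "functional f"
    then obtain x where x: "x \<in> C" "z = S x" by blast
    have f': "functional (\<lambda>y. f (S y))" by (rule lin_comp[OF f lin_S_ax])
    show "R f z \<in> S ` C" "L f z \<in> S ` C"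
      unfolding x(2) RS[OF f] by (intro imageI subcoalgD[OF Cs(1)] x f')+
  qed
  moreover have "S ` C \<noteq> {0}"
  proof
    assume *: "S ` C = {0}"
    hence "C \<subseteq> {0}" using Sz by blast
    thus False using Cs subspace_0[OF subcoalgD(1)[OF Cs(1)]] by blast
  qed
  moreover have "D = {0} \<or> D = S ` C" if D: "subcoalg D" "D \<subseteq> S ` C" for D
  proof -
    define D' where "D' = {x \<in> C. S x \<in> D}"
    have "subspace D'"
      using subcoalgD(1)[OF Cs(1)] subcoalgD(1)[OF D(1)] unfolding D'_def subspace_def
      by (auto simp: linD(3-5)[OF lin_S_ax])
    moreover have "R f x \<in> D'" "L f x \<in> D'" if x: "x \<in> D'" and f: "functional f" for x f
    proof -
      obtain g where g: "functional g" "f = (\<lambda>y. g (S y))" using factor[OF f] by fastforce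
      have "S (R f x) = L g (S x)" "S (L f x) = R g (S x)" using RS[OF g(1), of x] g(2) by auto
      thus "R f x \<in> D'" "L f x \<in> D'"
        using x f g D subcoalgD[OF Cs(1)] subcoalgD[OF D(1)] by (auto simp: D'_def)
    qed
    ultimately have "subcoalg D'" by (auto simp: subcoalg_def)
    moreover have "D' \<subseteq> C" by (auto simp: D'_def)
    ultimately have "D' = {0} \<or> D' = C" using C by (auto simp: simple_subcoalg_def)
    moreover have "D = S ` D'" using D(2) by (auto simp: D'_def)
    ultimately show ?thesis by (auto simp: S0)
  qed
  ultimately show ?thesis by (auto simp: simple_subcoalg_def)
qed

text \<open>The preimage of the Hopf coradical under \<open>S\<close> is a subalgebra, as
  \<open>S\<close> reverses products, and it contains the coradical, as \<open>S\<close> maps simple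
  subcoalgebras to simple ones.\<close>

lemma S_hopf_coradical:
  assumes inj: "inj S"
  shows "S ` (subalg hull corad) \<subseteq> subalg hull corad"
proof -
  let ?A = "subalg hull corad"
  note A = subalg_hull[of corad]
  have "S x \<in> corad" if "x \<in> corad" for x
    using that unfolding corad_def
  proof (induction rule: span_induct_alt)
    case base
    show ?case by (simp add: linD(5)[OF lin_S_ax] span_zero)
  next
    case (step c z y)
    then obtain C where "simple_subcoalg C" "z \<in> C" by blast
    hence "S z \<in> \<Union>{C. simple_subcoalg C}" using simple_S_image[OF inj] by blast
    thus ?case
      using step by (simp add: linD(3,4)[OF lin_S_ax] span_add span_scale span_base)
  qed
  hence "corad \<subseteq> {x. S x \<in> ?A}" using hull_subset[of corad subalg] by blast
  moreover have "subalg {x. S x \<in> ?A}"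
    using subalgD[OF A] by (auto simp: subalg_def subspace_def linD[OF lin_S_ax] S_one S_mul)
  ultimately have "?A \<subseteq> {x. S x \<in> ?A}" by (rule hull_minimal)
  thus ?thesis by blast
qed

end

text \<open>The Hopf algebra with opposite multiplication and opposite comultiplication has the same
  antipode; it exchanges left and right ideals.\<close>

definition swap_delta :: "('h \<Rightarrow> ('h \<times> 'h) list) \<Rightarrow> 'h \<Rightarrow> ('h \<times> 'h) list"
  where "swap_delta d x = map prod.swap (d x)"

lemma sweedler_swap_delta: "sweedler (swap_delta d) \<phi> = sweedler d (\<lambda>a b. \<phi> b a)"
  by (simp add: sweedler_def swap_delta_def fun_eq_iff comp_def case_prod_unfold)

lemma bilin_flip: "bilin s s' \<phi> \<Longrightarrow> bilin s s' (\<lambda>a b. \<phi> b a)"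
  by (simp add: bilin_def)

context hopf
begin

lemma coalgebra_cop: "coalgebra scale (swap_delta delta) counit"
proof (intro coalgebra.intro vector_space_axioms coalgebra_axioms.intro)
  show "lin scale (*) (sweedler (swap_delta delta) \<phi>)" if "bilin scale (*) \<phi>" for \<phi>
    unfolding sweedler_swap_delta by (rule sweedler_linear_ax[OF bilin_flip[OF that]])
  show "sweedler (swap_delta delta) (\<lambda>a b. sweedler (swap_delta delta) (\<lambda>a' a''. \<psi> a' a'' b) a) x
      = sweedler (swap_delta delta) (\<lambda>a b. sweedler (swap_delta delta) (\<psi> a) b) x"
    if "\<And>b c. lin scale (*) (\<lambda>a. \<psi> a b c)" "\<And>a c. lin scale (*) (\<lambda>b. \<psi> a b c)"
      "\<And>a b. lin scale (*) (\<psi> a b)" for \<psi> x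
    unfolding sweedler_swap_delta
    using coassoc_ax[of "\<lambda>a b c. \<psi> c b a" x] that by simp
qed (simp_all add: sweedler_swap_delta lin_counit_ax counit_l counit_r)

lemma hopf_op_cop: "hopf scale (swap_delta delta) counit (\<lambda>x y. y \<odot> x) \<one> S"
proof (intro hopf.intro coalgebra_cop hopf_axioms.intro)
  show "sweedler (swap_delta delta) \<phi> (y \<odot> x)
      = sweedler (swap_delta delta) (\<lambda>a b. sweedler (swap_delta delta) (\<lambda>c d. \<phi> (c \<odot> a) (d \<odot> b)) y) x"
    if "bilin scale (*) \<phi>" for \<phi> x y
    unfolding sweedler_swap_delta cm_mul_ax[OF bilin_flip[OF that]]
    by (subst sweedler_swap) (rule refl)
  show "sweedler (swap_delta delta) \<phi> \<one> = \<phi> \<one> \<one>" if "bilin scale (*) \<phi>" for \<phi>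
    unfolding sweedler_swap_delta by (rule cm_one_ax[OF bilin_flip[OF that]])
qed (simp_all add: sweedler_swap_delta bilin_flip[OF bilin_mul] mul_assoc counit_mul counit_one
    lin_S_ax S_l S_r mult.commute)

lemma subcoalg_cop: "coalgebra.subcoalg scale (swap_delta delta) C \<longleftrightarrow> subcoalg C"
proof -
  interpret c: coalgebra scale "swap_delta delta" counit by (rule coalgebra_cop)
  show ?thesis
    by (auto simp: c.subcoalg_def subcoalg_def c.R_def c.L_def R_def L_def sweedler_swap_delta)
qed

lemma simple_subcoalg_cop:
  "coalgebra.simple_subcoalg scale (swap_delta delta) C \<longleftrightarrow> simple_subcoalg C"
proof -
  interpret c: coalgebra scale "swap_delta delta" counit by (rule coalgebra_cop)
  show ?thesis by (simp add: c.simple_subcoalg_def simple_subcoalg_def subcoalg_cop)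
qed

lemma subalg_op: "hopf.subalg scale (\<lambda>x y. y \<odot> x) \<one> A \<longleftrightarrow> subalg A"
proof -
  interpret c: hopf scale "swap_delta delta" counit "\<lambda>x y. y \<odot> x" \<one> S by (rule hopf_op_cop)
  show ?thesis by (auto simp: c.subalg_def subalg_def)
qed

lemma inj_antipode':
  assumes "noeth \<or> hopf.noeth (\<lambda>x y. y \<odot> x)"
  shows "inj S"
  using assms inj_antipode hopf.inj_antipode[OF hopf_op_cop] by blast

lemma finitely_generated_over':
  assumes n: "noeth \<or> hopf.noeth (\<lambda>x y. y \<odot> x)"
    and K0: "subcoalg K0" "subalg K0" "\<And>x. x \<in> K0 \<Longrightarrow> S x \<in> K0" "\<And>C. simple_subcoalg C \<Longrightarrow> C \<subseteq> K0"
    and K: "subcoalg K" "subalg K" "K0 \<subseteq> K"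
  shows "\<exists>X. finite X \<and> X \<subseteq> K \<and> (\<forall>A. subalg A \<longrightarrow> K0 \<union> X \<subseteq> A \<longrightarrow> K \<subseteq> A)"
  using n
proof
  assume noeth
  thus ?thesis by (rule finitely_generated_over[OF _ K0 K])
next
  assume "hopf.noeth (\<lambda>x y. y \<odot> x)"
  from hopf.finitely_generated_over[OF hopf_op_cop this, unfolded subcoalg_cop simple_subcoalg_cop subalg_op,
      OF K0 K]
  show ?thesis .
qed

text \<open>Used with the whole algebra for \<open>K\<close> and with the Hopf coradical for
  \<open>K0\<close>; generators of \<open>K0\<close> are joined to the finitely many elements that
  generate \<open>K\<close> over it.\<close>

lemma affine_step:
  assumes n: "noeth \<or> hopf.noeth (\<lambda>x y. y \<odot> x)"
    and K0: "subcoalg K0" "subalg K0" "S ` K0 \<subseteq> K0" "corad \<subseteq> K0" and fg: "finite F" "K0 = subalg hull F"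
    and K: "subcoalg K" "subalg K" "K0 \<subseteq> K"
  shows "\<exists>G. finite G \<and> K = subalg hull G"
proof -
  have "C \<subseteq> K0" if "simple_subcoalg C" for C using simple_subset_corad[OF that] K0(4) by blast
  then obtain X where X: "finite X" "X \<subseteq> K" "\<And>A. subalg A \<Longrightarrow> K0 \<union> X \<subseteq> A \<Longrightarrow> K \<subseteq> A"
    using finitely_generated_over'[OF n K0(1,2) _ _ K] K0(3) by (metis image_subset_iff)
  have "K = subalg hull (F \<union> X)"
  proof
    have "K0 \<subseteq> subalg hull (F \<union> X)" unfolding fg(2) by (rule hull_mono) blast
    moreover have "X \<subseteq> subalg hull (F \<union> X)" using hull_subset[of "F \<union> X" subalg] by blast
    ultimately show "K \<subseteq> subalg hull (F \<union> X)" by (intro X(3) subalg_hull) blast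
    have "F \<subseteq> K0" unfolding fg(2) by (rule hull_subset)
    thus "subalg hull (F \<union> X) \<subseteq> K" using X(2) K by (intro hull_minimal) auto
  qed
  thus ?thesis using fg(1) X(1) by blast
qed

end


section \<open>Hopf algebras with comultiplication in the tensor square\<close>

lemma lin_ext_superset:
  assumes "vector_space s" "finite A" "Poly_Mapping.keys p \<subseteq> A"
  shows "lin_ext s f p = (\<Sum>x\<in>A. s (Poly_Mapping.lookup p x) (f x))"
proof -
  interpret vector_space s by fact
  show ?thesis
    unfolding lin_ext_def
    by (rule sum.mono_neutral_left) (use assms in \<open>auto simp: in_keys_iff\<close>)
qed

lemma lin_lin_ext:
  fixes s :: "'k::field \<Rightarrow> 'v::ab_group_add \<Rightarrow> 'v" and f :: "'x \<Rightarrow> 'v"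
  assumes "vector_space s"
  shows "lin fscale s (lin_ext s f)"
proof (rule linI[OF vector_space_fscale assms])
  interpret vector_space s by fact
  fix p q :: "'x \<Rightarrow>\<^sub>0 'k" and c
  let ?A = "Poly_Mapping.keys p \<union> Poly_Mapping.keys q"
  have "finite ?A" "Poly_Mapping.keys (p + q) \<subseteq> ?A" by (auto simp: keys_add)
  thus "lin_ext s f (p + q) = lin_ext s f p + lin_ext s f q"
    by (simp add: lin_ext_superset[OF assms, of ?A] lookup_add scale_left_distrib sum.distrib)
  have "Poly_Mapping.keys (fscale c p) \<subseteq> Poly_Mapping.keys p" by (auto simp: in_keys_iff)
  thus "lin_ext s f (fscale c p) = s c (lin_ext s f p)"
    by (simp add: lin_ext_superset[OF assms, of "Poly_Mapping.keys p"] scale_sum_right)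
qed

lemma lin_ext_single: "vector_space s \<Longrightarrow> lin_ext s f (Poly_Mapping.single x c) = s c (f x)"
  by (subst lin_ext_superset[of s "{x}"]) auto

lemma lin_ext_lin_ext:
  assumes "lin s s' g"
  shows "g (lin_ext s f p) = lin_ext s' (\<lambda>x. g (f x)) p"
  by (simp add: lin_ext_def linD(4)[OF assms] linD(8)[OF assms])

lemma lin_ext_cong:
  "(\<And>x. x \<in> Poly_Mapping.keys p \<Longrightarrow> f x = g x) \<Longrightarrow> lin_ext s f p = lin_ext s g p"
  by (simp add: lin_ext_def)

lemma fscale_single: "fscale c (Poly_Mapping.single x d) = Poly_Mapping.single x (c * d)"
  by (rule poly_mapping_eqI) (simp add: lookup_single when_def)

lemma lin_ext_id: "lin_ext fscale (\<lambda>x. Poly_Mapping.single x 1) p = p"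
  by (rule poly_mapping_eqI)
    (simp add: lin_ext_def fscale_single lookup_sum lookup_single when_def in_keys_iff)

lemma bilin_tensor_null:
  assumes \<phi>: "bilin scale s \<phi>" and p: "p \<in> tensor_null scale"
  shows "lin_ext s (\<lambda>(a, b). \<phi> a b) p = 0"
proof -
  note 1 = linD[OF bilinD(1)[OF \<phi>]] and 2 = linD[OF bilinD(2)[OF \<phi>]]
  note s = 1(2)
  interpret s: vector_space s by fact
  interpret fs: vector_space fscale by (rule vector_space_fscale)
  let ?F = "lin_ext s (\<lambda>(a, b). \<phi> a b)"
  note F = lin_lin_ext[OF s, of "\<lambda>(a, b). \<phi> a b"]
  show ?thesis
    using p unfolding tensor_null_def
  proof (induction rule: fs.span_induct_alt)
    case base
    show ?case by (rule linD(5)[OF F])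
  next
    case (step c x y)
    hence "?F x = 0"
      by (auto simp: linD(6)[OF F] lin_ext_single[OF s] 1(3,4) 2(3,4))
    thus ?case using step by (simp add: linD(3,4)[OF F])
  qed
qed

text \<open>Bilinear forms separate the points of the tensor square: a functional on the free space
  that kills the relations but not \<open>p\<close> restricts to a bilinear form on the basis
  vectors.\<close>

lemma tensor_nullI:
  assumes vs: "vector_space scale"
    and p: "\<And>\<phi>. bilin scale (*) \<phi> \<Longrightarrow> lin_ext (*) (\<lambda>(a, b). \<phi> a b) p = 0"
  shows "p \<in> tensor_null scale"
proof (rule ccontr)
  interpret fs: vector_space fscale by (rule vector_space_fscale)
  assume "p \<notin> tensor_null scale"
  moreover have "fs.subspace (tensor_null scale)" unfolding tensor_null_def by (rule fs.subspace_span)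
  ultimately obtain F where F: "lin fscale (*) F" "\<And>q. q \<in> tensor_null scale \<Longrightarrow> F q = 0" "F p = 1"
    using fs.functional_separates_subspace by metis
  define \<phi> where "\<phi> a b = F (Poly_Mapping.single (a, b) 1)" for a b
  have Fs: "F (Poly_Mapping.single x c) = c * F (Poly_Mapping.single x 1)" for x c
    using linD(4)[OF F(1), of c "Poly_Mapping.single x 1"] by (simp add: fscale_single)
  have "bilin scale (*) \<phi>"
  proof (intro bilinI linI vs vector_space_times)
    fix a b x y c
    have "Poly_Mapping.single (x + y, b) 1 - Poly_Mapping.single (x, b) 1 - Poly_Mapping.single (y, b) 1
        \<in> tensor_null scale"
      "Poly_Mapping.single (a, x + y) 1 - Poly_Mapping.single (a, x) 1 - Poly_Mapping.single (a, y) 1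
        \<in> tensor_null scale"
      "Poly_Mapping.single (scale c x, b) 1 - Poly_Mapping.single (x, b) c \<in> tensor_null scale"
      "Poly_Mapping.single (a, scale c x) 1 - Poly_Mapping.single (a, x) c \<in> tensor_null scale"
      unfolding tensor_null_def by (rule fs.span_base, blast)+
    from this[THEN F(2)]
    show "\<phi> (x + y) b = \<phi> x b + \<phi> y b" "\<phi> a (x + y) = \<phi> a x + \<phi> a y"
      "\<phi> (scale c x) b = c * \<phi> x b" "\<phi> a (scale c x) = c * \<phi> a x"
      by (simp_all add: \<phi>_def linD(6)[OF F(1)] Fs[of _ c] diff_eq_eq add.commute)
  qed
  from p[OF this] have "lin_ext (*) (\<lambda>x. F (Poly_Mapping.single x 1)) p = 0"
    by (simp add: \<phi>_def case_prod_unfold)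
  thus False using F(3) lin_ext_lin_ext[OF F(1), of "\<lambda>x. Poly_Mapping.single x 1" p] by (simp add: lin_ext_id)
qed

lemma trilin_tensor3_null:
  assumes 1: "\<And>b c. lin scale s (\<lambda>a. \<psi> a b c)" and 2: "\<And>a c. lin scale s (\<lambda>b. \<psi> a b c)"
    and 3: "\<And>a b. lin scale s (\<psi> a b)" and p: "p \<in> tensor3_null scale"
  shows "lin_ext s (\<lambda>(a, b, c). \<psi> a b c) p = 0"
proof -
  note s = linD(2)[OF 1]
  interpret s: vector_space s by fact
  interpret fs: vector_space fscale by (rule vector_space_fscale)
  let ?F = "lin_ext s (\<lambda>(a, b, c). \<psi> a b c)"
  note F = lin_lin_ext[OF s, of "\<lambda>(a, b, c). \<psi> a b c"]
  show ?thesis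
    using p unfolding tensor3_null_def
  proof (induction rule: fs.span_induct_alt)
    case base
    show ?case by (rule linD(5)[OF F])
  next
    case (step c x y)
    hence "?F x = 0"
      by (auto simp: linD(6)[OF F] lin_ext_single[OF s] linD(3,4)[OF 1] linD(3,4)[OF 2] linD(3,4)[OF 3])
    thus ?case using step by (simp add: linD(3,4)[OF F])
  qed
qed

section \<open>From the comultiplication in the tensor square to Sweedler sums\<close>

context hopf_algebra
begin

lemma comult_diff:
  assumes "p \<in> comult x" "q \<in> comult x"
  shows "p - q \<in> tensor_null scale"
proof -
  interpret fs: vector_space fscale by (rule vector_space_fscale)
  have sub: "fs.subspace (tensor_null scale)" unfolding tensor_null_def by (rule fs.subspace_span)
  obtain z where "comult x = {(p, q). p - q \<in> tensor_null scale} `` {z}"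
    using comult_closed[of x] unfolding tensor_square_def by (auto elim: quotientE)
  hence "z - p \<in> tensor_null scale" "z - q \<in> tensor_null scale" using assms by auto
  from fs.subspace_diff[OF sub this(2,1)] show ?thesis by simp
qed

lemma comultI:
  assumes "p \<in> comult x" "p - q \<in> tensor_null scale"
  shows "q \<in> comult x"
proof -
  interpret fs: vector_space fscale by (rule vector_space_fscale)
  have sub: "fs.subspace (tensor_null scale)" unfolding tensor_null_def by (rule fs.subspace_span)
  obtain z where z: "comult x = {(p, q). p - q \<in> tensor_null scale} `` {z}"
    using comult_closed[of x] unfolding tensor_square_def by (auto elim: quotientE)
  hence "z - p \<in> tensor_null scale" using assms by auto
  from fs.subspace_add[OF sub this assms(2)] show ?thesis by (simp add: z)
qed

definition rep :: "'h \<Rightarrow> ('h \<times> 'h \<Rightarrow>\<^sub>0 'k)" where "rep x = (SOME p. p \<in> comult x)"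

lemma rep: "rep x \<in> comult x"
proof -
  interpret fs: vector_space fscale by (rule vector_space_fscale)
  obtain z where z: "comult x = {(p, q). p - q \<in> tensor_null scale} `` {z}"
    using comult_closed[of x] unfolding tensor_square_def by (auto elim: quotientE)
  have "0 \<in> tensor_null scale" unfolding tensor_null_def by (rule fs.span_zero)
  hence "z \<in> comult x" by (simp add: z)
  thus ?thesis unfolding rep_def by (rule someI)
qed

text \<open>Sweedler lists carry no scalars, so each coefficient is absorbed into the first tensor
  factor; the order of the list is an arbitrary choice.\<close>

definition delta :: "'h \<Rightarrow> ('h \<times> 'h) list"
  where "delta x = map (\<lambda>(a, b). (scale (Poly_Mapping.lookup (rep x) (a, b)) a, b))
    (SOME l. set l = Poly_Mapping.keys (rep x) \<and> distinct l)"

text \<open>Representatives differ by multilinearity relations, which bilinear maps kill. As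
  \<open>p\<close> is arbitrary, each axiom on representatives can be read off at the representative
  it provides.\<close>

lemma sweedler_eq_lin_ext:
  assumes \<phi>: "bilin scale s \<phi>" and p: "p \<in> comult x"
  shows "sweedler delta \<phi> x = lin_ext s (\<lambda>(a, b). \<phi> a b) p"
proof -
  note s = linD(2)[OF bilinD(1)[OF \<phi>]]
  define l where "l = (SOME l. set l = Poly_Mapping.keys (rep x) \<and> distinct l)"
  have "\<exists>l. set l = Poly_Mapping.keys (rep x) \<and> distinct l"
    by (rule finite_distinct_list) simp
  from someI_ex[OF this] have l: "set l = Poly_Mapping.keys (rep x)" "distinct l"
    by (auto simp: l_def)
  have "sweedler delta \<phi> x = (\<Sum>(a, b)\<leftarrow>l. s (Poly_Mapping.lookup (rep x) (a, b)) (\<phi> a b))"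
    by (simp add: sweedler_def delta_def l_def[symmetric] comp_def case_prod_unfold
        linD(4)[OF bilinD(1)[OF \<phi>]])
  also have "\<dots> = lin_ext s (\<lambda>(a, b). \<phi> a b) (rep x)"
    unfolding lin_ext_def using l by (simp add: sum_list_distinct_conv_sum_set case_prod_unfold)
  also have "\<dots> = lin_ext s (\<lambda>(a, b). \<phi> a b) p"
    using bilin_tensor_null[OF \<phi> comult_diff[OF rep p]] by (simp add: linD(6)[OF lin_lin_ext[OF s]])
  finally show ?thesis .
qed

lemma bilin_scale1: "lin scale (*) f \<Longrightarrow> bilin scale scale (\<lambda>a b. scale (f a) b)"
  by (intro bilinI lin_scaleL[OF vector_space_axioms] lin_scaleR lin_ident[OF vector_space_axioms])

lemma bilin_scale2: "lin scale (*) f \<Longrightarrow> bilin scale scale (\<lambda>a b. scale (f b) a)"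
  by (intro bilinI lin_scaleL[OF vector_space_axioms] lin_scaleR lin_ident[OF vector_space_axioms])

lemma bilin_times: "bilin scale scale (*)"
  by (intro bilinI linI vector_space_axioms) (simp_all add: algebra_simps scale_mult_left scale_mult_right)

lemma coalgebra: "coalgebra scale delta counit"
proof (intro coalgebra.intro vector_space_axioms coalgebra_axioms.intro)
  note vs = vector_space_axioms vector_space_times
  show lin: "lin scale (*) (sweedler delta \<phi>)" if \<phi>: "bilin scale (*) \<phi>" for \<phi>
  proof (rule linI[OF vs])
    fix x y c
    note F = lin_lin_ext[OF vs(2), of "\<lambda>(a, b). \<phi> a b"]
    show "sweedler delta \<phi> (x + y) = sweedler delta \<phi> x + sweedler delta \<phi> y"
      unfolding sweedler_eq_lin_ext[OF \<phi> comult_add[OF rep[of x] rep[of y]]]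
        sweedler_eq_lin_ext[OF \<phi> rep[of x]] sweedler_eq_lin_ext[OF \<phi> rep[of y]]
      by (rule linD(3)[OF F])
    show "sweedler delta \<phi> (scale c x) = c * sweedler delta \<phi> x"
      unfolding sweedler_eq_lin_ext[OF \<phi> comult_scale[OF rep[of x]]]
        sweedler_eq_lin_ext[OF \<phi> rep[of x]]
      by (rule linD(4)[OF F])
  qed
  show "lin scale (*) counit" by (rule counit_linear)
  show "sweedler delta (\<lambda>a b. scale (counit a) b) x = x" for x
    unfolding sweedler_eq_lin_ext[OF bilin_scale1[OF counit_linear] rep] by (rule counit_left[OF rep])
  show "sweedler delta (\<lambda>a b. scale (counit b) a) x = x" for x
    unfolding sweedler_eq_lin_ext[OF bilin_scale2[OF counit_linear] rep] by (rule counit_right[OF rep])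
  show "sweedler delta (\<lambda>a b. sweedler delta (\<lambda>a' a''. \<psi> a' a'' b) a) x
      = sweedler delta (\<lambda>a b. sweedler delta (\<psi> a) b) x"
    if 1: "\<And>b c. lin scale (*) (\<lambda>a. \<psi> a b c)" and 2: "\<And>a c. lin scale (*) (\<lambda>b. \<psi> a b c)"
      and 3: "\<And>a b. lin scale (*) (\<psi> a b)" for \<psi> x
  proof -
    let ?F = "lin_ext (*) (\<lambda>(a, b, c). \<psi> a b c)"
    note F = lin_lin_ext[OF vs(2), of "\<lambda>(a, b, c). \<psi> a b c"]
    have b1: "bilin scale (*) (\<lambda>a' a''. \<psi> a' a'' b)" and b2: "bilin scale (*) (\<psi> b)" for b
      by (intro bilinI 1 2 3)+
    have B1: "bilin scale (*) (\<lambda>a b. sweedler delta (\<lambda>a' a''. \<psi> a' a'' b) a)"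
      by (intro bilinI lin[OF b1] lin_sweedler_inner 3 vs)
    have B2: "bilin scale (*) (\<lambda>a b. sweedler delta (\<psi> a) b)"
      by (intro bilinI lin[OF b2] lin_sweedler_inner 1 vs)
    have "?F (comult_tensor_id rep (rep x) - id_tensor_comult rep (rep x)) = 0"
      by (rule trilin_tensor3_null[OF 1 2 3 coassoc[OF rep]])
    hence "?F (comult_tensor_id rep (rep x)) = ?F (id_tensor_comult rep (rep x))"
      by (simp add: linD(6)[OF F])
    moreover have "?F (comult_tensor_id rep (rep x))
        = sweedler delta (\<lambda>a b. sweedler delta (\<lambda>a' a''. \<psi> a' a'' b) a) x"
      unfolding comult_tensor_id_def sweedler_eq_lin_ext[OF B1 rep] lin_ext_lin_ext[OF F]
      by (rule lin_ext_cong, clarsimp simp: lin_ext_lin_ext[OF F] sweedler_eq_lin_ext[OF b1 rep])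
        (rule lin_ext_cong, clarsimp simp: lin_ext_single[OF vs(2)])
    moreover have "?F (id_tensor_comult rep (rep x)) = sweedler delta (\<lambda>a b. sweedler delta (\<psi> a) b) x"
      unfolding id_tensor_comult_def sweedler_eq_lin_ext[OF B2 rep] lin_ext_lin_ext[OF F]
      by (rule lin_ext_cong, clarsimp simp: lin_ext_lin_ext[OF F] sweedler_eq_lin_ext[OF b2 rep])
        (rule lin_ext_cong, clarsimp simp: lin_ext_single[OF vs(2)])
    ultimately show ?thesis by simp
  qed
qed

lemma hopf: "hopf scale delta counit (*) 1 antipode"
proof (intro hopf.intro coalgebra hopf_axioms.intro bilin_times)
  interpret c: coalgebra scale delta counit by (rule coalgebra)
  note h = c.lin_intros lin_bilin1[OF bilin_times] lin_bilin2[OF bilin_times] lin_comp[OF antipode_linear]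
  show "sweedler delta \<phi> (x * y) = sweedler delta (\<lambda>a b. sweedler delta (\<lambda>c d. \<phi> (a * c) (b * d)) y) x"
    if \<phi>: "bilin scale (*) \<phi>" for \<phi> x y
  proof -
    let ?F = "lin_ext (*) (\<lambda>(a, b). \<phi> a b)"
    note F = lin_lin_ext[OF vector_space_times, of "\<lambda>(a, b). \<phi> a b"]
    have b: "bilin scale (*) (\<lambda>c d. \<phi> (a * c) (b * d))" for a b
      by (intro h lin_bilin1[OF \<phi>] lin_bilin2[OF \<phi>])
    have B: "bilin scale (*) (\<lambda>a b. sweedler delta (\<lambda>c d. \<phi> (a * c) (b * d)) y)"
      by (intro h lin_bilin1[OF \<phi>] lin_bilin2[OF \<phi>])
    have "sweedler delta \<phi> (x * y) = ?F (tensor_mult (rep x) (rep y))"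
      by (rule sweedler_eq_lin_ext[OF \<phi> comult_mult[OF rep rep]])
    also have "\<dots> = lin_ext (*) (\<lambda>(a, b). lin_ext (*) (\<lambda>(c, d). \<phi> (a * c) (b * d)) (rep y)) (rep x)"
      unfolding tensor_mult_def lin_ext_lin_ext[OF F]
      by (rule lin_ext_cong, clarsimp simp: lin_ext_lin_ext[OF F])
        (rule lin_ext_cong, clarsimp simp: lin_ext_single[OF vector_space_times])
    also have "\<dots> = sweedler delta (\<lambda>a b. sweedler delta (\<lambda>c d. \<phi> (a * c) (b * d)) y) x"
      unfolding sweedler_eq_lin_ext[OF B rep]
      by (rule lin_ext_cong) (clarsimp simp: sweedler_eq_lin_ext[OF b rep])
    finally show ?thesis .
  qed
  show "sweedler delta \<phi> 1 = \<phi> 1 1" if \<phi>: "bilin scale (*) \<phi>" for \<phi>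
    using sweedler_eq_lin_ext[OF \<phi> comult_one] by (simp add: lin_ext_single[OF vector_space_times])
  have b: "bilin scale scale (\<lambda>a b. antipode a * b)" "bilin scale scale (\<lambda>a b. a * antipode b)"
    by (intro h)+
  show "sweedler delta (\<lambda>a b. antipode a * b) x = scale (counit x) 1" for x
    unfolding sweedler_eq_lin_ext[OF b(1) rep] by (rule antipode_left[OF rep])
  show "sweedler delta (\<lambda>a b. a * antipode b) x = scale (counit x) 1" for x
    unfolding sweedler_eq_lin_ext[OF b(2) rep] by (rule antipode_right[OF rep])
qed (simp_all add: mult.assoc counit_mult counit_one antipode_linear)

sublocale hopf scale delta counit "(*)" 1 antipode
  by (rule hopf)

text \<open>For the converse, a projection onto \<open>C\<close> is applied to both factors of a
  representative. The result \<open>q\<close> has its keys in \<open>C \<times> C\<close> and the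
  same class, since all bilinear forms take the same value on it.\<close>

lemma subcoalgebra_iff: "subcoalgebra scale comult C \<longleftrightarrow> subcoalg C"
proof
  assume C: "subcoalgebra scale comult C"
  hence sub: "subspace C" by (simp add: subcoalgebra_def)
  have "R f x \<in> C \<and> L f x \<in> C" if x: "x \<in> C" and f: "functional f" for x f
  proof -
    obtain p where p: "p \<in> comult x" "Poly_Mapping.keys p \<subseteq> C \<times> C"
      using C x unfolding subcoalgebra_def tensor_square_image_def by blast
    have "R f x = lin_ext scale (\<lambda>(a, b). scale (f b) a) p" "L f x = lin_ext scale (\<lambda>(a, b). scale (f a) b) p"
      unfolding R_def L_def
      by (rule sweedler_eq_lin_ext[OF bilin_scale2[OF f] p(1)], rule sweedler_eq_lin_ext[OF bilin_scale1[OF f] p(1)])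
    thus ?thesis
      unfolding lin_ext_def using p(2) by (auto intro!: subspace_sum[OF sub] subspace_scale[OF sub])
  qed
  thus "subcoalg C" using sub by (simp add: subcoalg_def)
next
  assume C: "subcoalg C"
  obtain t where t: "endo t" "\<And>x. t x \<in> C" "\<And>x. x \<in> C \<Longrightarrow> t x = x"
    by (rule projection_exists[OF subcoalgD(1)[OF C]]) blast
  have "comult x \<in> tensor_square_image scale C" if x: "x \<in> C" for x
  proof -
    define q where "q = lin_ext fscale (\<lambda>(a, b). Poly_Mapping.single (t a, t b) 1) (rep x)"
    have q: "lin_ext (*) (\<lambda>(a, b). \<phi> a b) q = lin_ext (*) (\<lambda>(a, b). \<phi> (t a) (t b)) (rep x)" for \<phi> :: "'h \<Rightarrow> 'h \<Rightarrow> 'k"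
      unfolding q_def lin_ext_lin_ext[OF lin_lin_ext[OF vector_space_times]]
      by (simp add: case_prod_unfold lin_ext_single[OF vector_space_times])
    have "rep x - q \<in> tensor_null scale"
    proof (rule tensor_nullI[OF vector_space_axioms])
      fix \<phi> :: "'h \<Rightarrow> 'h \<Rightarrow> 'k" assume \<phi>: "bilin scale (*) \<phi>"
      have b: "bilin scale (*) (\<lambda>a b. \<phi> (t a) (t b))"
        by (intro bilinI lin_bilin1[OF \<phi>] lin_bilin2[OF \<phi>] t)
      have "cm \<phi> x = cm (\<lambda>a b. \<phi> (t a) (t b)) x"
        by (rule subcoalg_cm_eq[OF C x \<phi> b]) (simp add: t(3))
      thus "lin_ext (*) (\<lambda>(a, b). \<phi> a b) (rep x - q) = 0"
        by (simp add: linD(6)[OF lin_lin_ext[OF vector_space_times]] q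
            sweedler_eq_lin_ext[OF \<phi> rep] sweedler_eq_lin_ext[OF b rep])
    qed
    hence "q \<in> comult x" by (rule comultI[OF rep])
    moreover have "Poly_Mapping.keys q \<subseteq> C \<times> C"
    proof -
      have "Poly_Mapping.keys (fscale c (Poly_Mapping.single (t a, t b) 1)) \<subseteq> C \<times> C" for a b c
        by (auto simp: fscale_single t(2))
      thus ?thesis
        unfolding q_def lin_ext_def
        by (intro order.trans[OF keys_sum]) (auto simp: case_prod_unfold)
    qed
    ultimately show ?thesis using comult_closed by (auto simp: tensor_square_image_def)
  qed
  thus "subcoalgebra scale comult C" using subcoalgD(1)[OF C] by (simp add: subcoalgebra_def)
qed

lemma coradical_eq: "coradical scale comult = corad"
  by (simp add: coradical_def corad_def simple_subcoalgebra_def simple_subcoalg_def subcoalgebra_iff)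

lemma subalgebra_iff: "subalgebra scale = subalg"
  by (auto simp: subalgebra_def subalg_def fun_eq_iff)

lemma affine_iff: "affine_algebra scale A \<longleftrightarrow> (\<exists>F. finite F \<and> A = subalg hull F)"
  by (auto simp: affine_algebra_def subalgebra_iff subalg_hull)

lemma noethI: "left_noetherian TYPE('h) \<Longrightarrow> noeth"
proof -
  assume n: "left_noetherian TYPE('h)"
  have l: "lideal = left_ideal" by (auto simp: lideal_def left_ideal_def fun_eq_iff)
  show noeth
    unfolding noeth_def l
  proof (intro allI impI)
    fix I :: "'h set" assume "left_ideal I"
    then obtain F where "finite F" "I = left_ideal hull F" using n by (auto simp: left_noetherian_def)
    thus "\<exists>F. finite F \<and> F \<subseteq> I \<and> (\<forall>J. left_ideal J \<longrightarrow> F \<subseteq> J \<longrightarrow> I \<subseteq> J)"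
      using hull_subset[of F left_ideal] hull_minimal[of F _ left_ideal] by blast
  qed
qed

lemma noeth_opI:
  assumes n: "right_noetherian TYPE('h)"
  shows "hopf.noeth (\<lambda>x y :: 'h. y * x)"
proof -
  interpret c: hopf scale "swap_delta delta" counit "\<lambda>x y. y * x" 1 antipode by (rule hopf_op_cop)
  have l: "c.lideal = right_ideal" by (auto simp: c.lideal_def right_ideal_def fun_eq_iff)
  show ?thesis
    unfolding c.noeth_def l
  proof (intro allI impI)
    fix I :: "'h set" assume "right_ideal I"
    then obtain F where "finite F" "I = right_ideal hull F" using n by (auto simp: right_noetherian_def)
    thus "\<exists>F. finite F \<and> F \<subseteq> I \<and> (\<forall>J. right_ideal J \<longrightarrow> F \<subseteq> J \<longrightarrow> I \<subseteq> J)"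
      using hull_subset[of F right_ideal] hull_minimal[of F _ right_ideal] by blast
  qed
qed

end

theorem theoremB:
  fixes scale :: "'k::field \<Rightarrow> 'h::ring_1 \<Rightarrow> 'h"
    and comult :: "'h \<Rightarrow> ('h \<times> 'h \<Rightarrow>\<^sub>0 'k) set"
    and counit :: "'h \<Rightarrow> 'k"
    and antipode :: "'h \<Rightarrow> 'h"
  assumes "hopf_algebra scale comult counit antipode"
    and "left_noetherian TYPE('h) \<or> right_noetherian TYPE('h)"
  shows "(affine_algebra scale (UNIV :: 'h set) \<longleftrightarrow>
            affine_algebra scale (hopf_coradical scale comult))
       \<and> (affine_algebra scale (hopf_coradical scale comult) \<longleftrightarrow>
            (\<exists>A. hopf_subalgebra scale comult antipode A \<and> affine_algebra scale A
                 \<and> coradical scale comult \<subseteq> A))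
       \<and> (affine_algebra scale (UNIV :: 'h set) \<longrightarrow>
            (\<forall>A. hopf_subalgebra scale comult antipode A \<and> coradical scale comult \<subseteq> A
                 \<longrightarrow> affine_algebra scale A))"
proof -
  interpret hopf_algebra scale comult counit antipode by fact
  let ?H0 = "subalg hull corad"
  have n: "noeth \<or> hopf.noeth (\<lambda>x y :: 'h. y * x)" using assms(2) noethI noeth_opI by blast
  have hs: "hopf_subalgebra scale comult antipode A \<longleftrightarrow> subalg A \<and> subcoalg A \<and> antipode ` A \<subseteq> A" for A
    by (simp add: hopf_subalgebra_def subalgebra_iff subcoalgebra_iff)
  have hc: "hopf_coradical scale comult = ?H0"
    by (simp add: hopf_coradical_def subalgebra_iff coradical_eq)
  \<comment> \<open>Stability under the antipode comes from its injectivity, hence from the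
    Noetherian hypothesis.\<close>
  have H0: "subcoalg ?H0" "subalg ?H0" "antipode ` ?H0 \<subseteq> ?H0" "corad \<subseteq> ?H0"
    by (rule subcoalg_subalg_hull[OF subcoalg_corad] subalg_hull hull_subset
        S_hopf_coradical[OF inj_antipode'[OF n]])+
  have U: "subcoalg UNIV" "subalg UNIV" by (simp_all add: subcoalg_def subalg_def)
  have step: "affine_algebra scale K"
    if "subalg K0" "subcoalg K0" "antipode ` K0 \<subseteq> K0" "corad \<subseteq> K0" "affine_algebra scale K0"
      "subcoalg K" "subalg K" "K0 \<subseteq> K" for K0 K
    using affine_step[OF n that(2,1,3,4) _ _ that(6-8)] that(5) unfolding affine_iff by blast
  have ab: "affine_algebra scale ?H0" if "affine_algebra scale (UNIV :: 'h set)"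
    using that hopf_coradical_finitely_generated unfolding affine_iff by metis
  have "affine_algebra scale K"
    if "affine_algebra scale (UNIV :: 'h set)" "subalg K" "subcoalg K" "corad \<subseteq> K" for K
  proof (rule step[OF H0(2,1,3,4) ab[OF that(1)] that(3,2)])
    show "?H0 \<subseteq> K" using that(4,2) by (rule hull_minimal)
  qed
  \<comment> \<open>From (c) to (a): the whole algebra is a subbialgebra containing
    \<open>A\<close>.\<close>
  moreover have "affine_algebra scale (UNIV :: 'h set)"
    if "subalg A" "subcoalg A" "antipode ` A \<subseteq> A" "affine_algebra scale A" "corad \<subseteq> A" for A
    by (rule step[OF that(1,2,3,5,4) U subset_UNIV])
  \<comment> \<open>From (b) to (c) the Hopf coradical itself serves as the Hopf subalgebra.\<close>
  ultimately show ?thesis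
    unfolding hs hc coradical_eq using ab H0 by blast
qed

end
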